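(* Suppose that $(W(x),\mathfrak D)$ is a real $2\times2$ hypergeometric matrix Bochner pair corresponding to a point $(a,b,c,d,\lambda,B(0)_{11},B(0)_{12},B(0)_{21},B(0)_{22})$ in the classifying space $\mathcal E$ (see context). Then the corresponding weight matrix $W(x)$ is of the form $$W(x)=Q(x)(1-x)^{-\lambda/2-1-\gamma/2-\sigma_-/2}(1+x)^{-\lambda/2-1+\gamma/2-\sigma_+/2}$$ for some symmetric, matrix-valued rational function $Q(x)$ and integers $\sigma_\pm\in\{0,1\}$. Here $$\gamma=\tfrac12\operatorname{tr}(A_{11}B(0))=\tfrac12\big((\lambda+d)B(0)_{11}+(b+c)B(0)_{21}+(b-c)B(0)_{12}+(\lambda-d)B(0)_{22}\big),$$ and in particular $\det(W(x))=(1-x)^{-\lambda-2-\gamma}(1+x)^{-\lambda-2+\gamma}$. Furthermore, for each of the families (I)-(III) defining $\mathcal E$, we have the following expressions for the corresponding matrix Bochner pairs (up to similarity of $W(x)$), where we write $B_{ij}=B(0)_{ij}$. (I) $\sigma_-=0$, $\sigma_+=0$, $\gamma=arB_{22}$ and $$Q(x)_{11}=(1+Q(x)_{12}^2)/Q(x)_{22},\qquad Q(x)_{12}=\frac{1}{(1-x^2)s}\left(-arB_{22}+arx-(r-2)x\right),$$ $$Q(x)_{22}=\frac{1}{(1-x^2)s}\cdot\frac{-r^2aB_{22}^2+(a-1)\left(r(r-2)B_{22}x+(r-2)(x^2+1)\right)+4a}{(a-1)r+2a},$$ $$\mathfrak D=\partial_x^2(1-x^2)I+\partial_x\begin{pmatrix}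 x\lambda-B_{22}\lambda\frac{a+1}{a-1} & -2a-\lambda \\ \frac{1}{2a+\lambda}\left(B_{22}^2\frac{\lambda^2}{(a-1)^2}-4\right) & \lambda x-B_{22}\lambda \end{pmatrix}+\begin{pmatrix} a & 0 \\ 0 & -a \end{pmatrix},$$ where $r=\frac{\lambda}{a-1}$ and $s^2=\frac{(r-2)(a-1)((r+2)a-(r-2))}{4-r^2B_{22}^2}$. (II) $\sigma_-=0$, $\sigma_+=1$, $\gamma=r(1-2aB_{21})+\lambda$ and $$Q(x)_{11}=((1+x)^{-1}+Q(x)_{12}^2)/Q(x)_{22},\qquad Q(x)_{12}=\frac{1/2}{(1-x^2)s}\left(4arB_{21}-8a+2x\lambda+3x+2\lambda+3\right),$$ $$Q(x)_{22}=\frac{1}{(1-x^2)s}\left(4arB_{21}-4ax+3x+2\lambda+3\right),$$ $$\mathfrak D=\partial_x^2(1-x^2)I+\partial_x(x+1)\begin{pmatrix} \lambda-1/2 & 2 \\ 0 & \lambda+1/2 \end{pmatrix}+\partial_x\begin{pmatrix} (2a+1)rB_{21}-4a & -2rB_{21}+4 \\ (r/2)B_{21} & (2a-1)rB_{21}-4a+2 \end{pmatrix}+\begin{pmatrix} a & 0 \\ 0 & -a \end{pmatrix},$$ where $r=4a-2\lambda-1$ and $s^2=\frac{4a(3-4a+2\lambda)}{B_{21}r}$. (III) $\sigma_-=1$, $\sigma_+=1$, $\gamma=\frac{(\lambda+1)r\left(B_{21}^2\lambda^2+(b-1)(r^2-1)\right)}{B_{21}^2\lambda^2-(b-1)(r^2-1)}$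 and $$Q(x)_{11}=((1-x^2)^{-1}+Q(x)_{12}^2)/Q(x)_{22},\qquad Q(x)_{12}=\frac{1}{s}\left(B_{21}^2\lambda^2(x-r)+(b-1)(x+r)(1-r^2)\right),$$ $$Q(x)_{22}=\frac{B_{21}\lambda}{s}\left(B_{21}^2\lambda^2+(b-1)(r^2+2xr+1)\right),$$ \begin{align*} \mathfrak D&=\partial_x^2(1-x^2)I+\partial_xx\begin{pmatrix} \frac{B_{21}\lambda^2r-B_{21}^2\lambda^2+(b-1)(r^2-1)}{B_{21}\lambda r} & 2 \\ 2b-2 & \frac{B_{21}\lambda^2r+B_{21}^2\lambda^2-(b-1)(r^2-1)}{B_{21}\lambda r} \end{pmatrix}\\ &+\partial_x\begin{pmatrix} B_{21}-\lambda r-2r & -\frac{B_{21}\lambda(r^2+1)-r(r^2-1)}{B_{21}\lambda r} \\ \frac{B_{21}\lambda(B_{21}\lambda-r)}{r} & -\lambda(B_{21}+r) \end{pmatrix}\\ &+\partial_x(b-1)(1-r^2)\begin{pmatrix} \frac{-B_{21}^2\lambda^2+2B_{21}r\lambda(\lambda+1)}{B_{21}\lambda((b-1)(1-r^2)+B_{21}^2\lambda^2)} & \frac{(r-1)(r+1)}{B_{21}^2\lambda^2r} \\ \frac{r^2+1}{r(1-r^2)} & \frac{B_{21}^2\lambda^2+2B_{21}\lambda r(\lambda+1)}{B_{21}\lambda((b-1)(1-r^2)+B_{21}^2\lambda^2)} \end{pmatrix}\\ &+\partial_x\frac{-(b-1)^2(1-r^2)^2}{B_{21}\lambda((b-1)(1-r^2)+B_{21}^2\lambda^2)}\begin{pmatrix}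 1 & 0 \\ 0 & -1 \end{pmatrix}\\ &+\frac{(\lambda+1)((b-1)(r-1)^2+B_{21}^2\lambda^2)((b-1)(r+1)^2+B_{21}^2\lambda^2)}{2B_{21}\lambda r((b-1)(1-r^2)+B_{21}^2\lambda^2)}\begin{pmatrix} 1 & 0 \\ 0 & -1 \end{pmatrix}, \end{align*} where $r^2=1-\lambda^2B_{12}B_{21}$ and $s^2=(B_{21}^2\lambda^2+(b-1)(r-1)^2)(B_{21}^2\lambda^2+(b-1)(r+1)^2)$.
   Context: A $2\times2$ weight matrix (in the hypergeometric setting) is a smooth function $W$ on $\mathbb R$ with values in $M_2(\mathbb C)$ which is Hermitian and positive definite on $(-1,1)$, identically zero outside $(-1,1)$, and has finite moments. It defines $\langle P,Q\rangle_W=\int P(x)W(x)Q(x)^*dx$ on $M_2(\mathbb C[x])$. Matrix differential operators act on the right: for $\mathfrak D=\sum_m\partial_x^mA_m(x)$, $P\cdot\mathfrak D=\sum_mP^{(m)}(x)A_m(x)$. A hypergeometric matrix Bochner pair is a pair $(W,\mathfrak D)$ with $\mathfrak D=\partial_x^2(1-x^2)I+\partial_x(A_{11}x+A_{10})+A_0$ ($A_{11},A_{10},A_0$ constant $2\times2$ matrices) such that $\langle P\cdot\mathfrak D,Q\rangle_W=\langle P,Q\cdot\mathfrak D\rangle_W$ for all $P,Q\in M_2(\mathbb C[x])$. It is real if $W$ and $\mathfrak D$ are both real, and reducible if it is equivalent to a direct sum of two scalar pairs. Pairs are considered up to translation $(W,\mathfrak D)\mapsto(W,\mathfrak D+\alpha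 I)$ ($\alpha\in\mathbb R$), conjugation $(W,\mathfrak D)\mapsto(UWU^*,U\mathfrak DU^{-1})$ ($U$ a constant invertible matrix) and reflection (induced by $x\mapsto-x$). "Up to similarity of $W(x)$" means up to $W\mapsto UWU^*$ with $U$ a constant invertible matrix. Coordinates: up to these equivalences $$A_{11}=\begin{pmatrix} \lambda+d & b+c \\ b-c & \lambda-d \end{pmatrix},\quad A_0=\begin{pmatrix} a & 0 \\ 0 & -a \end{pmatrix},\quad B(0)=\left(\int xW\,dx\right)\left(\int W\,dx\right)^{-1},\quad A_{10}=[B(0),A_0]-A_{11}B(0).$$ A pair is determined, up to similarity of $W$, by $A_{11}$, $A_0$ and $B(0)$. The classifying space $\mathcal E\subset\mathbb R^9$ of irreducible real $2\times 2$ hypergeometric matrix Bochner pairs (up to translation, conjugation and reflection) is an open subset of a real algebraic set, given by tuples $(a,b,c,d,\lambda,B(0)_{11},B(0)_{12},B(0)_{21},B(0)_{22})$ satisfying one of the following: (I) $b=c=0$, $d=0$, $(a-1)B(0)_{11}=(a+1)B(0)_{22}$, $B(0)_{22}^2\lambda^2=((4a^2-\lambda^2)B(0)_{21}+4)(a-1)^2$, $B(0)_{12}=1$. (II) $c=2-b$, $b=1$, $d=-1/2$, $B(0)_{11}=(4a+2)B(0)_{21}-1+8a\frac{1-2aB(0)_{21}}{2\lambda-1}$, $B(0)_{22}=(4a-2)B(0)_{21}-1+(8a-4)\frac{1-2aB(0)_{21}}{2\lambda+1}$, $B(0)_{12}=-4B(0)_{21}-8\frac{1-2aB(0)_{21}}{2\lambda+1}$.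 (III) $c=2-b$, $2ad+(\lambda+1)(4(b-1)+d^2)=0$, $B(0)_{11}d=((b-1)B(0)_{12}-B(0)_{21})\lambda-2B(0)_{21}$, $B(0)_{22}d=((b-1)B(0)_{12}-B(0)_{21})\lambda+2(b-1)B(0)_{12}$, $d^2=\lambda^2\frac{(B(0)_{21}+(b-1)B(0)_{12})^2}{1-\lambda^2B(0)_{12}B(0)_{21}}$.
   Formalization: Corrected: signs of γ and σ± in exponents and det reversed; det up to a constant; (I) formulas need a≠1; (II) Q22 gains −4a+2xλ, s² loses factor 4; (III) Q12, Q22 gain 1/(1−x²), operator entry B21−λr−2r becomes B21λ−λr−2r; W smooth only on (−1,1). *)

theory Defs
  imports "HOL-Analysis.Analysis" "HOL-Computational_Algebra.Polynomial"
begin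

section \<open>Matrices\<close>

definition mat2 :: "'a::zero \<Rightarrow> 'a \<Rightarrow> 'a \<Rightarrow> 'a \<Rightarrow> 'a^2^2" where
  "mat2 p q r s = vector [vector [p, q], vector [r, s]]"

definition ctranspose :: "complex^'n^'m \<Rightarrow> complex^'m^'n" where
  "ctranspose A = (\<chi> i j. cnj (A $ j $ i))"

definition cmat :: "real^'n^'m \<Rightarrow> complex^'n^'m" where
  "cmat A = (\<chi> i j. complex_of_real (A $ i $ j))"

definition hermitian :: "complex^'n^'n \<Rightarrow> bool" where
  "hermitian A \<longleftrightarrow> ctranspose A = A"

definition positive_definite :: "complex^'n^'n \<Rightarrow> bool" where
  "positive_definite A \<longleftrightarrow>
     hermitian A \<and> (\<forall>v. v \<noteq> 0 \<longrightarrow> 0 < Re (\<Sum>i\<in>UNIV. \<Sum>j\<in>UNIV. v $ i * A $ i $ j * cnj (v $ j)))"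


section \<open>Weight matrices\<close>

text \<open>
  Smoothness is required on the open interval $(-1,1)$ only: outside it the weight vanishes
  identically, and already the Jacobi weights $(1-x)^\alpha(1+x)^\beta$ are in general
  not even continuous at $\pm1$.
\<close>

definition smooth_inside :: "(real \<Rightarrow> 'a::real_normed_vector) \<Rightarrow> bool" where
  "smooth_inside W \<longleftrightarrow>
     (\<exists>F :: nat \<Rightarrow> real \<Rightarrow> 'a. F 0 = W \<and>
        (\<forall>k. \<forall>x\<in>{-1<..<1}. (F k has_vector_derivative F (Suc k) x) (at x)))"

definition weight_matrix :: "(real \<Rightarrow> complex^'n^'n) \<Rightarrow> bool" where
  "weight_matrix W \<longleftrightarrow>
     smooth_inside W \<and>
     (\<forall>x\<in>{-1<..<1}. positive_definite (W x)) \<and>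
     (\<forall>x. x \<notin> {-1<..<1} \<longrightarrow> W x = 0) \<and>
     (\<forall>n::nat. integrable lborel (\<lambda>x. x ^ n *\<^sub>R W x))"

definition moment :: "(real \<Rightarrow> complex^'n^'n) \<Rightarrow> nat \<Rightarrow> complex^'n^'n" where
  "moment W n = (LINT x|lborel. x ^ n *\<^sub>R W x)"

definition poly_mat :: "(complex poly)^'n^'m \<Rightarrow> real \<Rightarrow> complex^'n^'m" where
  "poly_mat P x = (\<chi> i j. poly (P $ i $ j) (complex_of_real x))"

definition weight_inner ::
  "(real \<Rightarrow> complex^'n^'n) \<Rightarrow> (complex poly)^'n^'n \<Rightarrow> (complex poly)^'n^'n \<Rightarrow> complex^'n^'n" where
  "weight_inner W P Q = (LINT x|lborel. poly_mat P x ** W x ** ctranspose (poly_mat Q x))"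


section \<open>Matrix differential operators\<close>

text \<open>
  The list $[A_0, A_1, \dots, A_k]$ stands for the operator $\sum_m \partial_x^m A_m(x)$, which
  acts on matrix polynomials from the right.
\<close>

type_synonym 'n diff_op = "((complex poly)^'n^'n) list"

definition pderiv_mat :: "nat \<Rightarrow> (complex poly)^'n^'m \<Rightarrow> (complex poly)^'n^'m" where
  "pderiv_mat m P = (\<chi> i j. (pderiv ^^ m) (P $ i $ j))"

definition act :: "(complex poly)^'n^'n \<Rightarrow> 'n::finite diff_op \<Rightarrow> (complex poly)^'n^'n" where
  "act P D = (\<Sum>m<length D. pderiv_mat m P ** (D ! m))"

definition const_mat :: "complex^'n^'m \<Rightarrow> (complex poly)^'n^'m" where
  "const_mat A = (\<chi> i j. [:A $ i $ j:])"

text \<open>$\partial_x^2 (1-x^2) I + \partial_x (A_{11} x + A_{10}) + A_0$\<close>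

definition hyp_op :: "complex^'n^'n \<Rightarrow> complex^'n^'n \<Rightarrow> complex^'n^'n \<Rightarrow> 'n::finite diff_op" where
  "hyp_op A11 A10 A0 = [const_mat A0, (\<chi> i j. [:A10 $ i $ j, A11 $ i $ j:]), mat [:1, 0, -1:]]"

definition bochner_pair :: "(real \<Rightarrow> complex^'n^'n) \<Rightarrow> 'n::finite diff_op \<Rightarrow> bool" where
  "bochner_pair W D \<longleftrightarrow>
     weight_matrix W \<and> (\<exists>A11 A10 A0. D = hyp_op A11 A10 A0) \<and>
     (\<forall>P Q. weight_inner W (act P D) Q = weight_inner W P (act Q D))"

definition real_pair :: "(real \<Rightarrow> complex^'n^'n) \<Rightarrow> 'n::finite diff_op \<Rightarrow> bool" where
  "real_pair W D \<longleftrightarrow>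
     (\<forall>x i j. W x $ i $ j \<in> \<real>) \<and> (\<forall>A\<in>set D. \<forall>i j n. coeff (A $ i $ j) n \<in> \<real>)"


section \<open>Equivalence and reducibility\<close>

definition conj_weight :: "complex^'n^'n \<Rightarrow> (real \<Rightarrow> complex^'n^'n) \<Rightarrow> real \<Rightarrow> complex^'n^'n" where
  "conj_weight U W x = U ** W x ** ctranspose U"

definition conj_op :: "complex^'n^'n \<Rightarrow> 'n::finite diff_op \<Rightarrow> 'n diff_op" where
  "conj_op U D = map (\<lambda>A. const_mat U ** A ** const_mat (matrix_inv U)) D"

definition translate_op :: "real \<Rightarrow> 'n::finite diff_op \<Rightarrow> 'n diff_op" where
  "translate_op \<alpha> D = D[0 := D ! 0 + mat [:complex_of_real \<alpha>:]]"

definition reflect_op :: "'n::finite diff_op \<Rightarrow> 'n diff_op" where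
  "reflect_op D =
     map (\<lambda>m. \<chi> i j. smult ((-1) ^ m) (pcompose (D ! m $ i $ j) [:0, -1:])) [0..<length D]"

inductive pair_equiv ::
  "(real \<Rightarrow> complex^'n^'n) \<times> 'n::finite diff_op \<Rightarrow> (real \<Rightarrow> complex^'n^'n) \<times> 'n diff_op \<Rightarrow> bool" where
  refl: "pair_equiv p p"
| translation: "pair_equiv p (W, D) \<Longrightarrow> pair_equiv p (W, translate_op \<alpha> D)"
| conjugation: "pair_equiv p (W, D) \<Longrightarrow> invertible U \<Longrightarrow> pair_equiv p (conj_weight U W, conj_op U D)"
| reflection: "pair_equiv p (W, D) \<Longrightarrow> pair_equiv p (\<lambda>x. W (- x), reflect_op D)"

definition direct_sum :: "'a::zero^1^1 \<Rightarrow> 'a^1^1 \<Rightarrow> 'a^2^2" where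
  "direct_sum A B = mat2 (A $ 1 $ 1) 0 0 (B $ 1 $ 1)"

definition reducible_pair :: "(real \<Rightarrow> complex^2^2) \<Rightarrow> 2 diff_op \<Rightarrow> bool" where
  "reducible_pair W D \<longleftrightarrow>
     (\<exists>w1 (d1 :: 1 diff_op) w2 (d2 :: 1 diff_op). bochner_pair w1 d1 \<and> bochner_pair w2 d2 \<and>
        pair_equiv (W, D) (\<lambda>x. direct_sum (w1 x) (w2 x), map2 direct_sum d1 d2))"


section \<open>The classifying space\<close>

text \<open>
  Points are tuples $(a,b,c,d,\lambda,B_{11},B_{12},B_{21},B_{22})$, where $B = B(0)$ is the
  quotient of the first two moments of the weight.
\<close>

type_synonym point =
  "real \<times> real \<times> real \<times> real \<times> real \<times> real \<times> real \<times> real \<times> real"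

definition A11_of :: "real \<Rightarrow> real \<Rightarrow> real \<Rightarrow> real \<Rightarrow> real^2^2" where
  "A11_of b c d l = mat2 (l + d) (b + c) (b - c) (l - d)"

definition A0_of :: "real \<Rightarrow> real^2^2" where
  "A0_of a = mat2 a 0 0 (- a)"

definition A10_of :: "real^2^2 \<Rightarrow> real^2^2 \<Rightarrow> real^2^2 \<Rightarrow> real^2^2" where
  "A10_of A11 A0 B = (B ** A0 - A0 ** B) - A11 ** B"

fun has_coordinates :: "(real \<Rightarrow> complex^2^2) \<Rightarrow> 2 diff_op \<Rightarrow> point \<Rightarrow> bool" where
  "has_coordinates W D (a, b, c, d, l, B11, B12, B21, B22) \<longleftrightarrow>
     (let A11 = A11_of b c d l; A0 = A0_of a; B = mat2 B11 B12 B21 B22 in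
        D = hyp_op (cmat A11) (cmat (A10_of A11 A0 B)) (cmat A0) \<and>
        moment W 1 ** matrix_inv (moment W 0) = cmat B)"

definition corresponds_to :: "(real \<Rightarrow> complex^2^2) \<Rightarrow> 2 diff_op \<Rightarrow> point \<Rightarrow> bool" where
  "corresponds_to W D p \<longleftrightarrow>
     bochner_pair W D \<and> real_pair W D \<and> \<not> reducible_pair W D \<and> has_coordinates W D p"

text \<open>
  Where a defining equation of one of the families contains a quotient, the denominator is
  required not to vanish.
\<close>

fun family_I :: "point \<Rightarrow> bool" where
  "family_I (a, b, c, d, l, B11, B12, B21, B22) \<longleftrightarrow>
     b = 0 \<and> c = 0 \<and> d = 0 \<and>
     (a - 1) * B11 = (a + 1) * B22 \<and>
     B22\<^sup>2 * l\<^sup>2 = ((4 * a\<^sup>2 - l\<^sup>2) * B21 + 4) * (a - 1)\<^sup>2 \<and>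
     B12 = 1"

fun family_II :: "point \<Rightarrow> bool" where
  "family_II (a, b, c, d, l, B11, B12, B21, B22) \<longleftrightarrow>
     c = 2 - b \<and> b = 1 \<and> d = - 1 / 2 \<and>
     2 * l - 1 \<noteq> 0 \<and> 2 * l + 1 \<noteq> 0 \<and>
     B11 = (4 * a + 2) * B21 - 1 + 8 * a * ((1 - 2 * a * B21) / (2 * l - 1)) \<and>
     B22 = (4 * a - 2) * B21 - 1 + (8 * a - 4) * ((1 - 2 * a * B21) / (2 * l + 1)) \<and>
     B12 = - 4 * B21 - 8 * ((1 - 2 * a * B21) / (2 * l + 1))"

fun family_III :: "point \<Rightarrow> bool" where
  "family_III (a, b, c, d, l, B11, B12, B21, B22) \<longleftrightarrow>
     c = 2 - b \<and>
     2 * a * d + (l + 1) * (4 * (b - 1) + d\<^sup>2) = 0 \<and>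
     B11 * d = ((b - 1) * B12 - B21) * l - 2 * B21 \<and>
     B22 * d = ((b - 1) * B12 - B21) * l + 2 * (b - 1) * B12 \<and>
     1 - l\<^sup>2 * B12 * B21 \<noteq> 0 \<and>
     d\<^sup>2 = l\<^sup>2 * ((B21 + (b - 1) * B12)\<^sup>2 / (1 - l\<^sup>2 * B12 * B21))"

definition classifying_space :: "point set" where
  "classifying_space =
     {p. (family_I p \<or> family_II p \<or> family_III p) \<and> (\<exists>W D. corresponds_to W D p)}"


section \<open>The explicit form of the weights\<close>

definition gamma_of :: "real^2^2 \<Rightarrow> real^2^2 \<Rightarrow> real" where
  "gamma_of A11 B = 1 / 2 * trace (A11 ** B)"

text \<open>
  The signs of $\gamma$ and $\sigma_\pm$ are forced. The symmetry of the operator gives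
  $(\det((1-x^2)W))' = \frac{2\lambda x-2\gamma}{1-x^2}\det((1-x^2)W)$, whence
  $\det W = (1-x)^{-\lambda-2+\gamma}(1+x)^{-\lambda-2-\gamma}$ up to a constant factor, and
  the matrices $Q$ below have determinant $(1-x)^{-\sigma_-}(1+x)^{-\sigma_+}$.
\<close>

definition jacobi_factor :: "real \<Rightarrow> real \<Rightarrow> int \<Rightarrow> int \<Rightarrow> real \<Rightarrow> real" where
  "jacobi_factor l g \<sigma>m \<sigma>p x =
     (1 - x) powr (- l / 2 - 1 + g / 2 + real_of_int \<sigma>m / 2) *
     (1 + x) powr (- l / 2 - 1 - g / 2 + real_of_int \<sigma>p / 2)"

definition rational_on_interval :: "(real \<Rightarrow> real^2^2) \<Rightarrow> bool" where
  "rational_on_interval Q \<longleftrightarrow>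
     (\<forall>i j. \<exists>p q :: real poly. \<forall>x\<in>{-1<..<1}. poly q x \<noteq> 0 \<and> Q x $ i $ j = poly p x / poly q x)"

definition weight_of_form ::
  "(real \<Rightarrow> complex^2^2) \<Rightarrow> real \<Rightarrow> real \<Rightarrow> int \<Rightarrow> int \<Rightarrow> (real \<Rightarrow> real^2^2) \<Rightarrow> bool" where
  "weight_of_form W l g \<sigma>m \<sigma>p Q \<longleftrightarrow>
     (\<forall>x\<in>{-1<..<1}. W x = jacobi_factor l g \<sigma>m \<sigma>p x *\<^sub>R cmat (Q x))"

definition similar_to_form ::
  "(real \<Rightarrow> complex^2^2) \<Rightarrow> real \<Rightarrow> real \<Rightarrow> int \<Rightarrow> int \<Rightarrow> (real \<Rightarrow> real^2^2) \<Rightarrow> bool" where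
  "similar_to_form W l g \<sigma>m \<sigma>p Q \<longleftrightarrow>
     (\<exists>U. invertible U \<and> weight_of_form (conj_weight U W) l g \<sigma>m \<sigma>p Q)"

text \<open>The symmetric matrix with entries $q_{12}$, $q_{22}$ and determinant \<open>\<delta>\<close>.\<close>

definition sym_with_det :: "real \<Rightarrow> real \<Rightarrow> real \<Rightarrow> real^2^2" where
  "sym_with_det \<delta> q12 q22 = mat2 ((\<delta> + q12\<^sup>2) / q22) q12 q12 q22"

definition Q_I :: "real \<Rightarrow> real \<Rightarrow> real \<Rightarrow> real \<Rightarrow> real \<Rightarrow> real^2^2" where
  "Q_I a r B22 s x = sym_with_det 1
     (1 / ((1 - x\<^sup>2) * s) * (- a * r * B22 + a * r * x - (r - 2) * x))
     (1 / ((1 - x\<^sup>2) * s) *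
        ((- r\<^sup>2 * a * B22\<^sup>2 + (a - 1) * (r * (r - 2) * B22 * x + (r - 2) * (x\<^sup>2 + 1)) + 4 * a)
          / ((a - 1) * r + 2 * a)))"

definition Q_II :: "real \<Rightarrow> real \<Rightarrow> real \<Rightarrow> real \<Rightarrow> real \<Rightarrow> real \<Rightarrow> real^2^2" where
  "Q_II a l r B21 s x = sym_with_det (1 / (1 + x))
     ((1 / 2) / ((1 - x\<^sup>2) * s) * (4 * a * r * B21 - 8 * a + 2 * x * l + 3 * x + 2 * l + 3))
     (1 / ((1 - x\<^sup>2) * s) * (4 * a * r * B21 - 4 * a * x - 4 * a + 2 * x * l + 3 * x + 2 * l + 3))"

definition Q_III :: "real \<Rightarrow> real \<Rightarrow> real \<Rightarrow> real \<Rightarrow> real \<Rightarrow> real \<Rightarrow> real^2^2" where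
  "Q_III b l r B21 s x = sym_with_det (1 / (1 - x\<^sup>2))
     (1 / ((1 - x\<^sup>2) * s) * (B21\<^sup>2 * l\<^sup>2 * (x - r) + (b - 1) * (x + r) * (1 - r\<^sup>2)))
     (B21 * l / ((1 - x\<^sup>2) * s) * (B21\<^sup>2 * l\<^sup>2 + (b - 1) * (r\<^sup>2 + 2 * x * r + 1)))"

end

theory Submission
  imports Defs
begin

text \<open>
  Let $u, v, v, z$ be the entries of $W$ and $p, q, r, t$ those of $A(x) = A_{11}x + A_{10}$, row by
  row, and put $U, V, Z = (1-x^2)u, (1-x^2)v, (1-x^2)z$. Testing the symmetry
  of the operator against polynomials gives integral identities which, by the Weierstrass theorem,
  turn into a pointwise linear system with zero boundary values (\<open>weak_derivative\<close>, the locale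
  \<open>jacobi_pair\<close>):
  $U' = pu + qv$, $2V' = pv + qz + ru + tv$, $Z' = rv + tz$, and $j' = 4av$ for the antisymmetric
  part $j = qz - ru + (p-t)v$ of $AW$. Liouville's formula for this system gives the determinant
  (\<open>det_of_trace\<close>). Differentiating $(1-x^2)j$ yields one more linear relation
  (\<open>second_relation\<close>).

  If $a = 0$, then $j$ is a constant with boundary value zero, so both coefficients of $A$ are
  self-adjoint for every $W(x)$; their common eigenrows split the pair
  (\<open>reducible_of_zero_constant_term\<close>). Hence $a \neq 0$. Suppose now that $4aV = \eta j$ with a
  linear polynomial $\eta$. Then $(1-x^2)j' = \eta j$, so $j$ is a multiple of a Jacobi factor
  $(1-x)^\alpha(1+x)^\beta$, and the system expresses $V$, $Z$ and the determinant as polynomials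
  times powers of $j$ (\<open>solution_diagonal\<close>, \<open>solution_determinant\<close>). A diagonal
  similarity absorbs the remaining constant factors (\<open>similar_of_solution\<close>); the same expressions show that $W$ is
  the Jacobi factor times a rational matrix (\<open>rational_of_solution\<close>).

  It remains to find $\eta$. For the first family $4aV = \eta j$ is the second relation itself. For
  the other two consider the defect $T = \eta j - 4aV$. It satisfies more homogeneous linear
  equations than an unknown function can: eliminating, a polynomial times $T$ vanishes. For generic
  parameters this polynomial is not zero, so $T = 0$. For exceptional ones $T$ is
  itself a Jacobi factor, and then the boundary values or the first moments of the weight, which
  the coordinates $B(0)$ prescribe (\<open>moments\<close>), exclude $T \neq 0$
  (\<open>first_order_family_II\<close>, \<open>T_zero_coupled\<close>, \<open>T_zero_uncoupled\<close>).
  The solution of the third family needs $d \neq 0$; for $d = 0$ the system is solved directly and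
  contradicts positivity, or the operator would have a polynomial eigenfunction with a non-real
  eigenvalue (\<open>family_III_nonzero\<close>).
\<close>

section \<open>From weak to pointwise differential equations\<close>

text \<open>
  Multiplication by the reciprocal Jacobi factor is the integrating factor of the equation. All
  scalar equations below are of this type.
\<close>
lemma jacobi_first_order:
  fixes f f' :: "real \<Rightarrow> real"
  assumes f: "\<And>x. x \<in> {-1<..<1} \<Longrightarrow> (f has_real_derivative f' x) (at x)"
    and ode: "\<And>x. x \<in> {-1<..<1} \<Longrightarrow> (1 - x\<^sup>2) * f' x = (\<alpha> * x + \<beta>) * f x"
  obtains C where "\<And>x. x \<in> {-1<..<1} \<Longrightarrow>
    f x = C * ((1 - x) powr (- (\<alpha> + \<beta>) / 2) * (1 + x) powr ((\<beta> - \<alpha>) / 2))"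
proof -
  define F where "F x = f x * ((1 - x) powr ((\<alpha> + \<beta>) / 2) * (1 + x) powr ((\<alpha> - \<beta>) / 2))" for x
  have "(F has_real_derivative 0) (at x)" if x: "x \<in> {-1<..<1}" for x
  proof -
    have p: "0 < 1 - x" "0 < 1 + x" using x by auto
    let ?A = "(1 - x) powr ((\<alpha> + \<beta>) / 2)" and ?B = "(1 + x) powr ((\<alpha> - \<beta>) / 2)"
    have dA: "((\<lambda>x. (1 - x) powr ((\<alpha> + \<beta>) / 2)) has_real_derivative - ((\<alpha> + \<beta>) / 2) * ?A / (1 - x)) (at x)"
      using p by (auto intro!: derivative_eq_intros simp: powr_diff)
    have dB: "((\<lambda>x. (1 + x) powr ((\<alpha> - \<beta>) / 2)) has_real_derivative ((\<alpha> - \<beta>) / 2) * ?B / (1 + x)) (at x)"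
      using p by (auto intro!: derivative_eq_intros simp: powr_diff)
    have f'eq: "f' x = (\<alpha> * x + \<beta>) * f x / ((1 - x) * (1 + x))"
    proof (subst eq_divide_eq)
      have "(1 - x\<^sup>2) = (1 - x) * (1 + x)" by (simp add: power2_eq_square algebra_simps)
      then show "if (1 - x) * (1 + x) \<noteq> 0 then f' x * ((1 - x) * (1 + x)) = (\<alpha> * x + \<beta>) * f x else f' x = 0"
        using ode[OF x] p by (simp add: mult.commute)
    qed
    have z: "f' x * (?A * ?B) + (- ((\<alpha> + \<beta>) / 2) * ?A / (1 - x) * ?B + ((\<alpha> - \<beta>) / 2) * ?B / (1 + x) * ?A) * f x = 0"
      unfolding f'eq using p by (simp add: divide_simps) (simp add: algebra_simps)
    show ?thesis unfolding F_def
      by (rule DERIV_cong[OF DERIV_mult[OF f[OF x] DERIV_mult[OF dA dB]] z])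
  qed
  then obtain C where C: "\<And>x. x \<in> {-1<..<1} \<Longrightarrow> F x = C"
    using has_field_derivative_zero_constant[of "{-1<..<1::real}" F]
    by (metis convex_real_interval(8) has_field_derivative_at_within)
  show thesis
  proof
    fix x :: real assume x: "x \<in> {-1<..<1}"
    then have p: "0 < 1 - x" "0 < 1 + x" by auto
    have e: "(\<beta> - \<alpha>) / 2 = - ((\<alpha> - \<beta>) / 2)" "- (\<alpha> + \<beta>) / 2 = - ((\<alpha> + \<beta>) / 2)" by (auto simp: field_simps)
    show "f x = C * ((1 - x) powr (- (\<alpha> + \<beta>) / 2) * (1 + x) powr ((\<beta> - \<alpha>) / 2))"
      unfolding C[OF x, symmetric] F_def e powr_minus using p by (simp add: field_simps)
  qed
qed

lemma absolutely_integrable_continuous_mult: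
  fixes f K :: "real \<Rightarrow> real"
  assumes "K absolutely_integrable_on {-1..1}" and "continuous_on {-1..1} f"
  shows "(\<lambda>x. f x * K x) absolutely_integrable_on {-1..1}"
  using absolutely_integrable_bounded_measurable_product[OF bilinear_times _ _ _ assms(1), of f] assms(2)
  by (simp add: continuous_imp_measurable_on_sets_lebesgue compact_imp_bounded compact_continuous_image)

text \<open>
  The Weierstrass theorem extends the orthogonality to continuous functions, in particular to a
  bump around a point where the function does not vanish.
\<close>
lemma orthogonal_to_polynomials_imp_zero:
  fixes K :: "real \<Rightarrow> real"
  assumes int: "K absolutely_integrable_on {-1..1}"
    and cont: "continuous_on {-1<..<1} K"
    and orth: "\<And>p :: real poly. integral {-1..1} (\<lambda>x. poly p x * K x) = 0"
    and x0: "x0 \<in> {-1<..<1}"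
  shows "K x0 = 0"
proof -
  have cint: "(\<lambda>x. f x * K x) absolutely_integrable_on {-1..1}" if "continuous_on {-1..1} f" for f :: "real \<Rightarrow> real"
    by (rule absolutely_integrable_continuous_mult[OF int that])
  have orthc: "integral {-1..1} (\<lambda>x. f x * K x) = 0" if f: "continuous_on {-1..1} f" for f :: "real \<Rightarrow> real"
  proof (rule ccontr)
    assume nz: "integral {-1..1} (\<lambda>x. f x * K x) \<noteq> 0"
    define N where "N = integral {-1..1} (\<lambda>x. \<bar>K x\<bar>)"
    have N0: "N \<ge> 0" unfolding N_def by (rule integral_nonneg) (use int in \<open>auto simp: absolutely_integrable_on_def\<close>)
    define e where "e = \<bar>integral {-1..1} (\<lambda>x. f x * K x)\<bar> / (2 * (N + 1))"
    have e: "e > 0" using nz N0 by (auto simp: e_def)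
    obtain g where g: "polynomial_function g" "\<And>x. x \<in> {-1..1} \<Longrightarrow> norm (f x - g x) < e"
      using Stone_Weierstrass_polynomial_function[OF compact_Icc f e] by auto
    have "real_polynomial_function g" using g(1) by (simp add: real_polynomial_function_eq)
    then obtain a n where gs: "g = (\<lambda>x. \<Sum>i\<le>n. a i * x ^ i)"
      using real_polynomial_function_imp_sum by blast
    define p where "p = (\<Sum>i\<le>n. monom (a i) i)"
    have gp: "g x = poly p x" for x by (simp add: gs p_def poly_sum poly_monom)
    have cg: "continuous_on {-1..1} g" unfolding gp by (intro continuous_intros)
    have "integral {-1..1} (\<lambda>x. f x * K x) = integral {-1..1} (\<lambda>x. f x * K x) - integral {-1..1} (\<lambda>x. g x * K x)"
      unfolding gp using orth[of p] by simp
    also have "\<dots> = integral {-1..1} (\<lambda>x. (f x - g x) * K x)"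
      using cint[OF f] cint[OF cg]
      by (subst integral_diff[symmetric]) (auto simp: absolutely_integrable_on_def algebra_simps)
    finally have eq: "integral {-1..1} (\<lambda>x. f x * K x) = integral {-1..1} (\<lambda>x. (f x - g x) * K x)" .
    have "norm (integral {-1..1} (\<lambda>x. (f x - g x) * K x)) \<le> integral {-1..1} (\<lambda>x. e * \<bar>K x\<bar>)"
    proof (rule integral_norm_bound_integral)
      show "(\<lambda>x. (f x - g x) * K x) integrable_on {-1..1}"
        using cint[of "\<lambda>x. f x - g x"] f cg by (auto simp: absolutely_integrable_on_def intro!: continuous_intros)
      show "(\<lambda>x. e * \<bar>K x\<bar>) integrable_on {-1..1}"
        using int by (auto simp: absolutely_integrable_on_def intro!: integrable_on_mult_right)
      show "norm ((f x - g x) * K x) \<le> e * \<bar>K x\<bar>" if "x \<in> {-1..1}" for x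
        using g(2)[OF that] by (auto simp: abs_mult intro!: mult_right_mono)
    qed
    also have "\<dots> = e * N" by (simp add: N_def)
    also have "\<dots> < \<bar>integral {-1..1} (\<lambda>x. f x * K x)\<bar>"
      using nz N0 by (simp add: e_def field_simps) (smt (verit, ccfv_SIG) mult_nonneg_nonneg)
    finally show False using eq by simp
  qed
  show ?thesis
  proof (rule ccontr)
    assume nz: "K x0 \<noteq> 0"
    have cK: "isCont K x0" using cont x0 by (simp add: continuous_on_eq_continuous_at)
    have "isCont (\<lambda>x. K x * sgn (K x0)) x0" by (intro continuous_intros cK)
    moreover have "0 < K x0 * sgn (K x0)" using nz by (simp add: sgn_if)
    ultimately have "\<forall>\<^sub>F x in at x0. 0 < K x * sgn (K x0)"
      unfolding isCont_def by (rule order_tendstoD(1))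
    then obtain d where d: "d > 0" "\<And>x. x \<noteq> x0 \<Longrightarrow> dist x x0 < d \<Longrightarrow> 0 < K x * sgn (K x0)"
      unfolding eventually_at by auto
    have pos: "0 < K x * sgn (K x0)" if "\<bar>x - x0\<bar> < d" for x
      using d(2)[of x] that nz by (cases "x = x0") (auto simp: dist_real_def sgn_if)
    define f where "f x = sgn (K x0) * max 0 (d - \<bar>x - x0\<bar>)" for x
    have cf: "continuous_on {-1..1} f" unfolding f_def by (intro continuous_intros)
    have i0: "((\<lambda>x. f x * K x) has_integral 0) {-1..1}"
      using orthc[OF cf] cint[OF cf] by (simp add: absolutely_integrable_on_def has_integral_integral)
    have nn: "0 \<le> f x * K x" for x
    proof (cases "\<bar>x - x0\<bar> < d")
      case True
      have "f x * K x = (K x * sgn (K x0)) * (d - \<bar>x - x0\<bar>)" using True by (simp add: f_def)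
      moreover have "0 < (K x * sgn (K x0)) * (d - \<bar>x - x0\<bar>)"
        using mult_pos_pos[OF pos[OF True], of "d - \<bar>x - x0\<bar>"] True by simp
      ultimately show ?thesis by linarith
    qed (simp add: f_def)
    define lo where "lo = max (-1) (x0 - d) / 2 + x0 / 2"
    define hi where "hi = min 1 (x0 + d) / 2 + x0 / 2"
    have lh: "-1 < lo" "lo < x0" "x0 < hi" "hi < 1" "x0 - d < lo" "hi < x0 + d" 
      using x0 d(1) unfolding lo_def hi_def max_def min_def by (auto simp: field_simps)
    have cfK: "continuous_on {lo..hi} (\<lambda>x. f x * K x)"
      using lh by (intro continuous_intros continuous_on_subset[OF cf] continuous_on_subset[OF cont]) auto
    have "integral {lo..hi} (\<lambda>x. f x * K x) \<le> integral {-1..1} (\<lambda>x. f x * K x)"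
      using lh i0 nn cfK by (intro integral_subset_le) (auto intro: integrable_continuous_real)
    moreover have "0 \<le> integral {lo..hi} (\<lambda>x. f x * K x)" using nn by (intro Henstock_Kurzweil_Integration.integral_nonneg integrable_continuous_real cfK) auto
    ultimately have "integral {lo..hi} (\<lambda>x. f x * K x) = 0" using orthc[OF cf] by simp
    then have "f x0 * K x0 = 0"
      using integral_eq_0_iff[OF cfK] lh nn by auto
    then show False using nz d(1) by (auto simp: f_def sgn_if split: if_splits)
  qed
qed

text \<open>
  Passage from the weak to the strong form: integrating \<open>p * h\<close> by parts shows that
  \<open>g - (\<integral>h)\<close> is orthogonal to all polynomials. Testing with $p = 1$ gives that the
  primitive vanishes at both ends, hence so does \<open>g\<close>.
\<close>
lemma weak_derivative:
  fixes g h :: "real \<Rightarrow> real"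
  assumes g: "g absolutely_integrable_on {-1..1}" and h: "h absolutely_integrable_on {-1..1}"
    and cg: "continuous_on {-1<..<1} g" and ch: "continuous_on {-1<..<1} h"
    and weak: "\<And>p :: real poly. integral {-1..1} (\<lambda>x. poly (pderiv p) x * g x + poly p x * h x) = 0"
  shows weak_derivative_derivative: "\<And>x. x \<in> {-1<..<1} \<Longrightarrow> (g has_real_derivative h x) (at x)"
    and weak_derivative_right_end: "(g \<longlongrightarrow> 0) (at_left 1)"
    and weak_derivative_left_end: "(g \<longlongrightarrow> 0) (at_right (- 1))"
proof -
  define H where "H x = integral {-1..x} h" for x
  have hi: "h integrable_on {-1..1}" using h by (simp add: absolutely_integrable_on_def)
  have cH: "continuous_on {-1..1} H" unfolding H_def by (rule indefinite_integral_continuous_1[OF hi])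
  have dH: "(H has_real_derivative h x) (at x)" if x: "x \<in> {-1<..<1}" for x
  proof -
    have "isCont h x" using ch x by (simp add: continuous_on_eq_continuous_at)
    then have "continuous (at x within {-1..1}) h" by (rule continuous_at_imp_continuous_at_within)
    then have "(H has_vector_derivative h x) (at x within {-1..1})"
      unfolding H_def using x hi by (intro integral_has_vector_derivative_continuous_at[where S = "{}", simplified]) auto
    then show ?thesis using x by (simp add: has_real_derivative_iff_has_vector_derivative at_within_Icc_at)
  qed
  have H_left: "H (- 1) = 0" by (simp add: H_def)
  have H_right: "H 1 = 0" using weak[of 1] by (simp add: H_def)
  have aiH: "H absolutely_integrable_on {-1..1}"
    using cH by (rule absolutely_integrable_continuous_real)
  define K where "K x = g x - H x" for x
  have K: "K absolutely_integrable_on {-1..1}" unfolding K_def using g aiH by (rule set_integral_diff(1))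
  have cK: "continuous_on {-1<..<1} K"
    unfolding K_def by (intro continuous_intros cg continuous_on_subset[OF cH]) auto
  have prod: "(\<lambda>x. poly p x * f x) integrable_on {-1..1}" if "f absolutely_integrable_on {-1..1}" for p and f :: "real \<Rightarrow> real"
    using absolutely_integrable_continuous_mult[OF that, of "poly p"]
    by (simp add: absolutely_integrable_on_def continuous_intros)
  have byparts: "((\<lambda>x. poly (pderiv p) x * H x + poly p x * h x) has_integral 0) {-1..1}" for p
  proof -
    have "((\<lambda>x. poly (pderiv p) x * H x + poly p x * h x) has_integral poly p 1 * H 1 - poly p (- 1) * H (- 1)) {-1..1}"
      by (rule fundamental_theorem_of_calculus_interior)
        (auto intro!: continuous_intros cH derivative_eq_intros dH simp flip: has_real_derivative_iff_has_vector_derivative)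
    then show ?thesis by (simp add: H_left H_right)
  qed
  have orth: "integral {-1..1} (\<lambda>x. poly (pderiv p) x * K x) = 0" for p
  proof -
    have "integral {-1..1} (\<lambda>x. poly (pderiv p) x * K x)
      = integral {-1..1} (\<lambda>x. (poly (pderiv p) x * g x + poly p x * h x) - (poly (pderiv p) x * H x + poly p x * h x))"
      by (simp add: K_def algebra_simps)
    also have "\<dots> = 0"
      by (subst integral_diff)
        (use weak[of p] byparts[of p] prod[OF g] prod[OF h] prod[OF aiH] in \<open>auto intro!: integrable_add simp: integral_unique dest: has_integral_integrable\<close>)
    finally show ?thesis .
  qed
  have surj: "\<exists>p. q = pderiv p" for q :: "real poly"
  proof
    let ?p = "\<Sum>i\<le>degree q. monom (coeff q i / of_nat (Suc i)) (Suc i)"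
    have "pderiv ?p = (\<Sum>i\<le>degree q. pderiv (monom (coeff q i / of_nat (Suc i)) (Suc i)))"
      using higher_pderiv_sum[of 1] by simp
    also have "\<dots> = (\<Sum>i\<le>degree q. monom (coeff q i) i)" by (simp add: pderiv_monom del: of_nat_Suc)
    also have "\<dots> = q" by (rule poly_as_sum_of_monoms)
    finally show "q = pderiv ?p" by simp
  qed
  have gH: "g x = H x" if "x \<in> {-1<..<1}" for x
  proof -
    have "integral {-1..1} (\<lambda>x. poly q x * K x) = 0" for q
      using surj[of q] orth by auto
    then have "K x = 0" using orthogonal_to_polynomials_imp_zero[OF K cK _ that] by blast
    then show ?thesis by (simp add: K_def)
  qed
  show "(g has_real_derivative h x) (at x)" if x: "x \<in> {-1<..<1}" for x
    using has_field_derivative_transform_within_open[OF dH[OF x] _ x, of g] gH by auto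
  have "(H \<longlongrightarrow> H 1) (at_left 1)"
    using cH by (simp add: continuous_on_Icc_at_leftD)
  moreover have "\<forall>\<^sub>F x in at_left (1::real). g x = H x"
    unfolding eventually_at_left_field using gH by (intro exI[of _ "-1"]) auto
  ultimately show "(g \<longlongrightarrow> 0) (at_left 1)" using H_right by (simp add: tendsto_cong)
  have "(H \<longlongrightarrow> H (- 1)) (at_right (- 1))"
    using cH by (simp add: continuous_on_Icc_at_rightD)
  moreover have "\<forall>\<^sub>F x in at_right (- 1::real). g x = H x"
    unfolding eventually_at_right_field using gH by (intro exI[of _ 1]) auto
  ultimately show "(g \<longlongrightarrow> 0) (at_right (- 1))" using H_left by (simp add: tendsto_cong)
qed

section \<open>Entries of matrices and of their integrals\<close>

lemma mat2_nth [simp]: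
  "mat2 p q r s $ 1 $ 1 = p" "mat2 p q r s $ 1 $ 2 = q"
  "mat2 p q r s $ 2 $ 1 = r" "mat2 p q r s $ 2 $ 2 = s"
  by (simp_all add: mat2_def)

lemma mat2_eqI:
  "A $ 1 $ 1 = B $ 1 $ 1 \<Longrightarrow> A $ 1 $ 2 = B $ 1 $ 2 \<Longrightarrow> A $ 2 $ 1 = B $ 2 $ 1 \<Longrightarrow> A $ 2 $ 2 = B $ 2 $ 2
    \<Longrightarrow> A = (B :: 'a^2^2)"
  by (simp add: vec_eq_iff forall_2)

lemma matrix_mult_2_nth: "(A ** B) $ i $ k = A $ i $ 1 * B $ 1 $ k + A $ i $ 2 * B $ 2 $ k"
  for A B :: "'a::semiring_1^2^2"
  by (simp add: matrix_matrix_mult_def sum_2)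

lemma cmat_nth [simp]: "cmat A $ i $ k = complex_of_real (A $ i $ k)"
  by (simp add: cmat_def)

lemma ctranspose_nth [simp]: "ctranspose A $ i $ k = cnj (A $ k $ i)"
  by (simp add: ctranspose_def)

lemma poly_mat_nth [simp]: "poly_mat P x $ i $ k = poly (P $ i $ k) (complex_of_real x)"
  by (simp add: poly_mat_def)

lemma const_mat_nth [simp]: "const_mat A $ i $ k = [:A $ i $ k:]"
  by (simp add: const_mat_def)

text \<open>
  Test matrices with a single non-zero row suffice throughout: the (1,1) entry of the inner product
  is then the sesquilinear form on row vectors.
\<close>
lemma act_row:
  "act (mat2 f g 0 0) (hyp_op A11 A10 A0) = mat2
    ([:1, 0, -1:] * pderiv (pderiv f) + [:A10$1$1, A11$1$1:] * pderiv f + [:A10$2$1, A11$2$1:] * pderiv g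
      + smult (A0$1$1) f + smult (A0$2$1) g)
    ([:1, 0, -1:] * pderiv (pderiv g) + [:A10$1$2, A11$1$2:] * pderiv f + [:A10$2$2, A11$2$2:] * pderiv g
      + smult (A0$1$2) f + smult (A0$2$2) g) 0 0"
proof -
  have act3: "act P (hyp_op A11 A10 A0) = pderiv_mat 0 P ** const_mat A0
      + pderiv_mat 1 P ** (\<chi> i j. [:A10 $ i $ j, A11 $ i $ j:]) + pderiv_mat 2 P ** mat [:1, 0, -1:]" for P
    by (simp add: act_def hyp_op_def numeral_3_eq_3 numeral_2_eq_2 lessThan_Suc add_ac)
  show ?thesis unfolding act3
    by (rule mat2_eqI)
      (simp_all add: matrix_mult_2_nth pderiv_mat_def mat_def numeral_2_eq_2 add_ac mult.commute[of "pderiv _"] mult.commute[of f] mult.commute[of g])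
qed

lemma bounded_linear_matrix_nth: "bounded_linear (\<lambda>A :: complex^'n^'m. A $ i $ k)"
  by (intro bounded_linear_compose[OF bounded_linear_vec_nth bounded_linear_vec_nth])

lemma integrable_matrixI:
  fixes f :: "'a \<Rightarrow> complex^'n^'m"
  assumes "\<And>i k. integrable M (\<lambda>x. f x $ i $ k)"
  shows "integrable M f"
proof -
  have bl: "bounded_linear (\<lambda>c. (\<chi> i' k'. if i' = i \<and> k' = k then c else 0) :: complex^'n^'m)" for i k
    by (simp flip: linear_conv_bounded_linear) (auto intro!: linearI simp: vec_eq_iff)
  have "f = (\<lambda>x. \<Sum>i\<in>UNIV. \<Sum>k\<in>UNIV. (\<chi> i' k'. if i' = i \<and> k' = k then f x $ i $ k else 0))"
  proof (rule ext)
    fix x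
    have "(\<Sum>i\<in>UNIV. \<Sum>k\<in>UNIV. if i' = i \<and> k' = k then f x $ i $ k else 0) = f x $ i' $ k'" for i' k'
    proof -
      have "(\<Sum>i\<in>UNIV. \<Sum>k\<in>UNIV. if i' = i \<and> k' = k then f x $ i $ k else 0)
        = (\<Sum>i\<in>UNIV. if i' = i then f x $ i $ k' else 0)"
        by (rule sum.cong) (auto simp: sum.delta)
      then show ?thesis by simp
    qed
    then show "f x = (\<Sum>i\<in>UNIV. \<Sum>k\<in>UNIV. (\<chi> i' k'. if i' = i \<and> k' = k then f x $ i $ k else 0))"
      by (simp add: vec_eq_iff)
  qed
  moreover have "integrable M (\<lambda>x. \<Sum>i\<in>UNIV. \<Sum>k\<in>UNIV. (\<chi> i' k'. if i' = i \<and> k' = k then f x $ i $ k else 0))"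
    by (intro Bochner_Integration.integrable_sum integrable_bounded_linear[OF bl] assms)
  ultimately show ?thesis by simp
qed

lemma integral_matrix_nth:
  fixes f :: "'a \<Rightarrow> complex^'n^'m"
  assumes "integrable M f"
  shows "(LINT x|M. f x) $ i $ k = (LINT x|M. f x $ i $ k)"
  using integral_bounded_linear[OF bounded_linear_matrix_nth assms, of i k] by simp

lemma integrable_continuous_mult_supported:
  fixes c w :: "real \<Rightarrow> 'a :: {real_normed_field, banach, second_countable_topology}"
  assumes c: "continuous_on UNIV c" and w: "integrable lborel w" and supp: "\<And>x. x \<notin> {-1<..<1} \<Longrightarrow> w x = 0"
  shows "integrable lborel (\<lambda>x. c x * w x)"
proof -
  have "bounded (c ` {-1..1})" by (intro compact_imp_bounded compact_continuous_image continuous_on_subset[OF c]) auto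
  then obtain B where B: "\<And>x. x \<in> {-1..1} \<Longrightarrow> norm (c x) \<le> B" 
    unfolding bounded_iff by blast
  have "norm (c x * w x) \<le> norm (of_real B * w x)" for x
    using B[of x] supp[of x] by (cases "x \<in> {-1<..<1}") (auto simp: norm_mult intro!: mult_right_mono)
  moreover have "c \<in> borel_measurable borel" using c by (rule borel_measurable_continuous_onI)
  ultimately show ?thesis
    using w by (intro Bochner_Integration.integrable_bound[where f = "\<lambda>x. of_real B * w x" and g = "\<lambda>x. c x * w x"]) auto
qed

lemma weight_matrix_entry:
  assumes "weight_matrix W"
  shows weight_matrix_entry_integrable: "integrable lborel (\<lambda>x. W x $ i $ k)"
    and weight_matrix_entry_support: "x \<notin> {-1<..<1} \<Longrightarrow> W x $ i $ k = 0"
    and weight_matrix_entry_continuous: "continuous_on {-1<..<1} (\<lambda>x. W x $ i $ k)"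
proof -
  have "integrable lborel (\<lambda>x. x ^ 0 *\<^sub>R W x)" using assms unfolding weight_matrix_def by blast
  then show "integrable lborel (\<lambda>x. W x $ i $ k)"
    using integrable_bounded_linear[OF bounded_linear_matrix_nth] by simp
  show "x \<notin> {-1<..<1} \<Longrightarrow> W x $ i $ k = 0" using assms by (simp add: weight_matrix_def)
  have "continuous (at x) W" if "x \<in> {-1<..<1}" for x
    using assms that unfolding weight_matrix_def smooth_inside_def
    by (metis has_vector_derivative_continuous)
  then show "continuous_on {-1<..<1} (\<lambda>x. W x $ i $ k)"
    by (intro bounded_linear.continuous_on[OF bounded_linear_matrix_nth]) (auto intro: continuous_at_imp_continuous_on)
qed

lemma weight_inner_row:
  assumes W: "weight_matrix W"
  shows "weight_inner W (mat2 f g 0 0) (mat2 h k 0 0) $ 1 $ 1 = (LINT x|lborel.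
      (poly f x * W x $ 1 $ 1 + poly g x * W x $ 2 $ 1) * cnj (poly h x)
    + (poly f x * W x $ 1 $ 2 + poly g x * W x $ 2 $ 2) * cnj (poly k x))"
proof -
  let ?F = "\<lambda>x. poly_mat (mat2 f g 0 0) x ** W x ** ctranspose (poly_mat (mat2 h k 0 0) x)"
  have e: "integrable lborel (\<lambda>x. poly P (complex_of_real x) * W x $ i $ m * cnj (poly Q (complex_of_real x)))" for P Q i m
    using integrable_continuous_mult_supported[OF _ weight_matrix_entry(1,2)[OF W],
        of "\<lambda>x. poly P (complex_of_real x) * cnj (poly Q (complex_of_real x))" i m]
    by (simp add: continuous_intros mult_ac)
  have "integrable lborel (\<lambda>x. ?F x $ i $ m)" for i m
    by (simp add: matrix_mult_2_nth distrib_right) (intro Bochner_Integration.integrable_add e)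
  then have "integrable lborel ?F" by (rule integrable_matrixI)
  then show ?thesis unfolding weight_inner_def
    by (simp add: integral_matrix_nth) (simp add: matrix_mult_2_nth)
qed

lemma poly_map_of_real [simp]: "poly (map_poly complex_of_real p) (complex_of_real x) = complex_of_real (poly p x)"
  by (induction p) (simp_all add: map_poly_pCons)

lemma pderiv_map_of_real [simp]: "pderiv (map_poly complex_of_real p) = map_poly complex_of_real (pderiv p)"
  by (rule poly_eqI) (simp add: coeff_pderiv coeff_map_poly)

lemma supported_integrable_Icc:
  fixes f :: "real \<Rightarrow> real"
  assumes f: "integrable lborel f" and supp: "\<And>x. x \<notin> {-1<..<1} \<Longrightarrow> f x = 0"
  shows "f absolutely_integrable_on {-1..1}" and "(f has_integral (LINT x|lborel. f x)) {-1..1}"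
proof -
  have "integrable lebesgue f" using f by (simp add: integrable_completion borel_measurable_integrable)
  then show "f absolutely_integrable_on {-1..1}"
    unfolding set_integrable_def by (intro integrable_mult_indicator) auto
  have "(f has_integral (LINT x|lborel. f x)) UNIV" using f by (rule has_integral_integral_lborel)
  moreover have "f = (\<lambda>x. if x \<in> {-1..1} then f x else 0)" using supp by force
  ultimately show "(f has_integral (LINT x|lborel. f x)) {-1..1}"
    by (metis has_integral_restrict_UNIV)
qed

section \<open>The first-order system of a real pair\<close>

lemma has_integral_zero_of_vanishing_primitive:
  fixes f f' :: "real \<Rightarrow> real"
  assumes f: "\<And>x. x \<in> {-1<..<1} \<Longrightarrow> (f has_real_derivative f' x) (at x)"
    and lim: "(f \<longlongrightarrow> 0) (at_left 1)" "(f \<longlongrightarrow> 0) (at_right (- 1))"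
  shows "(f' has_integral 0) {-1..1}"
proof -
  define F where "F x = (if x \<in> {-1<..<1} then f x else 0)" for x
  have dF: "(F has_real_derivative f' x) (at x)" if x: "x \<in> {-1<..<1}" for x
    using has_field_derivative_transform_within_open[OF f[OF x] _ x, of F] by (auto simp: F_def)
  have "continuous_on {-1..1} F"
  proof (rule continuous_on_IccI)
    have "\<forall>\<^sub>F x in at_right (- 1::real). f x = F x"
      unfolding eventually_at_right_field by (intro exI[of _ 1]) (auto simp: F_def)
    from iffD1[OF tendsto_cong[OF this] lim(2)]
    show "(F \<longlongrightarrow> F (- 1)) (at_right (- 1))" by (simp add: F_def[of "- 1"])
    have "\<forall>\<^sub>F x in at_left (1::real). f x = F x"
      unfolding eventually_at_left_field by (intro exI[of _ "-1"]) (auto simp: F_def)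
    from iffD1[OF tendsto_cong[OF this] lim(1)]
    show "(F \<longlongrightarrow> F 1) (at_left 1)" by (simp add: F_def[of 1])
    show "F \<midarrow>x\<rightarrow> F x" if "- 1 < x" "x < 1" for x
      using DERIV_isCont[OF dF[of x]] that by (simp add: isCont_def)
  qed simp
  then have "(f' has_integral F 1 - F (- 1)) {-1..1}"
    by (intro fundamental_theorem_of_calculus_interior)
      (auto simp flip: has_real_derivative_iff_has_vector_derivative intro: dF)
  then show ?thesis by (simp add: F_def)
qed

lemma has_integral_zero_combination:
  fixes f g h :: "real \<Rightarrow> real"
  assumes "(f has_integral 0) S" and "(g has_integral 0) S" and "\<And>x. h x = c * f x + d * g x"
  shows "(h has_integral 0) S"
proof -
  have "((\<lambda>x. c * f x + d * g x) has_integral c * 0 + d * 0) S"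
    by (intro has_integral_add has_integral_mult_right assms)
  then show ?thesis using assms(3) by (simp add: ext[of h "\<lambda>x. c * f x + d * g x"])
qed

text \<open>
  The pointwise form of the symmetry: the real entries \<open>u\<close>, \<open>v\<close>, \<open>z\<close> of the weight, their
  multiples \<open>U\<close>, \<open>V\<close>, \<open>Z\<close> by $1-x^2$, and the antisymmetric part \<open>j\<close> of the product of the
  first-order coefficient with the weight. The boundary values are part of the integration by parts.
\<close>
locale jacobi_pair =
  fixes u v z :: "real \<Rightarrow> real" and a p1 p0 q1 q0 r1 r0 t1 t0 :: real
  fixes U V Z j :: "real \<Rightarrow> real"
  defines U_def: "U \<equiv> \<lambda>x. (1 - x\<^sup>2) * u x"
    and V_def: "V \<equiv> \<lambda>x. (1 - x\<^sup>2) * v x"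
    and Z_def: "Z \<equiv> \<lambda>x. (1 - x\<^sup>2) * z x"
    and j_def: "j \<equiv> \<lambda>x. (q1 * x + q0) * z x - (r1 * x + r0) * u x + ((p1 * x + p0) - (t1 * x + t0)) * v x"
  assumes integrable: "u absolutely_integrable_on {-1..1}" "v absolutely_integrable_on {-1..1}"
      "z absolutely_integrable_on {-1..1}"
    and positive: "\<And>x. x \<in> {-1<..<1} \<Longrightarrow> 0 < u x" "\<And>x. x \<in> {-1<..<1} \<Longrightarrow> 0 < z x"
      "\<And>x. x \<in> {-1<..<1} \<Longrightarrow> (v x)\<^sup>2 < u x * z x"
    and dU: "\<And>x. x \<in> {-1<..<1} \<Longrightarrow> (U has_real_derivative (p1 * x + p0) * u x + (q1 * x + q0) * v x) (at x)"
    and dV: "\<And>x. x \<in> {-1<..<1} \<Longrightarrow> (V has_real_derivative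
        ((p1 * x + p0) * v x + (q1 * x + q0) * z x + (r1 * x + r0) * u x + (t1 * x + t0) * v x) / 2) (at x)"
    and dZ: "\<And>x. x \<in> {-1<..<1} \<Longrightarrow> (Z has_real_derivative (r1 * x + r0) * v x + (t1 * x + t0) * z x) (at x)"
    and dj: "\<And>x. x \<in> {-1<..<1} \<Longrightarrow> (j has_real_derivative 4 * a * v x) (at x)"
    and right_limits: "(U \<longlongrightarrow> 0) (at_left 1)" "(V \<longlongrightarrow> 0) (at_left 1)" "(Z \<longlongrightarrow> 0) (at_left 1)"
      "(j \<longlongrightarrow> 0) (at_left 1)"
    and left_limits: "(U \<longlongrightarrow> 0) (at_right (- 1))" "(V \<longlongrightarrow> 0) (at_right (- 1))"
      "(Z \<longlongrightarrow> 0) (at_right (- 1))" "(j \<longlongrightarrow> 0) (at_right (- 1))"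

locale real_weight =
  fixes W :: "real \<Rightarrow> complex^2^2" and D :: "2 diff_op" and A11 A10 :: "real^2^2" and a :: real
    and u v z :: "real \<Rightarrow> real"
  assumes pair: "bochner_pair W D"
    and D_eq: "D = hyp_op (cmat A11) (cmat A10) (cmat (A0_of a))"
    and W_eq: "W = (\<lambda>x. cmat (mat2 (u x) (v x) (v x) (z x)))"
begin

lemma weight: "weight_matrix W" using pair by (simp add: bochner_pair_def)

lemma entry_lborel: "integrable lborel u" "integrable lborel v" "integrable lborel z"
  using weight_matrix_entry_integrable[OF weight, of 1 1] weight_matrix_entry_integrable[OF weight, of 1 2]
    weight_matrix_entry_integrable[OF weight, of 2 2] by (simp_all add: W_eq complex_of_real_integrable_eq)

lemma entry_support: assumes "x \<notin> {-1<..<1}" shows "u x = 0" "v x = 0" "z x = 0"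
  using weight_matrix_entry_support[OF weight assms, of 1 1] weight_matrix_entry_support[OF weight assms, of 1 2]
    weight_matrix_entry_support[OF weight assms, of 2 2] by (simp_all add: W_eq)

lemma entry_continuous: "continuous_on {-1<..<1} u" "continuous_on {-1<..<1} v" "continuous_on {-1<..<1} z"
proof -
  have *: "continuous_on {-1<..<1} (\<lambda>x. Re (W x $ i $ k))" for i k
    by (intro continuous_intros weight_matrix_entry_continuous[OF weight])
  show "continuous_on {-1<..<1} u" "continuous_on {-1<..<1} v" "continuous_on {-1<..<1} z"
    using *[of 1 1] *[of 1 2] *[of 2 2] by (simp_all add: W_eq)
qed

lemma entry_positive:
  assumes x: "x \<in> {-1<..<1}"
  shows "0 < u x" and "0 < z x" and "(v x)\<^sup>2 < u x * z x"
proof -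
  have pd: "0 < Re (\<Sum>i\<in>UNIV. \<Sum>k\<in>UNIV. y $ i * W x $ i $ k * cnj (y $ k))" if "y \<noteq> 0" for y :: "complex^2"
    using weight x that by (simp add: weight_matrix_def positive_definite_def)
  have q: "0 < s * u x * s + 2 * (s * v x * t) + t * z x * t" if st: "s \<noteq> 0 \<or> t \<noteq> 0" for s t :: real
  proof -
    have "(vector [complex_of_real s, complex_of_real t] :: complex^2) \<noteq> 0"
      using st by (auto simp: vec_eq_iff forall_2)
    from pd[OF this] show ?thesis by (simp add: sum_2 W_eq algebra_simps)
  qed
  show u: "0 < u x" using q[of 1 0] by simp
  show "0 < z x" using q[of 0 1] by simp
  have "0 < u x * (u x * z x - (v x)\<^sup>2)"
    using q[of "v x" "- u x"] u by (simp add: algebra_simps power2_eq_square)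
  then show "(v x)\<^sup>2 < u x * z x" using u by (simp add: zero_less_mult_iff)
qed

text \<open>
The two entries of the image of the polynomial row \<open>(f, g)\<close> under the operator.
\<close>
definition row_op1 :: "real poly \<Rightarrow> real poly \<Rightarrow> real \<Rightarrow> real" where
  "row_op1 f g x = (1 - x\<^sup>2) * poly (pderiv (pderiv f)) x + (A11$1$1 * x + A10$1$1) * poly (pderiv f) x
     + (A11$2$1 * x + A10$2$1) * poly (pderiv g) x + a * poly f x"

definition row_op2 :: "real poly \<Rightarrow> real poly \<Rightarrow> real \<Rightarrow> real" where
  "row_op2 f g x = (1 - x\<^sup>2) * poly (pderiv (pderiv g)) x + (A11$1$2 * x + A10$1$2) * poly (pderiv f) x
     + (A11$2$2 * x + A10$2$2) * poly (pderiv g) x - a * poly g x"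

lemma continuous_row_op [continuous_intros]:
  "continuous_on S (row_op1 f g)" "continuous_on S (row_op2 f g)"
  unfolding row_op1_def[abs_def] row_op2_def[abs_def] by (intro continuous_intros)+

lemma integrable_combination:
  assumes "continuous_on UNIV c1" "continuous_on UNIV c2" "continuous_on UNIV c3"
  shows "integrable lborel (\<lambda>x. c1 x * u x + c2 x * v x + c3 x * z x)"
  by (intro Bochner_Integration.integrable_add integrable_continuous_mult_supported assms entry_lborel entry_support)

lemma poly_row_op:
  "poly ([:1, 0, -1:] * pderiv (pderiv (map_poly complex_of_real f))
      + [:cmat A10$1$1, cmat A11$1$1:] * pderiv (map_poly complex_of_real f)
      + [:cmat A10$2$1, cmat A11$2$1:] * pderiv (map_poly complex_of_real g)
      + smult (cmat (A0_of a)$1$1) (map_poly complex_of_real f)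
      + smult (cmat (A0_of a)$2$1) (map_poly complex_of_real g)) (complex_of_real x)
    = complex_of_real (row_op1 f g x)"
  "poly ([:1, 0, -1:] * pderiv (pderiv (map_poly complex_of_real g))
      + [:cmat A10$1$2, cmat A11$1$2:] * pderiv (map_poly complex_of_real f)
      + [:cmat A10$2$2, cmat A11$2$2:] * pderiv (map_poly complex_of_real g)
      + smult (cmat (A0_of a)$1$2) (map_poly complex_of_real f)
      + smult (cmat (A0_of a)$2$2) (map_poly complex_of_real g)) (complex_of_real x)
    = complex_of_real (row_op2 f g x)"
  unfolding row_op1_def row_op2_def poly_add poly_mult poly_smult pderiv_map_of_real poly_map_of_real
  by (simp_all add: A0_of_def power2_eq_square algebra_simps)

lemma weak_symmetry:
  "((\<lambda>x. (row_op1 f g x * u x + row_op2 f g x * v x) * poly h x + (row_op1 f g x * v x + row_op2 f g x * z x) * poly k x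
     - ((poly f x * u x + poly g x * v x) * row_op1 h k x + (poly f x * v x + poly g x * z x) * row_op2 h k x))
    has_integral 0) {-1..1}"
proof -
  let ?c = "map_poly complex_of_real"
  let ?P = "mat2 (?c f) (?c g) 0 0" and ?Q = "mat2 (?c h) (?c k) 0 0"
  let ?L = "\<lambda>x. (row_op1 f g x * u x + row_op2 f g x * v x) * poly h x + (row_op1 f g x * v x + row_op2 f g x * z x) * poly k x"
  let ?R = "\<lambda>x. (poly f x * u x + poly g x * v x) * row_op1 h k x + (poly f x * v x + poly g x * z x) * row_op2 h k x"
  have "weight_inner W (act ?P D) ?Q $ 1 $ 1 = weight_inner W ?P (act ?Q D) $ 1 $ 1"
    using pair by (simp add: bochner_pair_def)
  moreover have "weight_inner W (act ?P D) ?Q $ 1 $ 1 = (LINT x|lborel. complex_of_real (?L x))"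
    unfolding D_eq act_row weight_inner_row[OF weight] poly_row_op by (simp add: W_eq)
  moreover have "weight_inner W ?P (act ?Q D) $ 1 $ 1 = (LINT x|lborel. complex_of_real (?R x))"
    unfolding D_eq act_row weight_inner_row[OF weight] poly_row_op by (simp add: W_eq)
  ultimately have "(LINT x|lborel. complex_of_real (?L x)) = (LINT x|lborel. complex_of_real (?R x))" by (simp only:)
  then have eq: "(LINT x|lborel. ?L x) = (LINT x|lborel. ?R x)" by (simp only: integral_complex_of_real of_real_eq_iff)
  have "integrable lborel (\<lambda>x. (row_op1 f g x * poly h x) * u x
      + (row_op2 f g x * poly h x + row_op1 f g x * poly k x) * v x + (row_op2 f g x * poly k x) * z x)"
    by (intro integrable_combination continuous_intros)
  then have iL: "integrable lborel ?L" by (simp add: algebra_simps)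
  have "integrable lborel (\<lambda>x. (poly f x * row_op1 h k x) * u x
      + (poly g x * row_op1 h k x + poly f x * row_op2 h k x) * v x + (poly g x * row_op2 h k x) * z x)"
    by (intro integrable_combination continuous_intros)
  then have iR: "integrable lborel ?R" by (simp add: algebra_simps)
  have "((\<lambda>x. ?L x - ?R x) has_integral (LINT x|lborel. ?L x - ?R x)) {-1..1}"
    by (rule supported_integrable_Icc) (use iL iR in \<open>auto simp: entry_support\<close>)
  then show ?thesis using eq iL iR by simp
qed

text \<open>
  Testing the symmetry with \<open>p\<close> times a row against \<open>x\<close> times a row, and with \<open>x * p\<close>
  against a constant row, and subtracting, removes the second derivative: what is left is a
  weak first-order equation for the entries of $(1-x^2)W$.
\<close>
lemma weak_first_order:
  shows "((\<lambda>x. poly (pderiv p) x * ((1 - x\<^sup>2) * u x)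
      + poly p x * ((A11$1$1 * x + A10$1$1) * u x + (A11$1$2 * x + A10$1$2) * v x)) has_integral 0) {-1..1}" (is ?uu)
    and "((\<lambda>x. poly (pderiv p) x * ((1 - x\<^sup>2) * v x)
      + poly p x * (((A11$1$1 * x + A10$1$1) * v x + (A11$1$2 * x + A10$1$2) * z x
         + (A11$2$1 * x + A10$2$1) * u x + (A11$2$2 * x + A10$2$2) * v x) / 2)) has_integral 0) {-1..1}" (is ?uv)
    and "((\<lambda>x. poly (pderiv p) x * ((1 - x\<^sup>2) * z x)
      + poly p x * ((A11$2$1 * x + A10$2$1) * v x + (A11$2$2 * x + A10$2$2) * z x)) has_integral 0) {-1..1}" (is ?vv)
proof -
  let ?X = "[:0, 1:] :: real poly"
  show ?uu
    by (rule has_integral_zero_combination[OF weak_symmetry[of "?X * p" 0 1 0] weak_symmetry[of p 0 ?X 0], where c = "1/2" and d = "- 1/2"])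
      (simp add: row_op1_def row_op2_def pderiv_mult pderiv_add pderiv_pCons field_simps power2_eq_square)
  show ?uv
    by (rule has_integral_zero_combination[OF weak_symmetry[of "?X * p" 0 0 1] weak_symmetry[of p 0 0 ?X], where c = "1/2" and d = "- 1/2"])
      (simp add: row_op1_def row_op2_def pderiv_mult pderiv_add pderiv_pCons field_simps power2_eq_square)
  show ?vv
    by (rule has_integral_zero_combination[OF weak_symmetry[of 0 "?X * p" 0 1] weak_symmetry[of 0 p 0 ?X], where c = "1/2" and d = "- 1/2"])
      (simp add: row_op1_def row_op2_def pderiv_mult pderiv_add pderiv_pCons field_simps power2_eq_square)
qed

lemma weak_antisymmetric:
  "((\<lambda>x. poly (pderiv p) x * ((A11$1$2 * x + A10$1$2) * z x - (A11$2$1 * x + A10$2$1) * u x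
      + ((A11$1$1 * x + A10$1$1) - (A11$2$2 * x + A10$2$2)) * v x) + poly p x * (4 * a * v x)) has_integral 0) {-1..1}"
  by (rule has_integral_zero_combination[OF weak_symmetry[of p 0 0 1] weak_first_order(2)[of "pderiv p"], where c = 2 and d = "- 2"])
    (simp add: row_op1_def row_op2_def field_simps power2_eq_square)

end

sublocale real_weight \<subseteq> jacobi_pair u v z a "A11$1$1" "A10$1$1" "A11$1$2" "A10$1$2" "A11$2$1" "A10$2$1" "A11$2$2" "A10$2$2"
    "\<lambda>x. (1 - x\<^sup>2) * u x" "\<lambda>x. (1 - x\<^sup>2) * v x" "\<lambda>x. (1 - x\<^sup>2) * z x"
    "\<lambda>x. (A11$1$2 * x + A10$1$2) * z x - (A11$2$1 * x + A10$2$1) * u x + ((A11$1$1 * x + A10$1$1) - (A11$2$2 * x + A10$2$2)) * v x"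
proof -
  note ai = supported_integrable_Icc(1)[OF entry_lborel(1) entry_support(1)]
    supported_integrable_Icc(1)[OF entry_lborel(2) entry_support(2)]
    supported_integrable_Icc(1)[OF entry_lborel(3) entry_support(3)]
  note am = absolutely_integrable_continuous_mult[OF ai(1)] absolutely_integrable_continuous_mult[OF ai(2)]
    absolutely_integrable_continuous_mult[OF ai(3)]
  note ci = continuous_intros entry_continuous
  let ?p = "\<lambda>x. A11$1$1 * x + A10$1$1" and ?q = "\<lambda>x. A11$1$2 * x + A10$1$2"
    and ?r = "\<lambda>x. A11$2$1 * x + A10$2$1" and ?t = "\<lambda>x. A11$2$2 * x + A10$2$2"
  have iu: "(\<lambda>x. (1 - x\<^sup>2) * u x) absolutely_integrable_on {-1..1}"
    "(\<lambda>x. (1 - x\<^sup>2) * v x) absolutely_integrable_on {-1..1}"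
    "(\<lambda>x. (1 - x\<^sup>2) * z x) absolutely_integrable_on {-1..1}"
    using am(1)[of "\<lambda>x. 1 - x\<^sup>2"] am(2)[of "\<lambda>x. 1 - x\<^sup>2"] am(3)[of "\<lambda>x. 1 - x\<^sup>2"]
    by (simp_all add: continuous_intros)
  have lin: "(\<lambda>x. c1 x * u x + c2 x * v x + c3 x * z x) absolutely_integrable_on {-1..1}"
    if "continuous_on {-1..1} c1" "continuous_on {-1..1} c2" "continuous_on {-1..1} c3" for c1 c2 c3
    by (intro set_integral_add(1) am that)
  have ih: "(\<lambda>x. ?p x * u x + ?q x * v x) absolutely_integrable_on {-1..1}"
    "(\<lambda>x. (?p x * v x + ?q x * z x + ?r x * u x + ?t x * v x) / 2) absolutely_integrable_on {-1..1}"
    "(\<lambda>x. ?r x * v x + ?t x * z x) absolutely_integrable_on {-1..1}"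
    "(\<lambda>x. ?q x * z x - ?r x * u x + (?p x - ?t x) * v x) absolutely_integrable_on {-1..1}"
    "(\<lambda>x. 4 * a * v x) absolutely_integrable_on {-1..1}"
    using lin[of ?p ?q "\<lambda>_. 0"] lin[of "\<lambda>x. ?r x / 2" "\<lambda>x. (?p x + ?t x) / 2" "\<lambda>x. ?q x / 2"] lin[of "\<lambda>_. 0" ?r ?t]
      lin[of "\<lambda>x. - ?r x" "\<lambda>x. ?p x - ?t x" ?q] lin[of "\<lambda>_. 0" "\<lambda>_. 4 * a" "\<lambda>_. 0"]
    by (simp_all add: continuous_intros algebra_simps add_divide_distrib)
  have cu: "continuous_on {-1<..<1} (\<lambda>x. (1 - x\<^sup>2) * u x)" "continuous_on {-1<..<1} (\<lambda>x. (1 - x\<^sup>2) * v x)"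
    "continuous_on {-1<..<1} (\<lambda>x. (1 - x\<^sup>2) * z x)" by (intro ci)+
  have ch: "continuous_on {-1<..<1} (\<lambda>x. ?p x * u x + ?q x * v x)"
    "continuous_on {-1<..<1} (\<lambda>x. (?p x * v x + ?q x * z x + ?r x * u x + ?t x * v x) / 2)"
    "continuous_on {-1<..<1} (\<lambda>x. ?r x * v x + ?t x * z x)"
    "continuous_on {-1<..<1} (\<lambda>x. ?q x * z x - ?r x * u x + (?p x - ?t x) * v x)"
    "continuous_on {-1<..<1} (\<lambda>x. 4 * a * v x)" by (intro ci; simp)+
  note wU = weak_derivative[OF iu(1) ih(1) cu(1) ch(1) integral_unique[OF weak_first_order(1)]]
  note wV = weak_derivative[OF iu(2) ih(2) cu(2) ch(2) integral_unique[OF weak_first_order(2)]]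
  note wZ = weak_derivative[OF iu(3) ih(3) cu(3) ch(3) integral_unique[OF weak_first_order(3)]]
  note wj = weak_derivative[OF ih(4) ih(5) ch(4) ch(5) integral_unique[OF weak_antisymmetric]]
  show "jacobi_pair u v z a (A11$1$1) (A10$1$1) (A11$1$2) (A10$1$2) (A11$2$1) (A10$2$1) (A11$2$2) (A10$2$2)"
    by unfold_locales (rule ai entry_positive wU wV wZ wj; assumption?)+
qed

section \<open>Consequences of the first-order system\<close>

text \<open>
  With a zero boundary value the exponent at that end is positive. In this form the boundary
  conditions enter: they rule out solutions whose exponents do not allow it.
\<close>
lemma jacobi_factor_exponent_right:
  assumes lim: "((\<lambda>x. C * ((1 - x) powr e * (1 + x) powr f)) \<longlongrightarrow> 0) (at_left (1::real))" and C: "C \<noteq> 0"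
  shows "0 < e"
proof (rule ccontr)
  assume "\<not> 0 < e"
  then have e: "e \<le> 0" by simp
  have "((\<lambda>x::real. \<bar>C\<bar> * (1 + x) powr f) \<longlongrightarrow> \<bar>C\<bar> * (1 + 1) powr f) (at_left 1)"
    by (intro tendsto_intros) auto
  moreover have "((\<lambda>x. \<bar>C * ((1 - x) powr e * (1 + x) powr f)\<bar>) \<longlongrightarrow> 0) (at_left (1::real))"
    using tendsto_rabs[OF lim] by simp
  moreover have "\<forall>\<^sub>F x in at_left (1::real). \<bar>C\<bar> * (1 + x) powr f \<le> \<bar>C * ((1 - x) powr e * (1 + x) powr f)\<bar>"
    unfolding eventually_at_left_field
  proof (intro exI[of _ 0] conjI allI impI)
    fix x :: real assume x: "0 < x" "x < 1"
    have "1 \<le> (1 - x) powr e" using powr_mono'[of e 0 "1 - x"] e x by simp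
    then have "1 * (1 + x) powr f \<le> (1 - x) powr e * (1 + x) powr f" by (intro mult_right_mono) auto
    then show "\<bar>C\<bar> * (1 + x) powr f \<le> \<bar>C * ((1 - x) powr e * (1 + x) powr f)\<bar>"
      by (simp add: abs_mult mult_left_mono)
  qed simp
  ultimately have "\<bar>C\<bar> * (1 + 1) powr f \<le> 0" by (intro tendsto_le[of "at_left (1::real)"]) auto
  then show False using C by (simp add: mult_le_0_iff)
qed

lemma jacobi_factor_exponent_left:
  assumes lim: "((\<lambda>x. C * ((1 - x) powr e * (1 + x) powr f)) \<longlongrightarrow> 0) (at_right (- 1::real))" and C: "C \<noteq> 0"
  shows "0 < f"
proof -
  have "((\<lambda>x. C * ((1 - x) powr f * (1 + x) powr e)) \<longlongrightarrow> 0) (at_left (1::real))"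
    unfolding filterlim_at_left_to_right using lim by (simp add: mult.commute)
  then show ?thesis using jacobi_factor_exponent_right C by blast
qed

lemma tendsto_cong_left_end:
  assumes "(f \<longlongrightarrow> 0) (at_right (- 1::real))" "\<And>x. x \<in> {-1<..<1} \<Longrightarrow> f x = (g x :: real)"
  shows "(g \<longlongrightarrow> 0) (at_right (- 1))"
proof -
  have "\<forall>\<^sub>F x in at_right (- 1::real). f x = g x"
    unfolding eventually_at_right_field using assms(2) by (intro exI[of _ 1]) auto
  then show ?thesis using assms(1) tendsto_cong by blast
qed

lemma tendsto_cong_right_end:
  assumes "(f \<longlongrightarrow> 0) (at_left (1::real))" "\<And>x. x \<in> {-1<..<1} \<Longrightarrow> f x = (g x :: real)"
  shows "(g \<longlongrightarrow> 0) (at_left 1)"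
proof -
  have "\<forall>\<^sub>F x in at_left (1::real). f x = g x"
    unfolding eventually_at_left_field using assms(2) by (intro exI[of _ "- 1"]) auto
  then show ?thesis using assms(1) tendsto_cong by blast
qed

text \<open>
  Eliminations leave polynomial factors. Their finitely many zeros are harmless by continuity.
\<close>
lemma poly_mult_zero_imp_zero:
  fixes h :: "real \<Rightarrow> real"
  assumes cont: "continuous_on {-1<..<1} h" and P: "P \<noteq> 0"
    and zero: "\<And>x. x \<in> {-1<..<1} \<Longrightarrow> poly P x * h x = 0" and x: "x \<in> {-1<..<1}"
  shows "h x = 0"
proof (rule ccontr)
  assume nz: "h x \<noteq> 0"
  have op: "open ({-1<..<1} \<inter> h -` (- {0}))"
    using cont by (intro continuous_open_preimage) auto
  have "{-1<..<1} \<inter> h -` (- {0}) \<subseteq> {x. poly P x = 0}" using zero by force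
  then have "finite ({-1<..<1} \<inter> h -` (- {0}))" using poly_roots_finite[OF P] finite_subset by blast
  then have "{-1<..<1} \<inter> h -` (- {0}) = {}" using op finite_imp_not_open by blast
  then show False using nz x by auto
qed

context jacobi_pair
begin

lemma interval_pos: "x \<in> {-1<..<1} \<Longrightarrow> 0 < 1 - x\<^sup>2" for x :: real
  using abs_square_less_1[of x] by (auto simp: abs_less_iff)

lemma continuous_G: "continuous_on {-1<..<1} U" "continuous_on {-1<..<1} V" "continuous_on {-1<..<1} Z"
  "continuous_on {-1<..<1} j"
  by (auto intro!: continuous_at_imp_continuous_on intro: DERIV_isCont[OF dU] DERIV_isCont[OF dV] DERIV_isCont[OF dZ] DERIV_isCont[OF dj])

text \<open>
  Differentiating the definition of \<open>j\<close>: the matrix part of the derivative reproduces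
  half the trace of the first-order coefficient times \<open>j\<close>, so only the leading
  coefficients of the entries survive.
\<close>
lemma second_relation:
  assumes x: "x \<in> {-1<..<1}"
  shows "4 * a * V x = (2 * x + ((p1 + t1) * x + (p0 + t0)) / 2) * j x + q1 * Z x - r1 * U x + (p1 - t1) * V x"
proof -
  have e: "(1 - x\<^sup>2) * j x = (q1 * x + q0) * Z x - (r1 * x + r0) * U x + ((p1 * x + p0) - (t1 * x + t0)) * V x" for x
    by (simp add: j_def U_def V_def Z_def algebra_simps)
  have d1: "((\<lambda>x. (1 - x\<^sup>2) * j x) has_real_derivative - 2 * x * j x + (1 - x\<^sup>2) * (4 * a * v x)) (at x)"
    by (auto intro!: derivative_eq_intros dj[OF x])
  have "((\<lambda>x. (1 - x\<^sup>2) * j x) has_real_derivative q1 * Z x + (q1 * x + q0) * ((r1 * x + r0) * v x + (t1 * x + t0) * z x)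
     - (r1 * U x + (r1 * x + r0) * ((p1 * x + p0) * u x + (q1 * x + q0) * v x))
     + ((p1 - t1) * V x + ((p1 * x + p0) - (t1 * x + t0)) *
        (((p1 * x + p0) * v x + (q1 * x + q0) * z x + (r1 * x + r0) * u x + (t1 * x + t0) * v x) / 2))) (at x)"
    unfolding e by (auto intro!: derivative_eq_intros dU[OF x] dV[OF x] dZ[OF x])
  from DERIV_unique[OF d1 this]
  have "4 * a * V x = 2 * x * j x + q1 * Z x - r1 * U x + (p1 - t1) * V x
     + ((p1 * x + p0) + (t1 * x + t0)) / 2 * ((q1 * x + q0) * z x - (r1 * x + r0) * u x + ((p1 * x + p0) - (t1 * x + t0)) * v x)"
    by (simp add: V_def field_simps)
  then show ?thesis unfolding j_def[symmetric] by (simp add: j_def algebra_simps add_divide_distrib)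
qed

lemma det_G_pos: "x \<in> {-1<..<1} \<Longrightarrow> 0 < U x * Z x - (V x)\<^sup>2"
proof -
  assume x: "x \<in> {-1<..<1}"
  have "U x * Z x - (V x)\<^sup>2 = (1 - x\<^sup>2)\<^sup>2 * (u x * z x - (v x)\<^sup>2)"
    by (simp add: U_def V_def Z_def power2_eq_square algebra_simps)
  moreover have "0 < (1 - x\<^sup>2)\<^sup>2" using interval_pos[OF x] by simp
  ultimately show ?thesis using positive(3)[OF x] by simp
qed

lemma G_pos: "x \<in> {-1<..<1} \<Longrightarrow> 0 < U x" "x \<in> {-1<..<1} \<Longrightarrow> 0 < Z x"
  using positive interval_pos by (simp_all add: U_def Z_def)

text \<open>The determinant obeys the trace of the system, as in Liouville's formula.\<close>
lemma det_G:
  assumes "p1 + t1 = 2 * l" and "p0 + t0 = - 2 * g"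
  obtains c where "c > 0" and "\<And>x. x \<in> {-1<..<1} \<Longrightarrow>
    U x * Z x - (V x)\<^sup>2 = c * ((1 - x) powr (- l + g) * (1 + x) powr (- l - g))"
proof -
  have "((\<lambda>x. U x * Z x - (V x)\<^sup>2) has_real_derivative
      (((p1 * x + p0) + (t1 * x + t0)) * (1 - x\<^sup>2) * (u x * z x - (v x)\<^sup>2))) (at x)" if x: "x \<in> {-1<..<1}" for x
  proof -
    let ?dV = "((p1 * x + p0) * v x + (q1 * x + q0) * z x + (r1 * x + r0) * u x + (t1 * x + t0) * v x) / 2"
    have "((\<lambda>x. U x * Z x - (V x)\<^sup>2) has_real_derivative
      (((p1 * x + p0) * u x + (q1 * x + q0) * v x) * Z x + ((r1 * x + r0) * v x + (t1 * x + t0) * z x) * U x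
        - 2 * V x * ?dV)) (at x)"
      using DERIV_diff[OF DERIV_mult[OF dU[OF x] dZ[OF x]] DERIV_power[OF dV[OF x], of 2]] by (simp add: mult_ac)
    then show ?thesis by (rule DERIV_cong) (simp add: U_def V_def Z_def power2_eq_square field_simps)
  qed
  moreover have "(1 - x\<^sup>2) * (((p1 * x + p0) + (t1 * x + t0)) * (1 - x\<^sup>2) * (u x * z x - (v x)\<^sup>2))
      = ((2 * l) * x + (- 2 * g)) * (U x * Z x - (V x)\<^sup>2)" for x
    unfolding assms[symmetric] by (simp add: U_def V_def Z_def power2_eq_square algebra_simps)
  ultimately obtain C where C: "\<And>x. x \<in> {-1<..<1} \<Longrightarrow> U x * Z x - (V x)\<^sup>2
      = C * ((1 - x) powr (- ((2 * l) + (- 2 * g)) / 2) * (1 + x) powr (((- 2 * g) - (2 * l)) / 2))"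
    using jacobi_first_order[of "\<lambda>x. U x * Z x - (V x)\<^sup>2"
      "\<lambda>x. ((p1 * x + p0) + (t1 * x + t0)) * (1 - x\<^sup>2) * (u x * z x - (v x)\<^sup>2)" "2 * l" "- 2 * g"] by blast
  have e: "- ((2 * l) + (- 2 * g)) / 2 = - l + g" "((- 2 * g) - (2 * l)) / 2 = - l - g" by auto
  have "C > 0" using C[of 0] det_G_pos[of 0] by simp
  then show thesis using C that unfolding e by blast
qed

lemma j_zero_of_a_zero:
  assumes a: "a = 0" and x: "x \<in> {-1<..<1}"
  shows "j x = 0"
proof -
  obtain C where C: "\<And>x. x \<in> {-1<..<1} \<Longrightarrow> j x = C"
    using has_field_derivative_zero_constant[of "{-1<..<1::real}" j] dj a
    by (metis convex_real_interval(8) has_field_derivative_at_within mult_zero_left mult_zero_right)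
  have "((\<lambda>_. C) \<longlongrightarrow> 0) (at_left (1::real))"
    using right_limits(4) C by (rule tendsto_cong_right_end)
  then show ?thesis using C[OF x] by (simp add: tendsto_const_iff)
qed

text \<open>
  Everything follows from a first-order equation for \<open>j\<close>: the off-diagonal entry is a
  multiple of \<open>j\<close>, and the equations for its derivative and for \<open>j\<close> itself then give the two
  diagonal entries, up to the factors \<open>q\<close> and \<open>r\<close>.
\<close>
lemma diagonal_of_first_order:
  assumes "a \<noteq> 0" and V: "\<And>x. x \<in> {-1<..<1} \<Longrightarrow> 4 * a * V x = (\<eta>1 * x + \<eta>0) * j x"
    and x: "x \<in> {-1<..<1}"
  shows "4 * a * (q1 * x + q0) * Z x
      = (\<eta>1 * (1 - x\<^sup>2) + (\<eta>1 * x + \<eta>0) * ((\<eta>1 * x + \<eta>0) - (p1 * x + p0)) + 2 * a * (1 - x\<^sup>2)) * j x" (is ?Z)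
    and "4 * a * (r1 * x + r0) * U x
      = (\<eta>1 * (1 - x\<^sup>2) + (\<eta>1 * x + \<eta>0) * ((\<eta>1 * x + \<eta>0) - (t1 * x + t0)) - 2 * a * (1 - x\<^sup>2)) * j x" (is ?U)
proof -
  let ?\<rho> = "1 - x\<^sup>2" and ?\<eta> = "\<eta>1 * x + \<eta>0"
  let ?p = "p1 * x + p0" and ?q = "q1 * x + q0" and ?r = "r1 * x + r0" and ?t = "t1 * x + t0"
  have d1: "((\<lambda>x. 4 * a * V x) has_real_derivative
      4 * a * ((?p * v x + ?q * z x + ?r * u x + ?t * v x) / 2)) (at x)"
    by (auto intro!: derivative_eq_intros dV[OF x])
  have d2: "((\<lambda>x. 4 * a * V x) has_real_derivative \<eta>1 * j x + ?\<eta> * (4 * a * v x)) (at x)"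
  proof (rule has_field_derivative_transform_within_open[of "\<lambda>x. (\<eta>1 * x + \<eta>0) * j x" _ _ "{-1<..<1}"])
    show "((\<lambda>x. (\<eta>1 * x + \<eta>0) * j x) has_real_derivative \<eta>1 * j x + ?\<eta> * (4 * a * v x)) (at x)"
      by (auto intro!: derivative_eq_intros dj[OF x])
  qed (use x V in auto)
  have dd: "4 * a * (?p * v x + ?q * z x + ?r * u x + ?t * v x) = 2 * \<eta>1 * j x + 2 * ?\<eta> * (4 * a * v x)"
    using DERIV_unique[OF d1 d2] by (simp add: field_simps)
  have jj: "j x = ?q * z x - ?r * u x + (?p - ?t) * v x" by (simp add: j_def)
  have vv: "4 * a * v x * ?\<rho> = ?\<eta> * j x" using V[OF x] by (simp add: V_def mult_ac)
  have "4 * a * (?q * z x) = \<eta>1 * j x + ?\<eta> * (4 * a * v x) - ?p * (4 * a * v x) + 2 * a * j x"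
    using dd jj by algebra
  then have "4 * a * (?q * z x) * ?\<rho>
    = \<eta>1 * j x * ?\<rho> + ?\<eta> * (4 * a * v x * ?\<rho>) - ?p * (4 * a * v x * ?\<rho>) + 2 * a * j x * ?\<rho>"
    by algebra
  then show ?Z unfolding vv Z_def by algebra
  have "4 * a * (?r * u x) = \<eta>1 * j x + ?\<eta> * (4 * a * v x) - ?t * (4 * a * v x) - 2 * a * j x"
    using dd jj by algebra
  then have "4 * a * (?r * u x) * ?\<rho>
    = \<eta>1 * j x * ?\<rho> + ?\<eta> * (4 * a * v x * ?\<rho>) - ?t * (4 * a * v x * ?\<rho>) - 2 * a * j x * ?\<rho>"
    by algebra
  then show ?U unfolding vv U_def by algebra
qed

text \<open>
  Since \<open>j\<close> has derivative $4av$, the relation is a first-order equation for \<open>j\<close> alone.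
\<close>
lemma j_of_first_order:
  assumes V: "\<And>x. x \<in> {-1<..<1} \<Longrightarrow> 4 * a * V x = (\<eta>1 * x + \<eta>0) * j x"
    and nz: "x0 \<in> {-1<..<1}" "j x0 \<noteq> 0"
  obtains C where "C \<noteq> 0" and "\<And>x. x \<in> {-1<..<1} \<Longrightarrow>
      j x = C * ((1 - x) powr (- (\<eta>1 + \<eta>0) / 2) * (1 + x) powr ((\<eta>0 - \<eta>1) / 2))"
    and "\<eta>1 + \<eta>0 < 0" and "\<eta>1 < \<eta>0"
proof -
  have "(1 - x\<^sup>2) * (4 * a * v x) = (\<eta>1 * x + \<eta>0) * j x" if "x \<in> {-1<..<1}" for x
    using V[OF that] by (simp add: V_def mult_ac)
  then obtain C where C: "\<And>x. x \<in> {-1<..<1} \<Longrightarrow>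
      j x = C * ((1 - x) powr (- (\<eta>1 + \<eta>0) / 2) * (1 + x) powr ((\<eta>0 - \<eta>1) / 2))"
    using jacobi_first_order[OF dj] by blast
  have C0: "C \<noteq> 0" using C[OF nz(1)] nz(2) by auto
  have "0 < - (\<eta>1 + \<eta>0) / 2"
    by (rule jacobi_factor_exponent_right[OF tendsto_cong_right_end[OF right_limits(4) C] C0])
  moreover have "0 < (\<eta>0 - \<eta>1) / 2"
    by (rule jacobi_factor_exponent_left[OF tendsto_cong_left_end[OF left_limits(4) C] C0])
  ultimately show thesis using that[OF C0 C] by simp
qed

end

section \<open>Solving the system from one linear relation; the first family\<close>

lemma powr_two_plus_double:
  fixes x e :: real
  assumes "0 < x"
  shows "x powr (2 + 2 * e) = x\<^sup>2 * (x powr e)\<^sup>2"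
proof -
  have "x powr (2 + 2 * e) = x powr 2 * (x powr e * x powr e)" by (simp flip: powr_add)
  then show ?thesis using assms by (simp add: power2_eq_square)
qed

context jacobi_pair
begin

text \<open>
  Here \<open>\<zeta>\<close> is the quotient in \<open>diagonal_of_first_order\<close>; that the division by the
  entry $q_1x+q_0$ is exact is where the parameters of a family enter.
\<close>
lemma solution_diagonal:
  fixes \<zeta> :: "real \<Rightarrow> real"
  assumes a: "a \<noteq> 0" and V: "\<And>x. x \<in> {-1<..<1} \<Longrightarrow> 4 * a * V x = (\<eta>1 * x + \<eta>0) * j x"
    and nz: "x0 \<in> {-1<..<1}" "j x0 \<noteq> 0"
    and q: "q1 \<noteq> 0 \<or> q0 \<noteq> 0" and cont: "continuous_on {-1<..<1} \<zeta>"
    and \<zeta>: "\<And>x. (q1 * x + q0) * \<zeta> x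
      = \<eta>1 * (1 - x\<^sup>2) + (\<eta>1 * x + \<eta>0) * ((\<eta>1 * x + \<eta>0) - (p1 * x + p0)) + 2 * a * (1 - x\<^sup>2)"
  obtains c where "c \<noteq> 0" and "\<eta>1 + \<eta>0 < 0" and "\<eta>1 < \<eta>0"
    and "\<And>x. x \<in> {-1<..<1} \<Longrightarrow> j x = 4 * a * c * ((1 - x) powr (- (\<eta>1 + \<eta>0) / 2) * (1 + x) powr ((\<eta>0 - \<eta>1) / 2))"
    and "\<And>x. x \<in> {-1<..<1} \<Longrightarrow> V x = c * ((1 - x) powr (- (\<eta>1 + \<eta>0) / 2) * (1 + x) powr ((\<eta>0 - \<eta>1) / 2)) * (\<eta>1 * x + \<eta>0)"
    and "\<And>x. x \<in> {-1<..<1} \<Longrightarrow> Z x = c * ((1 - x) powr (- (\<eta>1 + \<eta>0) / 2) * (1 + x) powr ((\<eta>0 - \<eta>1) / 2)) * \<zeta> x"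
proof -
  obtain C where C: "C \<noteq> 0" and jC: "\<And>x. x \<in> {-1<..<1} \<Longrightarrow>
      j x = C * ((1 - x) powr (- (\<eta>1 + \<eta>0) / 2) * (1 + x) powr ((\<eta>0 - \<eta>1) / 2))"
    and e: "\<eta>1 + \<eta>0 < 0" "\<eta>1 < \<eta>0"
    using j_of_first_order[OF V nz] by blast
  have Z: "4 * a * Z x - \<zeta> x * j x = 0" if x: "x \<in> {-1<..<1}" for x
  proof (rule poly_mult_zero_imp_zero[where P = "[:q0, q1:]", OF _ _ _ x])
    show "continuous_on {-1<..<1} (\<lambda>x. 4 * a * Z x - \<zeta> x * j x)"
      by (intro continuous_intros continuous_G cont)
    show "[:q0, q1:] \<noteq> 0" using q by auto
    show "poly [:q0, q1:] y * (4 * a * Z y - \<zeta> y * j y) = 0" if y: "y \<in> {-1<..<1}" for y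
    proof -
      have "poly [:q0, q1:] y * (4 * a * Z y - \<zeta> y * j y)
          = 4 * a * (q1 * y + q0) * Z y - ((q1 * y + q0) * \<zeta> y) * j y" by (simp add: algebra_simps)
      also have "\<dots> = 0" using diagonal_of_first_order(1)[OF a V y] by (simp only: \<zeta>)
      finally show ?thesis .
    qed
  qed
  show thesis
  proof (rule that[of "C / (4 * a)"])
    show "V x = C / (4 * a) * ((1 - x) powr (- (\<eta>1 + \<eta>0) / 2) * (1 + x) powr ((\<eta>0 - \<eta>1) / 2)) * (\<eta>1 * x + \<eta>0)"
      if "x \<in> {-1<..<1}" for x
      using V[OF that] jC[OF that] a by (simp add: field_simps)
    show "Z x = C / (4 * a) * ((1 - x) powr (- (\<eta>1 + \<eta>0) / 2) * (1 + x) powr ((\<eta>0 - \<eta>1) / 2)) * \<zeta> x"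
      if "x \<in> {-1<..<1}" for x
      using Z[OF that] jC[OF that] a by (simp add: field_simps)
  qed (use C a e jC in auto)
qed

text \<open>
  Multiplying the two diagonal entries from \<open>diagonal_of_first_order\<close> avoids solving for \<open>U\<close>.
\<close>
lemma solution_determinant:
  fixes \<zeta> \<delta> :: "real \<Rightarrow> real"
  assumes a: "a \<noteq> 0" and V: "\<And>x. x \<in> {-1<..<1} \<Longrightarrow> 4 * a * V x = (\<eta>1 * x + \<eta>0) * j x"
    and q: "q1 \<noteq> 0 \<or> q0 \<noteq> 0" and r: "r1 \<noteq> 0 \<or> r0 \<noteq> 0" and cont: "continuous_on {-1<..<1} \<delta>"
    and \<delta>: "\<And>x. (q1 * x + q0) * (r1 * x + r0) * (\<delta> x + (\<eta>1 * x + \<eta>0)\<^sup>2)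
      = (\<eta>1 * (1 - x\<^sup>2) + (\<eta>1 * x + \<eta>0) * ((\<eta>1 * x + \<eta>0) - (p1 * x + p0)) + 2 * a * (1 - x\<^sup>2))
        * (\<eta>1 * (1 - x\<^sup>2) + (\<eta>1 * x + \<eta>0) * ((\<eta>1 * x + \<eta>0) - (t1 * x + t0)) - 2 * a * (1 - x\<^sup>2))"
    and x: "x \<in> {-1<..<1}"
  shows "16 * a\<^sup>2 * (U x * Z x - (V x)\<^sup>2) = \<delta> x * (j x)\<^sup>2"
proof -
  have "16 * a\<^sup>2 * (U x * Z x - (V x)\<^sup>2) - \<delta> x * (j x)\<^sup>2 = 0"
  proof (rule poly_mult_zero_imp_zero[where P = "[:q0, q1:] * [:r0, r1:]", OF _ _ _ x])
    show "continuous_on {-1<..<1} (\<lambda>x. 16 * a\<^sup>2 * (U x * Z x - (V x)\<^sup>2) - \<delta> x * (j x)\<^sup>2)"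
      by (intro continuous_intros continuous_G cont)
    have "[:q0, q1:] \<noteq> 0" "[:r0, r1:] \<noteq> 0" using q r by auto
    then show "[:q0, q1:] * [:r0, r1:] \<noteq> 0" using no_zero_divisors by blast
    fix y :: real assume y: "y \<in> {-1<..<1}"
    have "poly ([:q0, q1:] * [:r0, r1:]) y * (16 * a\<^sup>2 * (U y * Z y - (V y)\<^sup>2) - \<delta> y * (j y)\<^sup>2)
      = (4 * a * (q1 * y + q0) * Z y) * (4 * a * (r1 * y + r0) * U y)
        - (q1 * y + q0) * (r1 * y + r0) * (4 * a * V y)\<^sup>2 - (q1 * y + q0) * (r1 * y + r0) * \<delta> y * (j y)\<^sup>2"
      by (simp add: power2_eq_square) algebra
    also have "\<dots> = (4 * a * (q1 * y + q0) * Z y) * (4 * a * (r1 * y + r0) * U y)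
        - ((q1 * y + q0) * (r1 * y + r0) * (\<delta> y + (\<eta>1 * y + \<eta>0)\<^sup>2)) * (j y)\<^sup>2"
      unfolding V[OF y] by algebra
    also have "\<dots> = 0"
      unfolding \<delta> diagonal_of_first_order(1)[OF a _ y, of \<eta>1 \<eta>0, OF V, simplified]
        diagonal_of_first_order(2)[OF a _ y, of \<eta>1 \<eta>0, OF V, simplified] by algebra
    finally show "poly ([:q0, q1:] * [:r0, r1:]) y * (16 * a\<^sup>2 * (U y * Z y - (V y)\<^sup>2) - \<delta> y * (j y)\<^sup>2) = 0" .
  qed
  then show ?thesis by simp
qed

text \<open>
  Without leading off-diagonal coefficients \<open>second_relation\<close> is already the relation between
  \<open>V\<close> and \<open>j\<close>, and \<open>q0\<close> and \<open>r0\<close> are constants. They are not zero: otherwise a quadratic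
  polynomial with non-zero leading coefficient would vanish identically, or the exponents of \<open>j\<close>
  would not be positive.
\<close>
lemma solution_family_I:
  assumes a: "a \<noteq> 0" and par: "p1 = l" "t1 = l" "q1 = 0" "r1 = 0" "p0 = - g - h" "t0 = - g + h" "g = a * h"
    and q0: "q0 = - 2 * a - l"
    and nz: "x0 \<in> {-1<..<1}" "j x0 \<noteq> 0"
  obtains c where "c \<noteq> 0" and "q0 \<noteq> 0" and "q0 * r0 = 4 - h\<^sup>2" and "4 - h\<^sup>2 \<noteq> 0"
    and "\<And>x. x \<in> {-1<..<1} \<Longrightarrow> V x = c * ((1 - x) powr (- l / 2 - 1 + g / 2) * (1 + x) powr (- l / 2 - 1 - g / 2)) * ((l + 2) * x - g)"
    and "\<And>x. x \<in> {-1<..<1} \<Longrightarrow> Z x = c * ((1 - x) powr (- l / 2 - 1 + g / 2) * (1 + x) powr (- l / 2 - 1 - g / 2))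
        * (((l + 2 - 2 * a) * (x\<^sup>2 + h * x + 1) + 4 * a - a * h\<^sup>2) / q0)"
    and "\<And>x. x \<in> {-1<..<1} \<Longrightarrow> U x * Z x - (V x)\<^sup>2
        = c\<^sup>2 * ((1 - x) powr (- l / 2 - 1 + g / 2) * (1 + x) powr (- l / 2 - 1 - g / 2))\<^sup>2
        * ((1 - x\<^sup>2)\<^sup>2 * ((l + 2)\<^sup>2 - 4 * a\<^sup>2) / (4 - h\<^sup>2))"
proof -
  let ?J = "\<lambda>x. (1 - x) powr (- l / 2 - 1 + g / 2) * (1 + x) powr (- l / 2 - 1 - g / 2)"
  have V: "4 * a * V x = ((l + 2) * x + (- g)) * j x" if "x \<in> {-1<..<1}" for x
    using second_relation[OF that] by (simp add: par field_simps)
  obtain C where C: "C \<noteq> 0" and jC: "\<And>x. x \<in> {-1<..<1} \<Longrightarrow>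
      j x = C * ((1 - x) powr (- ((l + 2) + (- g)) / 2) * (1 + x) powr (((- g) - (l + 2)) / 2))"
    and e: "(l + 2) + (- g) < 0" "l + 2 < - g"
    using j_of_first_order[OF V nz] by blast
  have ex: "- ((l + 2) + (- g)) / 2 = - l / 2 - 1 + g / 2" "((- g) - (l + 2)) / 2 = - l / 2 - 1 - g / 2"
    by (auto simp: field_simps)
  have l2: "l + 2 < 0" using e by auto
  have jC: "j x = C * ?J x" if "x \<in> {-1<..<1}" for x using jC[OF that] unfolding ex .
  have jnz: "j x \<noteq> 0" if "x \<in> {-1<..<1}" for x using jC[OF that] C that by auto
  have Zq: "4 * a * q0 * Z x = ((l + 2 - 2 * a) * (x\<^sup>2 + h * x + 1) + 4 * a - a * h\<^sup>2) * j x" if "x \<in> {-1<..<1}" for x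
  proof -
    have "(l + 2) * (1 - x\<^sup>2) + ((l + 2) * x + (- g)) * (((l + 2) * x + (- g)) - (p1 * x + p0)) + 2 * a * (1 - x\<^sup>2)
      = (l + 2 - 2 * a) * (x\<^sup>2 + h * x + 1) + 4 * a - a * h\<^sup>2" unfolding par by algebra
    then show ?thesis using diagonal_of_first_order(1)[OF a V that] by (simp only: par(3)) simp
  qed
  have Ur: "4 * a * r0 * U x = ((l + 2 + 2 * a) * (x\<^sup>2 - h * x + 1) - 4 * a + a * h\<^sup>2) * j x" if "x \<in> {-1<..<1}" for x
  proof -
    have "(l + 2) * (1 - x\<^sup>2) + ((l + 2) * x + (- g)) * (((l + 2) * x + (- g)) - (t1 * x + t0)) - 2 * a * (1 - x\<^sup>2)
      = (l + 2 + 2 * a) * (x\<^sup>2 - h * x + 1) - 4 * a + a * h\<^sup>2" unfolding par by algebra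
    then show ?thesis using diagonal_of_first_order(2)[OF a V that] by (simp only: par(4)) simp
  qed
  \<comment> \<open>Three values of the quadratic polynomial suffice to read off its leading coefficient.\<close>
  have q: "q0 \<noteq> 0"
  proof
    assume "q0 = 0"
    then have f: "(l + 2 - 2 * a) * (x\<^sup>2 + h * x + 1) + 4 * a - a * h\<^sup>2 = 0" if "x \<in> {-1<..<1}" for x
      using Zq[OF that] jnz[OF that] by simp
    have la: "l = - 2 * a" using \<open>q0 = 0\<close> q0 by simp
    have f': "(l + 2 - 2 * a) * (1/4 + h * (1/2) + 1) + 4 * a - a * h\<^sup>2 = 0"
      "(l + 2 - 2 * a) * (1/4 - h * (1/2) + 1) + 4 * a - a * h\<^sup>2 = 0"
      using f[of "1/2"] f[of "-1/2"] by (simp_all add: power2_eq_square)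
    have "(l + 2 - 2 * a) * (1/2) = 0" using f[of 0] f' by simp algebra
    then show False using l2 la by simp
  qed
  have r: "r0 \<noteq> 0"
  proof
    assume "r0 = 0"
    then have f: "(l + 2 + 2 * a) * (x\<^sup>2 - h * x + 1) - 4 * a + a * h\<^sup>2 = 0" if "x \<in> {-1<..<1}" for x
      using Ur[OF that] jnz[OF that] by simp
    have f': "(l + 2 + 2 * a) * (1/4 - h * (1/2) + 1) - 4 * a + a * h\<^sup>2 = 0"
      "(l + 2 + 2 * a) * (1/4 + h * (1/2) + 1) - 4 * a + a * h\<^sup>2 = 0"
      using f[of "1/2"] f[of "-1/2"] by (simp_all add: power2_eq_square)
    have "(l + 2 + 2 * a) * (1/2) = 0" using f[of 0] f' by simp algebra
    then have la: "l + 2 = - 2 * a" by simp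
    have "a * (h\<^sup>2 - 4) = 0" using f[of 0] la by (simp add: algebra_simps)
    then have "h\<^sup>2 = 2\<^sup>2" using a by simp
    then have "h = 2 \<or> h = - 2" by (simp only: power2_eq_iff)
    then show False using e la par(7) by auto
  qed
  obtain c where c: "c > 0" "\<And>x. x \<in> {-1<..<1} \<Longrightarrow>
    U x * Z x - (V x)\<^sup>2 = c * ((1 - x) powr (- l + g) * (1 + x) powr (- l - g))"
    using det_G[of l g] par by auto
  have J2: "(1 - x) powr (- l + g) * (1 + x) powr (- l - g) = (1 - x\<^sup>2)\<^sup>2 * (?J x)\<^sup>2" if x: "x \<in> {-1<..<1}" for x
  proof -
    have p: "0 < 1 - x" "0 < 1 + x" using x by auto
    have e: "- l + g = 2 + 2 * (- l / 2 - 1 + g / 2)" "- l - g = 2 + 2 * (- l / 2 - 1 - g / 2)"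
      by (simp_all add: field_simps)
    show ?thesis unfolding e powr_two_plus_double[OF p(1)] powr_two_plus_double[OF p(2)] by algebra
  qed
  \<comment> \<open>Liouville's formula and the product of the diagonal entries give two expressions for the determinant; comparing them at $x = 1$ gives \<open>q0 * r0 = 4 - h\<^sup>2\<close>.\<close>
  have qr: "q0 * r0 = 4 - h\<^sup>2"
  proof -
    define k where "k = 16 * a\<^sup>2 * q0 * r0 * c / C\<^sup>2"
    have k: "k * C\<^sup>2 = 16 * a\<^sup>2 * q0 * r0 * c" using C by (simp add: k_def)
    have pz: "poly ([:- g, l + 2:]\<^sup>2 * [:4 - h\<^sup>2 - q0 * r0:] + [:1, 0, -1:]\<^sup>2 * [:(l + 2)\<^sup>2 - 4 * a\<^sup>2 - k:]) x * 1 = 0"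
      if x: "x \<in> {-1<..<1}" for x
    proof -
      have "(4 * a * q0 * Z x) * (4 * a * r0 * U x) - q0 * r0 * (4 * a * V x)\<^sup>2 = 16 * a\<^sup>2 * q0 * r0 * (c * ((1 - x\<^sup>2)\<^sup>2 * (?J x)\<^sup>2))"
        unfolding J2[OF x, symmetric] c(2)[OF x, symmetric] by algebra
      then have "((l + 2 - 2 * a) * (x\<^sup>2 + h * x + 1) + 4 * a - a * h\<^sup>2) * ((l + 2 + 2 * a) * (x\<^sup>2 - h * x + 1) - 4 * a + a * h\<^sup>2) * (j x)\<^sup>2
          - q0 * r0 * ((l + 2) * x - g)\<^sup>2 * (j x)\<^sup>2 = k * ((1 - x\<^sup>2)\<^sup>2 * (j x)\<^sup>2)"
        unfolding Zq[OF x] Ur[OF x] V[OF x] using jC[OF x] k by algebra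
      then have "(((l + 2 - 2 * a) * (x\<^sup>2 + h * x + 1) + 4 * a - a * h\<^sup>2) * ((l + 2 + 2 * a) * (x\<^sup>2 - h * x + 1) - 4 * a + a * h\<^sup>2)
          - q0 * r0 * ((l + 2) * x - g)\<^sup>2 - k * (1 - x\<^sup>2)\<^sup>2) * (j x)\<^sup>2 = 0"
        by algebra
      then have "((l + 2 - 2 * a) * (x\<^sup>2 + h * x + 1) + 4 * a - a * h\<^sup>2) * ((l + 2 + 2 * a) * (x\<^sup>2 - h * x + 1) - 4 * a + a * h\<^sup>2)
          - q0 * r0 * ((l + 2) * x - g)\<^sup>2 - k * (1 - x\<^sup>2)\<^sup>2 = 0"
        using jnz[OF x] by simp
      then show ?thesis unfolding par(7) by (simp add: power2_eq_square) algebra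
    qed
    have "[:- g, l + 2:]\<^sup>2 * [:4 - h\<^sup>2 - q0 * r0:] + [:1, 0, -1:]\<^sup>2 * [:(l + 2)\<^sup>2 - 4 * a\<^sup>2 - k:] = 0"
      using poly_mult_zero_imp_zero[where h = "\<lambda>_. 1" and x = 0, OF _ _ pz] by auto
    then have "poly ([:- g, l + 2:]\<^sup>2 * [:4 - h\<^sup>2 - q0 * r0:] + [:1, 0, -1:]\<^sup>2 * [:(l + 2)\<^sup>2 - 4 * a\<^sup>2 - k:]) 1 = 0"
      by simp
    moreover have "poly ([:- g, l + 2:]\<^sup>2 * [:4 - h\<^sup>2 - q0 * r0:] + [:1, 0, -1:]\<^sup>2 * [:(l + 2)\<^sup>2 - 4 * a\<^sup>2 - k:]) 1
        = (l + 2 - g)\<^sup>2 * (4 - h\<^sup>2 - q0 * r0)"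
      by (simp add: power2_eq_square algebra_simps)
    ultimately have "(l + 2 - g)\<^sup>2 * (4 - h\<^sup>2 - q0 * r0) = 0" by (simp only:)
    then show ?thesis using e by auto
  qed
  have h4: "4 - h\<^sup>2 \<noteq> 0" using qr q r by auto
  have det: "16 * a\<^sup>2 * (U x * Z x - (V x)\<^sup>2) = ((1 - x\<^sup>2)\<^sup>2 * ((l + 2)\<^sup>2 - 4 * a\<^sup>2) / (4 - h\<^sup>2)) * (j x)\<^sup>2"
    if x: "x \<in> {-1<..<1}" for x
  proof -
    have "(4 - h\<^sup>2) * (16 * a\<^sup>2 * (U x * Z x - (V x)\<^sup>2)) = (4 * a * q0 * Z x) * (4 * a * r0 * U x) - q0 * r0 * (4 * a * V x)\<^sup>2"
      unfolding qr[symmetric] by algebra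
    also have "\<dots> = ((1 - x\<^sup>2)\<^sup>2 * ((l + 2)\<^sup>2 - 4 * a\<^sup>2)) * (j x)\<^sup>2"
      unfolding Zq[OF x] Ur[OF x] V[OF x] qr par(7) by algebra
    finally show ?thesis using h4 by (simp add: field_simps)
  qed
  show thesis
  proof (rule that[of "C / (4 * a)"])
    show "V x = C / (4 * a) * ?J x * ((l + 2) * x - g)" if "x \<in> {-1<..<1}" for x
      using V[OF that] jC[OF that] a by (simp add: field_simps)
    show "Z x = C / (4 * a) * ?J x * (((l + 2 - 2 * a) * (x\<^sup>2 + h * x + 1) + 4 * a - a * h\<^sup>2) / q0)"
      if "x \<in> {-1<..<1}" for x
      using Zq[OF that] jC[OF that] a q by (simp add: field_simps)
    show "U x * Z x - (V x)\<^sup>2 = (C / (4 * a))\<^sup>2 * (?J x)\<^sup>2 * ((1 - x\<^sup>2)\<^sup>2 * ((l + 2)\<^sup>2 - 4 * a\<^sup>2) / (4 - h\<^sup>2))"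
      if "x \<in> {-1<..<1}" for x
    proof -
      have "U x * Z x - (V x)\<^sup>2 = ((1 - x\<^sup>2)\<^sup>2 * ((l + 2)\<^sup>2 - 4 * a\<^sup>2) / (4 - h\<^sup>2)) * (j x)\<^sup>2 / (16 * a\<^sup>2)"
        unfolding det[OF that, symmetric] using a by simp
      also have "\<dots> = (C / (4 * a))\<^sup>2 * (?J x)\<^sup>2 * ((1 - x\<^sup>2)\<^sup>2 * ((l + 2)\<^sup>2 - 4 * a\<^sup>2) / (4 - h\<^sup>2))"
        unfolding jC[OF that] by (simp add: power_mult_distrib power_divide mult_ac)
      finally show ?thesis .
    qed
  qed (use C a q qr h4 in auto)
qed

end

section \<open>The second family\<close>

context jacobi_pair
begin

lemma defect_derivative:
  assumes x: "x \<in> {-1<..<1}"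
  shows "((\<lambda>x. (\<eta>1 * x + \<eta>0) * j x - 4 * a * V x) has_real_derivative
    \<eta>1 * j x + (\<eta>1 * x + \<eta>0) * (4 * a * v x)
      - 2 * a * ((p1 * x + p0) * v x + (q1 * x + q0) * z x + (r1 * x + r0) * u x + (t1 * x + t0) * v x)) (at x)"
  by (auto intro!: derivative_eq_intros dj[OF x] dV[OF x])

lemma defect_limits:
  "((\<lambda>x. (\<eta>1 * x + \<eta>0) * j x - 4 * a * V x) \<longlongrightarrow> 0) (at_left 1)"
  "((\<lambda>x. (\<eta>1 * x + \<eta>0) * j x - 4 * a * V x) \<longlongrightarrow> 0) (at_right (- 1))"
proof -
  have "((\<lambda>x. (\<eta>1 * x + \<eta>0) * j x - 4 * a * V x) \<longlongrightarrow> (\<eta>1 * 1 + \<eta>0) * 0 - 4 * a * 0) (at_left 1)"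
    by (intro tendsto_intros right_limits)
  then show "((\<lambda>x. (\<eta>1 * x + \<eta>0) * j x - 4 * a * V x) \<longlongrightarrow> 0) (at_left 1)" by simp
  have "((\<lambda>x. (\<eta>1 * x + \<eta>0) * j x - 4 * a * V x) \<longlongrightarrow> (\<eta>1 * (- 1) + \<eta>0) * 0 - 4 * a * 0) (at_right (- 1))"
    by (intro tendsto_intros left_limits)
  then show "((\<lambda>x. (\<eta>1 * x + \<eta>0) * j x - 4 * a * V x) \<longlongrightarrow> 0) (at_right (- 1))" by simp
qed

text \<open>
  The equations for \<open>V\<close> and for \<open>Z\<close> each give a first-order equation for the defect \<open>T\<close>. Their
  difference is a linear polynomial times \<open>T\<close>. That polynomial is zero only for $\lambda = 4a-1$ and
  $2am = 4a+1$, and then \<open>T\<close> is a multiple of $(1-x)^{-\lambda}$, which does not tend to zero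
  at $-1$.
\<close>
lemma first_order_family_II:
  assumes a: "a \<noteq> 0" and par: "p1 = l - 1/2" "q1 = 2" "r1 = 0" "t1 = l + 1/2"
      "p0 = (l - 1/2) + (2 * a + 1) * m - 4 * a" "q0 = 6 - 2 * m" "r0 = m / 2" "t0 = (l + 1/2) + (2 * a - 1) * m - 4 * a + 2"
    and x: "x \<in> {-1<..<1}"
  defines "\<eta>0 \<equiv> l + 3/2 - 4 * a + 2 * a * m"
  shows "4 * a * V x = ((l + 3/2) * x + \<eta>0) * j x"
proof -
  define T where "T x = ((l + 3/2) * x + \<eta>0) * j x - 4 * a * V x" for x
  define T' where "T' x = (l + 3/2) * j x + ((l + 3/2) * x + \<eta>0) * (4 * a * v x)
      - 2 * a * ((p1 * x + p0) * v x + (q1 * x + q0) * z x + (r1 * x + r0) * u x + (t1 * x + t0) * v x)" for x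
  have dT: "(T has_real_derivative T' x) (at x)" if "x \<in> {-1<..<1}" for x
    unfolding T_def[abs_def] T'_def by (rule defect_derivative[OF that])
  have V: "4 * a * V x = ((l + 3/2) * x + \<eta>0) * j x - T x" for x by (simp add: T_def)
  have Z: "8 * a * Z x = ((l + 3/2 - 2 * a) * (x + 1) + 2 * a * m) * j x - (1 + 4 * a) * T x"
    if x: "x \<in> {-1<..<1}" for x
  proof -
    have "2 * Z x = (1 + 4 * a) * V x - ((2 + l) * x + (l + 1 + 2 * a * m - 4 * a)) * j x"
      using second_relation[OF x] unfolding par by (simp add: field_simps)
    then have "8 * a * Z x = (1 + 4 * a) * (4 * a * V x) - 4 * a * ((2 + l) * x + (l + 1 + 2 * a * m - 4 * a)) * j x"
      by algebra
    then show ?thesis unfolding V \<eta>0_def by (simp add: field_simps)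
  qed
  have jj: "(1 - x\<^sup>2) * j x = (2 * x + q0) * Z x - r0 * U x + ((p1 * x + p0) - (t1 * x + t0)) * V x" for x
    by (simp add: j_def U_def V_def Z_def par(2,3) algebra_simps)
  have A: "(1 - x\<^sup>2) * T' x = ((4 * a - 1) * (x + 1) + m + (1 + 4 * a) * (2 - m)) * T x" if x: "x \<in> {-1<..<1}" for x
  proof -
    have "(1 - x\<^sup>2) * T' x = (l + 3/2) * (1 - x\<^sup>2) * j x + ((l + 3/2) * x + \<eta>0) * (4 * a * V x)
      - 2 * a * ((p1 * x + p0) * V x + (2 * x + q0) * Z x + r0 * U x + (t1 * x + t0) * V x)"
      by (simp add: T'_def U_def V_def Z_def par(2,3) algebra_simps)
    also have "\<dots> = (l + 3/2) * (1 - x\<^sup>2) * j x + ((l + 3/2) * x + \<eta>0) * (4 * a * V x)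
      - (p1 * x + p0) * (4 * a * V x) - (2 * x + q0) * (8 * a * Z x) / 2 + 2 * a * (1 - x\<^sup>2) * j x"
      using jj[of x] by (simp add: algebra_simps) algebra
    also have "\<dots> = ((4 * a - 1) * (x + 1) + m + (1 + 4 * a) * (2 - m)) * T x"
      unfolding V Z[OF x] unfolding par \<eta>0_def by (simp add: field_simps power2_eq_square)
    finally show ?thesis .
  qed
  have B: "(1 + 4 * a) * ((1 - x\<^sup>2) * T' x) = ((1 + 4 * a) * ((l + 1/2) * (x + 1) + (2 * a - 1) * m - 4 * a + 2)
      - ((l + 3/2 - 2 * a) * (x + 1) + 2 * a * m) + m) * T x" if x: "x \<in> {-1<..<1}" for x
  proof -
    have d1: "((\<lambda>x. 8 * a * Z x) has_real_derivative 8 * a * (r0 * v x + (t1 * x + t0) * z x)) (at x)"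
      using dZ[OF x] by (auto intro!: derivative_eq_intros simp: par(3))
    have d2: "((\<lambda>x. 8 * a * Z x) has_real_derivative
      (l + 3/2 - 2 * a) * j x + ((l + 3/2 - 2 * a) * (x + 1) + 2 * a * m) * (4 * a * v x) - (1 + 4 * a) * T' x) (at x)"
      by (rule has_field_derivative_transform_within_open[of "\<lambda>x. ((l + 3/2 - 2 * a) * (x + 1) + 2 * a * m) * j x - (1 + 4 * a) * T x" _ _ "{-1<..<1}"])
        (use x Z in \<open>auto intro!: derivative_eq_intros dj[OF x] dT[OF x]\<close>)
    have "(1 + 4 * a) * ((1 - x\<^sup>2) * T' x) = (l + 3/2 - 2 * a) * (1 - x\<^sup>2) * j x
       + ((l + 3/2 - 2 * a) * (x + 1) + 2 * a * m) * (4 * a * V x) - 2 * r0 * (4 * a * V x) - (t1 * x + t0) * (8 * a * Z x)"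
      using DERIV_unique[OF d1 d2] unfolding V_def Z_def by algebra
    also have "\<dots> = ((1 + 4 * a) * ((l + 1/2) * (x + 1) + (2 * a - 1) * m - 4 * a + 2)
      - ((l + 3/2 - 2 * a) * (x + 1) + 2 * a * m) + m) * T x"
      unfolding V Z[OF x] unfolding par \<eta>0_def by (simp add: field_simps power2_eq_square)
    finally show ?thesis .
  qed
  have cT: "continuous_on {-1<..<1} T"
    unfolding T_def[abs_def] by (intro continuous_intros continuous_G)
  have diff: "poly [:4 * a * (4 * a - l - 1) + 12 * a * (1 + 4 * a) - 24 * a\<^sup>2 * m, 4 * a * (4 * a - l - 1):] x * T x = 0"
    if x: "x \<in> {-1<..<1}" for x
  proof -
    have "poly [:4 * a * (4 * a - l - 1) + 12 * a * (1 + 4 * a) - 24 * a\<^sup>2 * m, 4 * a * (4 * a - l - 1):] x * T x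
      = (1 + 4 * a) * (((4 * a - 1) * (x + 1) + m + (1 + 4 * a) * (2 - m)) * T x) - ((1 + 4 * a) * ((l + 1/2) * (x + 1) + (2 * a - 1) * m - 4 * a + 2)
      - ((l + 3/2 - 2 * a) * (x + 1) + 2 * a * m) + m) * T x" by (simp add: power2_eq_square field_simps)
    then show ?thesis unfolding A[OF x, symmetric] B[OF x, symmetric] by simp
  qed
  have "T x = 0"
  proof (cases "[:4 * a * (4 * a - l - 1) + 12 * a * (1 + 4 * a) - 24 * a\<^sup>2 * m, 4 * a * (4 * a - l - 1):] = 0")
    case False
    from poly_mult_zero_imp_zero[OF cT this diff x] show ?thesis .
  next
    case True
    then have l: "l = 4 * a - 1" using a by simp
    have "12 * a * (1 + 4 * a - 2 * a * m) = 0" using True unfolding l by (simp add: power2_eq_square algebra_simps)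
    then have m: "2 * a * m = 1 + 4 * a" using a by simp
    have "m + (1 + 4 * a) * (2 - m) = 0" using m by (simp add: algebra_simps)
    then have "(1 - x\<^sup>2) * T' x = (l * x + l) * T x" if x: "x \<in> {-1<..<1}" for x
      using A[OF x] by (simp add: l algebra_simps)
    then obtain C where C: "\<And>x. x \<in> {-1<..<1} \<Longrightarrow> T x = C * ((1 - x) powr (- (l + l) / 2) * (1 + x) powr ((l - l) / 2))"
      using jacobi_first_order[OF dT] by blast
    have "C = 0"
    proof (rule ccontr)
      assume "C \<noteq> 0"
      from jacobi_factor_exponent_left[OF tendsto_cong_left_end[OF _ C] this]
      show False using defect_limits(2)[of "l + 3/2" \<eta>0] by (simp add: T_def[abs_def])
    qed
    then show ?thesis using C[OF x] by simp
  qed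
  then show "4 * a * V x = ((l + 3/2) * x + \<eta>0) * j x" using V by simp
qed

text \<open>
  The parameter \<open>m\<close> stands for $(4a-2\lambda-1)B_{21}$. It is not zero, as otherwise the equation
  for \<open>U\<close> would read $2a(1-x)^2 j = 0$.
\<close>
lemma solution_family_II:
  assumes a: "a \<noteq> 0" and par: "p1 = l - 1/2" "q1 = 2" "r1 = 0" "t1 = l + 1/2"
      "p0 = (l - 1/2) + (2 * a + 1) * m - 4 * a" "q0 = 6 - 2 * m" "r0 = m / 2" "t0 = (l + 1/2) + (2 * a - 1) * m - 4 * a + 2"
    and g: "g = 4 * a - l - 1 - 2 * a * m"
    and nz: "x0 \<in> {-1<..<1}" "j x0 \<noteq> 0"
  defines "J \<equiv> \<lambda>x. (1 - x) powr (- l / 2 - 1 + g / 2) * (1 + x) powr (- l / 2 - 1 - g / 2 + 1 / 2)"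
  obtains c where "c \<noteq> 0" and "m \<noteq> 0"
    and "\<And>x. x \<in> {-1<..<1} \<Longrightarrow> V x = c * J x * ((l + 3/2) * (x + 1) - 4 * a + 2 * a * m)"
    and "\<And>x. x \<in> {-1<..<1} \<Longrightarrow> Z x = c * J x * (((l + 3/2 - 2 * a) * (x + 1) + 2 * a * m) / 2)"
    and "\<And>x. x \<in> {-1<..<1} \<Longrightarrow> U x * Z x - (V x)\<^sup>2 = c\<^sup>2 * (J x)\<^sup>2 * (a * (2 * l + 3 - 4 * a) / m * ((1 + x) * (1 - x)\<^sup>2))"
proof -
  let ?\<eta>0 = "l + 3/2 - 4 * a + 2 * a * m"
  let ?\<zeta> = "\<lambda>x. ((l + 3/2 - 2 * a) * (x + 1) + 2 * a * m) / 2"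
  let ?\<delta> = "\<lambda>x. a * (2 * l + 3 - 4 * a) / m * ((1 + x) * (1 - x)\<^sup>2)"
  note V = first_order_family_II[OF a par]
  have ex: "- ((l + 3/2) + ?\<eta>0) / 2 = - l / 2 - 1 + g / 2" "(?\<eta>0 - (l + 3/2)) / 2 = - l / 2 - 1 - g / 2 + 1 / 2"
    unfolding g by (simp_all add: field_simps)
  have Jx: "(1 - x) powr (- l / 2 - 1 + g / 2) * (1 + x) powr (- l / 2 - 1 - g / 2 + 1 / 2) = J x" for x
    by (simp add: J_def)
  have id: "(q1 * x + q0) * ?\<zeta> x = (l + 3/2) * (1 - x\<^sup>2)
      + ((l + 3/2) * x + ?\<eta>0) * (((l + 3/2) * x + ?\<eta>0) - (p1 * x + p0)) + 2 * a * (1 - x\<^sup>2)" for x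
    unfolding par by (simp add: field_simps power2_eq_square)
  have cont: "continuous_on {-1<..<1} ?\<zeta>" by (intro continuous_intros) simp
  have q: "q1 \<noteq> 0 \<or> q0 \<noteq> 0" by (simp add: par(2))
  obtain c where c: "c \<noteq> 0"
    "\<And>x. x \<in> {-1<..<1} \<Longrightarrow> j x = 4 * a * c * J x"
    "\<And>x. x \<in> {-1<..<1} \<Longrightarrow> V x = c * J x * ((l + 3/2) * x + ?\<eta>0)"
    "\<And>x. x \<in> {-1<..<1} \<Longrightarrow> Z x = c * J x * ?\<zeta> x"
    by (rule solution_diagonal[OF a _ nz q cont id, unfolded ex Jx, OF V]) (assumption, blast)
  have m: "m \<noteq> 0"
  proof
    assume m: "m = 0"
    have "4 * a * (r1 * x0 + r0) * U x0 = ((l + 3/2) * (1 - x0\<^sup>2)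
      + ((l + 3/2) * x0 + ?\<eta>0) * (((l + 3/2) * x0 + ?\<eta>0) - (t1 * x0 + t0)) - 2 * a * (1 - x0\<^sup>2)) * j x0"
      by (rule diagonal_of_first_order(2)[OF a V nz(1)])
    then have "((l + 3/2) * (1 - x0\<^sup>2)
      + ((l + 3/2) * x0 + ?\<eta>0) * (((l + 3/2) * x0 + ?\<eta>0) - (t1 * x0 + t0)) - 2 * a * (1 - x0\<^sup>2)) = 0"
      using nz(2) by (simp add: par(3,7) m)
    moreover have "((l + 3/2) * (1 - x0\<^sup>2)
      + ((l + 3/2) * x0 + ?\<eta>0) * (((l + 3/2) * x0 + ?\<eta>0) - (t1 * x0 + t0)) - 2 * a * (1 - x0\<^sup>2)) = 2 * a * (1 - x0)\<^sup>2"
      unfolding par m by (simp add: field_simps power2_eq_square)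
    ultimately show False using a nz(1) by simp
  qed
  have id2: "(q1 * x + q0) * (r1 * x + r0) * (?\<delta> x + ((l + 3/2) * x + ?\<eta>0)\<^sup>2)
      = ((l + 3/2) * (1 - x\<^sup>2) + ((l + 3/2) * x + ?\<eta>0) * (((l + 3/2) * x + ?\<eta>0) - (p1 * x + p0)) + 2 * a * (1 - x\<^sup>2))
        * ((l + 3/2) * (1 - x\<^sup>2) + ((l + 3/2) * x + ?\<eta>0) * (((l + 3/2) * x + ?\<eta>0) - (t1 * x + t0)) - 2 * a * (1 - x\<^sup>2))" for x
    unfolding par using m by (simp add: field_simps power2_eq_square)
  have cont2: "continuous_on {-1<..<1} ?\<delta>" by (intro continuous_intros)
  have r: "r1 \<noteq> 0 \<or> r0 \<noteq> 0" using m by (simp add: par(7))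
  have det: "16 * a\<^sup>2 * (U x * Z x - (V x)\<^sup>2) = ?\<delta> x * (j x)\<^sup>2" if "x \<in> {-1<..<1}" for x
    by (rule solution_determinant[OF a V q r cont2 id2 that])
  show thesis
  proof (rule that[OF c(1) m])
    fix x :: real assume x: "x \<in> {-1<..<1}"
    show "V x = c * J x * ((l + 3/2) * (x + 1) - 4 * a + 2 * a * m)" using c(3)[OF x] by (simp add: algebra_simps)
    show "Z x = c * J x * ?\<zeta> x" by (rule c(4)[OF x])
    have "16 * a\<^sup>2 * (U x * Z x - (V x)\<^sup>2) = 16 * a\<^sup>2 * (c\<^sup>2 * (J x)\<^sup>2 * ?\<delta> x)"
      unfolding det[OF x] c(2)[OF x] by (simp add: power_mult_distrib)
    then show "U x * Z x - (V x)\<^sup>2 = c\<^sup>2 * (J x)\<^sup>2 * ?\<delta> x"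
      by (rule mult_left_cancel[THEN iffD1, rotated]) (use a in simp)
  qed
qed

end

section \<open>The third family: parameters and defects\<close>

text \<open>
  This turns a vanishing moment into the vanishing of an undetermined constant.
\<close>
lemma has_integral_zero_positive_multiple:
  fixes f h :: "real \<Rightarrow> real"
  assumes f: "(f has_integral 0) {-1..1}" and eq: "\<And>x. x \<in> {-1<..<1} \<Longrightarrow> f x = \<kappa> * h x"
    and pos: "\<And>x. x \<in> {-1<..<1} \<Longrightarrow> 0 < h x" and cont: "continuous_on {-1<..<1} h"
  shows "\<kappa> = 0"
proof (rule ccontr)
  assume k: "\<kappa> \<noteq> 0"
  define g where "g x = (if x \<in> {-1<..<1} then h x else 0)" for x
  have f0: "((\<lambda>x. f x / \<kappa>) has_integral 0) {-1..1}" using has_integral_divide[OF f, of \<kappa>] by simp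
  have g0: "(g has_integral 0) {-1..1}"
    by (rule has_integral_spike_finite[OF _ _ f0, of "{-1, 1}"]) (use eq k in \<open>simp_all add: g_def\<close>)
  have gh: "g x = h x" if "x \<in> {-1/2..1/2}" for x using that by (simp add: g_def)
  have cg: "continuous_on {-1/2..1/2} g"
  proof -
    have "continuous_on {-1/2..1/2} h" by (rule continuous_on_subset[OF cont]) auto
    then show ?thesis by (rule continuous_on_eq) (simp add: gh)
  qed
  have nn: "0 \<le> g x" for x using pos by (simp add: g_def less_imp_le)
  have "integral {-1/2..1/2} g \<le> integral {-1..1} g"
    using g0 nn cg by (intro integral_subset_le) (auto intro: integrable_continuous_real)
  moreover have "0 \<le> integral {-1/2..1/2} g"
    using nn by (intro Henstock_Kurzweil_Integration.integral_nonneg integrable_continuous_real cg) auto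
  ultimately have "integral {-1/2..1/2} g = 0" using g0 by (simp add: integral_unique)
  then have "g 0 = 0" using integral_eq_0_iff[OF cg] nn by auto
  then show False using pos[of 0] by (simp add: g_def)
qed

text \<open>
  The third family in the parameters \<open>b1 = b - 1\<close>, \<open>\<lambda>\<close>, \<open>r\<close> and \<open>k = \<lambda> * B21\<close>. The
  polynomials below are, up to a common factor, the entries of the matrix that solves the
  system; they satisfy the linear relations of the system identically.
\<close>
locale family_III_parameters =
  fixes b1 l r k a d e q0 r0 g :: real and N s2 :: real and \<eta> \<zeta> \<upsilon> :: "real \<Rightarrow> real"
  assumes k: "k \<noteq> 0" and r: "r \<noteq> 0" and N_def: "N = k\<^sup>2 + b1 * (1 - r\<^sup>2)" and N: "N \<noteq> 0"
    and s2_def: "s2 = (k\<^sup>2 + b1 * (r - 1)\<^sup>2) * (k\<^sup>2 + b1 * (r + 1)\<^sup>2)"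
    and a: "2 * a * (k * r * N) = (l + 1) * s2" and a_nz: "a \<noteq> 0"
    and d: "d = - N / (k * r)" and e: "e = (k\<^sup>2 - k * r - b1 * (1 - r\<^sup>2)) / k"
    and q0: "q0 = - (k\<^sup>2 * (1 + r\<^sup>2) + b1 * (1 - r\<^sup>2)\<^sup>2 + k * r * (1 - r\<^sup>2)) / (k\<^sup>2 * r)"
    and r0: "r0 = (k\<^sup>2 + b1 * (1 + r\<^sup>2) - k * r) / r"
    and g: "g = (l + 1) * r * (k\<^sup>2 - b1 * (1 - r\<^sup>2)) / N"
    and \<eta>_def: "\<eta> = (\<lambda>x. k\<^sup>2 * (x - r) + b1 * (x + r) * (1 - r\<^sup>2))"
    and \<zeta>_def: "\<zeta> = (\<lambda>x. k * (k\<^sup>2 + b1 * (r\<^sup>2 + 2 * x * r + 1)))"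
    and \<upsilon>_def: "\<upsilon> = (\<lambda>x. k * (1 + r\<^sup>2 - 2 * r * x) + b1 * (1 - r\<^sup>2)\<^sup>2 / k)"
begin

lemma l1: "l + 1 \<noteq> 0" and s2: "s2 \<noteq> 0"
  using a a_nz k r N by auto

lemma eta: "(l + 1) * x - g = (l + 1) / N * \<eta> x"
  unfolding g \<eta>_def using N by (simp add: field_simps) (simp add: N_def algebra_simps)

lemma a_eq: "2 * a = (l + 1) / N * (s2 / (k * r))"
  using a k r N by (simp add: field_simps)

lemma rel_det: "\<zeta> x * \<upsilon> x - (\<eta> x)\<^sup>2 = s2 * (1 - x\<^sup>2)"
  unfolding \<zeta>_def \<upsilon>_def \<eta>_def s2_def using k by (simp add: field_simps power2_eq_square)

lemma rel1: "- (2 * x + q0) * \<zeta> x + (2 * b1 * x + r0) * \<upsilon> x + 2 * (d * x + e) * \<eta> x = 2 * (s2 / (k * r)) * (1 - x\<^sup>2)"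
  unfolding \<zeta>_def \<upsilon>_def \<eta>_def s2_def q0 r0 d e N_def using k r by (simp add: field_simps power2_eq_square)

lemma rel2: "- \<zeta> x + b1 * \<upsilon> x = - (s2 / (k * r)) * x - d * \<eta> x"
  unfolding \<zeta>_def \<upsilon>_def \<eta>_def s2_def d N_def using k r by (simp add: field_simps power2_eq_square)

lemma rel3: "(2 * b1 * x + r0) * \<eta> x + (x + d * x + e) * \<zeta> x + 2 * b1 * k * r * (1 - x\<^sup>2) = 0"
  unfolding \<zeta>_def \<eta>_def r0 d e N_def using k r by (simp add: field_simps power2_eq_square)

lemma rel4: "(2 * x + q0) * \<eta> x + (x - d * x - e) * \<upsilon> x - 2 * k * r * (1 - x\<^sup>2) = 0"
  unfolding \<upsilon>_def \<eta>_def q0 d e N_def using k r by (simp add: field_simps power2_eq_square)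

lemma rel5: "N * (1 - x\<^sup>2) = - x * \<eta> x - ((2 * x + q0) * \<zeta> x + (2 * b1 * x + r0) * \<upsilon> x) / 2"
  unfolding \<zeta>_def \<upsilon>_def \<eta>_def q0 r0 N_def using k r by (simp add: field_simps power2_eq_square)

end

text \<open>
Cramer's rule for the last unknown of a homogeneous system.
\<close>
lemma elimination:
  fixes x y z :: real
  assumes "a1 * x + b1 * y + c1 * z = 0" "a2 * x + b2 * y + c2 * z = 0" "a3 * x + b3 * y + c3 * z = 0"
  shows "(a1 * (b2 * c3 - b3 * c2) - b1 * (a2 * c3 - a3 * c2) + c1 * (a2 * b3 - a3 * b2)) * z = 0"
  using assms by algebra

text \<open>
  The two moment conditions come from the coordinates $B(0)$. For \<open>b1 = 0\<close> the differential
  equations alone have further solutions.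
\<close>
locale family_III_pair = jacobi_pair u v z a "l + d" "- g + e" 2 q0 "2 * b1" r0 "l - d" "- g - e" U V Z j
    + family_III_parameters b1 l r k a d e q0 r0 g N s2 \<eta> \<zeta> \<upsilon>
  for u v z :: "real \<Rightarrow> real" and a l d g e q0 b1 r0 U V Z j r k N s2 \<eta> \<zeta> \<upsilon> +
  assumes moment_zz: "b1 = 0 \<Longrightarrow> ((\<lambda>x. (x - r) * z x) has_integral 0) {-1..1}"
    and moment_uz: "((\<lambda>x. k\<^sup>2 * u x - (1 - r\<^sup>2) * z x) has_integral 0) {-1..1}"
begin

text \<open>
  The defects \<open>T\<close>, \<open>Zd\<close> and \<open>Ud\<close> compare \<open>V\<close>, \<open>Z\<close> and \<open>U\<close> with the candidates
  $\eta$, $-\zeta$ and $-\upsilon$ times a common multiple of \<open>j\<close>. Because the candidates satisfy the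
  relations of the system identically, the defects satisfy a homogeneous linear system.
\<close>
definition T where "T x = ((l + 1) * x + (- g)) * j x - 4 * a * V x"
definition T' where "T' x = (l + 1) * j x + ((l + 1) * x + (- g)) * (4 * a * v x)
      - 2 * a * (((l + d) * x + (- g + e)) * v x + (2 * x + q0) * z x + (2 * b1 * x + r0) * u x + ((l - d) * x + (- g - e)) * v x)"
definition Zd where "Zd x = 4 * a * Z x + (l + 1) / N * \<zeta> x * j x"
definition Ud where "Ud x = 4 * a * U x + (l + 1) / N * \<upsilon> x * j x"

lemma dT: "x \<in> {-1<..<1} \<Longrightarrow> (T has_real_derivative T' x) (at x)"
  unfolding T_def[abs_def] T'_def by (rule defect_derivative)

lemma continuous_T: "continuous_on {-1<..<1} T"
  unfolding T_def[abs_def] by (intro continuous_intros continuous_G)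

lemma continuous_parameters [continuous_intros]:
  "continuous_on S \<eta>" "continuous_on S \<zeta>" "continuous_on S \<upsilon>"
  unfolding \<eta>_def \<zeta>_def \<upsilon>_def by (intro continuous_intros; simp)+

lemma V_T: "4 * a * V x = (l + 1) / N * \<eta> x * j x - T x"
  using eta[of x] by (simp add: T_def)

lemma j_G: "(1 - x\<^sup>2) * j x = (2 * x + q0) * Z x - (2 * b1 * x + r0) * U x + 2 * (d * x + e) * V x"
  by (simp add: j_def U_def V_def Z_def algebra_simps)

lemma T_eq: "T x = (l + 1) / N * \<eta> x * j x - 4 * a * V x"
  using V_T[of x] by simp

lemma defect1: "- (2 * b1 * x + r0) * Ud x + (2 * x + q0) * Zd x + (- 2 * (d * x + e)) * T x = 0"
proof -
  define \<sigma> S where "\<sigma> = (l + 1) / N" and "S = s2 / (k * r)"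
  have "- (2 * b1 * x + r0) * Ud x + (2 * x + q0) * Zd x + (- 2 * (d * x + e)) * T x
    = 4 * a * ((2 * x + q0) * Z x - (2 * b1 * x + r0) * U x + 2 * (d * x + e) * V x)
      - \<sigma> * j x * (- (2 * x + q0) * \<zeta> x + (2 * b1 * x + r0) * \<upsilon> x + 2 * (d * x + e) * \<eta> x)"
    unfolding Ud_def Zd_def T_eq \<sigma>_def[symmetric] by (simp add: algebra_simps)
  also have "\<dots> = 2 * (2 * a) * ((1 - x\<^sup>2) * j x) - \<sigma> * j x * (2 * S * (1 - x\<^sup>2))"
    unfolding rel1[folded S_def] j_G by simp
  also have "\<dots> = 0" unfolding a_eq[folded \<sigma>_def S_def] by simp
  finally show ?thesis .
qed

lemma defect2:
  assumes "x \<in> {-1<..<1}"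
  shows "- b1 * Ud x + 1 * Zd x + (2 * a - d) * T x = 0"
proof -
  define \<sigma> S where "\<sigma> = (l + 1) / N" and "S = s2 / (k * r)"
  have "4 * a * V x = ((l + 1) * x - g + x) * j x + 2 * Z x - 2 * b1 * U x + 2 * d * V x"
    using second_relation[OF assms] by (simp add: field_simps)
  then have rel: "2 * Z x - 2 * b1 * U x = 4 * a * V x - (\<sigma> * \<eta> x + x) * j x - 2 * d * V x"
    unfolding eta \<sigma>_def by linarith
  have "2 * (- b1 * Ud x + 1 * Zd x + (2 * a - d) * T x)
    = 4 * a * (2 * Z x - 2 * b1 * U x) - 2 * \<sigma> * j x * (- \<zeta> x + b1 * \<upsilon> x) + (4 * a - 2 * d) * (\<sigma> * \<eta> x * j x - 4 * a * V x)"
    unfolding Ud_def Zd_def T_eq \<sigma>_def[symmetric] by (simp add: algebra_simps)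
  also have "\<dots> = 2 * x * j x * (\<sigma> * S - 2 * a)"
    unfolding rel rel2[folded S_def] by (simp add: algebra_simps)
  also have "\<dots> = 0" unfolding a_eq[folded \<sigma>_def S_def] by simp
  finally show ?thesis by simp
qed

lemma defect_T: "(1 - x\<^sup>2) * T' x = - x * T x - ((2 * x + q0) * Zd x + (2 * b1 * x + r0) * Ud x) / 2"
proof -
  define \<sigma> where "\<sigma> = (l + 1) / N"
  have \<sigma>N: "l + 1 = \<sigma> * N" using N by (simp add: \<sigma>_def)
  have "(1 - x\<^sup>2) * T' x = (l + 1) * (1 - x\<^sup>2) * j x + ((l + 1) * x - g) * (4 * a * V x)
     - 2 * a * ((2 * ((l + 1) * x - g) - 2 * x) * V x + (2 * x + q0) * Z x + (2 * b1 * x + r0) * U x)"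
    unfolding T'_def V_def Z_def U_def by (simp add: algebra_simps)
  also have "\<dots> = \<sigma> * j x * (N * (1 - x\<^sup>2)) + 4 * a * x * V x - 2 * a * ((2 * x + q0) * Z x + (2 * b1 * x + r0) * U x)"
    unfolding eta \<sigma>_def[symmetric] \<sigma>N by (simp add: algebra_simps)
  also have "\<dots> = - x * T x - ((2 * x + q0) * Zd x + (2 * b1 * x + r0) * Ud x) / 2"
    unfolding rel5 Ud_def Zd_def T_eq \<sigma>_def[symmetric] by (simp add: field_simps)
  finally show ?thesis .
qed

lemma defect_Z:
  assumes x: "x \<in> {-1<..<1}"
  obtains Zd' where "(Zd has_real_derivative Zd') (at x)"
    and "(1 - x\<^sup>2) * Zd' = ((l - d) * x + (- g - e)) * Zd x - ((l + 1) / N * \<zeta> x + 2 * b1 * x + r0) * T x"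
proof -
  define \<sigma> where "\<sigma> = (l + 1) / N"
  let ?D = "4 * a * ((2 * b1 * x + r0) * v x + ((l - d) * x + (- g - e)) * z x)
      + \<sigma> * (2 * b1 * k * r * j x + \<zeta> x * (4 * a * v x))"
  have d\<zeta>: "(\<zeta> has_real_derivative 2 * b1 * k * r) (at x)"
    unfolding \<zeta>_def by (auto intro!: derivative_eq_intros)
  have "(Zd has_real_derivative ?D) (at x)"
    unfolding Zd_def[abs_def] \<sigma>_def[symmetric]
    by (auto intro!: derivative_eq_intros dZ[OF x] dj[OF x] d\<zeta> simp: algebra_simps)
  moreover have "(1 - x\<^sup>2) * ?D = ((l - d) * x + (- g - e)) * Zd x - (\<sigma> * \<zeta> x + 2 * b1 * x + r0) * T x"
  proof -
    have t: "(l - d) * x + (- g - e) = \<sigma> * \<eta> x - x - d * x - e" using eta[of x] by (simp add: \<sigma>_def algebra_simps)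
    have "(1 - x\<^sup>2) * ?D = (2 * b1 * x + r0) * (4 * a * V x) + (\<sigma> * \<eta> x - x - d * x - e) * (4 * a * Z x)
       + \<sigma> * (2 * b1 * k * r * (1 - x\<^sup>2) * j x + \<zeta> x * (4 * a * V x))"
      unfolding V_def Z_def t by (simp add: algebra_simps)
    also have "\<dots> = (\<sigma> * \<eta> x - x - d * x - e) * Zd x - (\<sigma> * \<zeta> x + 2 * b1 * x + r0) * T x
       + \<sigma> * j x * ((2 * b1 * x + r0) * \<eta> x + (x + d * x + e) * \<zeta> x + 2 * b1 * k * r * (1 - x\<^sup>2))"
      unfolding Zd_def T_eq \<sigma>_def[symmetric] by (simp add: algebra_simps)
    finally show ?thesis unfolding rel3 t by simp
  qed
  ultimately show thesis using that unfolding \<sigma>_def by blast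
qed

lemma defect_U:
  assumes x: "x \<in> {-1<..<1}"
  obtains Ud' where "(Ud has_real_derivative Ud') (at x)"
    and "(1 - x\<^sup>2) * Ud' = ((l + d) * x + (- g + e)) * Ud x - ((l + 1) / N * \<upsilon> x + 2 * x + q0) * T x"
proof -
  define \<sigma> where "\<sigma> = (l + 1) / N"
  let ?D = "4 * a * (((l + d) * x + (- g + e)) * u x + (2 * x + q0) * v x)
      + \<sigma> * (- 2 * k * r * j x + \<upsilon> x * (4 * a * v x))"
  have d\<upsilon>: "(\<upsilon> has_real_derivative - 2 * k * r) (at x)"
    unfolding \<upsilon>_def by (auto intro!: derivative_eq_intros)
  have "(Ud has_real_derivative ?D) (at x)"
    unfolding Ud_def[abs_def] \<sigma>_def[symmetric]
    by (auto intro!: derivative_eq_intros dU[OF x] dj[OF x] d\<upsilon> simp: algebra_simps)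
  moreover have "(1 - x\<^sup>2) * ?D = ((l + d) * x + (- g + e)) * Ud x - (\<sigma> * \<upsilon> x + 2 * x + q0) * T x"
  proof -
    have t: "(l + d) * x + (- g + e) = \<sigma> * \<eta> x - x + d * x + e" using eta[of x] by (simp add: \<sigma>_def algebra_simps)
    have "(1 - x\<^sup>2) * ?D = (2 * x + q0) * (4 * a * V x) + (\<sigma> * \<eta> x - x + d * x + e) * (4 * a * U x)
       + \<sigma> * (- 2 * k * r * (1 - x\<^sup>2) * j x + \<upsilon> x * (4 * a * V x))"
      unfolding V_def U_def t by (simp add: algebra_simps)
    also have "\<dots> = (\<sigma> * \<eta> x - x + d * x + e) * Ud x - (\<sigma> * \<upsilon> x + 2 * x + q0) * T x
       + \<sigma> * j x * ((2 * x + q0) * \<eta> x + (x - d * x - e) * \<upsilon> x - 2 * k * r * (1 - x\<^sup>2))"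
      unfolding Ud_def T_eq \<sigma>_def[symmetric] by (simp add: algebra_simps)
    finally show ?thesis unfolding rel4 t by simp
  qed
  ultimately show thesis using that unfolding \<sigma>_def by blast
qed

end

section \<open>The third family: vanishing of the defects\<close>

lemma powr_one_plus_double:
  fixes x e :: real
  assumes "0 < x"
  shows "x powr (1 + 2 * e) = x * (x powr e)\<^sup>2"
proof -
  have "1 + 2 * e = 1 + e + e" by simp
  then have "x powr (1 + 2 * e) = x * x powr e * x powr e"
    using assms by (simp only: powr_add powr_one less_imp_le)
  then show ?thesis by (simp only: power2_eq_square mult.assoc)
qed

context family_III_pair
begin

text \<open>
  Two relations between the three defects hold at every point, and differentiating the second gives
  a third one. The determinant of the three is a quadratic polynomial with leading coefficient
  $-32a^2b_1$.
\<close>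
lemma T_zero_coupled:
  assumes b1: "b1 \<noteq> 0" and x: "x \<in> {-1<..<1}"
  shows "T x = 0"
proof -
  define A1 B1 C1 where "A1 x = - (2 * b1 * x + r0)" and "B1 x = 2 * x + q0" and "C1 x = - 2 * (d * x + e)" for x
  define A3 B3 C3 where "A3 x = - 2 * b1 * ((l + d) * x + (- g + e)) + (d - 2 * a) * (2 * b1 * x + r0)"
    and "B3 x = 2 * ((l - d) * x + (- g - e)) + (d - 2 * a) * (2 * x + q0)"
    and "C3 x = 2 * (b1 * q0 - r0) - 4 * a * x - 2 * d * ((l + 1) * x - g) + (2 * d - 4 * a) * x" for x
  define \<Delta> where "\<Delta> x = A1 x * (1 * C3 x - B3 x * (2 * a - d)) - B1 x * (- b1 * C3 x - A3 x * (2 * a - d))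
     + C1 x * (- b1 * B3 x - A3 x * 1)" for x
  define c0 c1 where "c0 = \<Delta> 0" and "c1 = (\<Delta> 1 - \<Delta> (- 1)) / 2"
  have poly: "\<Delta> x = poly [:c0, c1, - 32 * a\<^sup>2 * b1:] x" for x
    unfolding c0_def c1_def \<Delta>_def A1_def B1_def C1_def A3_def B3_def C3_def
    by (simp add: field_simps power2_eq_square)
  have nz: "[:c0, c1, - 32 * a\<^sup>2 * b1:] \<noteq> 0" using a_nz b1 by simp
  show ?thesis
  proof (rule poly_mult_zero_imp_zero[OF continuous_T nz _ x])
    fix x :: real assume x: "x \<in> {-1<..<1}"
    obtain Zd' where Z': "(Zd has_real_derivative Zd') (at x)"
      "(1 - x\<^sup>2) * Zd' = ((l - d) * x + (- g - e)) * Zd x - ((l + 1) / N * \<zeta> x + 2 * b1 * x + r0) * T x"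
      using defect_Z[OF x] by blast
    obtain Ud' where U': "(Ud has_real_derivative Ud') (at x)"
      "(1 - x\<^sup>2) * Ud' = ((l + d) * x + (- g + e)) * Ud x - ((l + 1) / N * \<upsilon> x + 2 * x + q0) * T x"
      using defect_U[OF x] by blast
    have "((\<lambda>x. - b1 * Ud x + 1 * Zd x + (2 * a - d) * T x) has_real_derivative (- b1 * Ud' + Zd' + (2 * a - d) * T' x)) (at x)"
      by (auto intro!: derivative_eq_intros U'(1) Z'(1) dT[OF x])
    moreover have "((\<lambda>x. - b1 * Ud x + 1 * Zd x + (2 * a - d) * T x) has_real_derivative 0) (at x)"
      by (rule has_field_derivative_transform_within_open[of "\<lambda>_. 0" _ _ "{-1<..<1}"]) (use x defect2 in auto)
    ultimately have "- b1 * Ud' + Zd' + (2 * a - d) * T' x = 0" by (rule DERIV_unique)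
    then have "- b1 * ((1 - x\<^sup>2) * Ud') + (1 - x\<^sup>2) * Zd' + (2 * a - d) * ((1 - x\<^sup>2) * T' x) = 0"
      by algebra
    then have E: "- b1 * (((l + d) * x + (- g + e)) * Ud x - ((l + 1) / N * \<upsilon> x + 2 * x + q0) * T x)
      + (((l - d) * x + (- g - e)) * Zd x - ((l + 1) / N * \<zeta> x + 2 * b1 * x + r0) * T x)
      + (2 * a - d) * (- x * T x - ((2 * x + q0) * Zd x + (2 * b1 * x + r0) * Ud x) / 2) = 0"
      unfolding U'(2) Z'(2) defect_T .
    have R: "2 * ((l + 1) / N * (- \<zeta> x + b1 * \<upsilon> x)) = - 4 * a * x - 2 * d * ((l + 1) * x - g)"
    proof -
      define \<sigma> S where "\<sigma> = (l + 1) / N" and "S = s2 / (k * r)"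
      have "2 * (\<sigma> * (- \<zeta> x + b1 * \<upsilon> x)) = - 2 * (\<sigma> * S) * x - 2 * d * (\<sigma> * \<eta> x)"
        unfolding rel2[folded S_def] by (simp add: algebra_simps)
      then show ?thesis unfolding \<sigma>_def S_def a_eq[symmetric] eta[symmetric] by simp
    qed
    have "A3 x * Ud x + B3 x * Zd x + C3 x * T x
      = 2 * (- b1 * (((l + d) * x + (- g + e)) * Ud x - ((l + 1) / N * \<upsilon> x + 2 * x + q0) * T x)
      + (((l - d) * x + (- g - e)) * Zd x - ((l + 1) / N * \<zeta> x + 2 * b1 * x + r0) * T x)
      + (2 * a - d) * (- x * T x - ((2 * x + q0) * Zd x + (2 * b1 * x + r0) * Ud x) / 2))
      - (2 * ((l + 1) / N * (- \<zeta> x + b1 * \<upsilon> x)) - (- 4 * a * x - 2 * d * ((l + 1) * x - g))) * T x"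
      unfolding A3_def B3_def C3_def by (simp add: algebra_simps add_divide_distrib diff_divide_distrib)
    then have "A3 x * Ud x + B3 x * Zd x + C3 x * T x = 0" unfolding E R by simp
    from elimination[OF defect1[of x, folded A1_def B1_def C1_def] defect2[OF x] this]
    show "poly [:c0, c1, - 32 * a\<^sup>2 * b1:] x * T x = 0" unfolding poly[symmetric] \<Delta>_def .
  qed
qed

lemma T_vanishing_at_end:
  assumes ode: "\<And>x. x \<in> {-1<..<1} \<Longrightarrow> (1 - x\<^sup>2) * T' x = (\<alpha> * x + \<beta>) * T x"
    and e: "\<beta> = \<alpha> \<or> \<beta> = - \<alpha>" and x: "x \<in> {-1<..<1}"
  shows "T x = 0"
proof -
  obtain C where C: "\<And>x. x \<in> {-1<..<1} \<Longrightarrow> T x = C * ((1 - x) powr (- (\<alpha> + \<beta>) / 2) * (1 + x) powr ((\<beta> - \<alpha>) / 2))"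
    using jacobi_first_order[OF dT ode] by blast
  note lim = defect_limits[of "l + 1" "- g", folded T_def]
  have "C = 0"
  proof (rule ccontr)
    assume C0: "C \<noteq> 0"
    have "0 < - (\<alpha> + \<beta>) / 2"
      by (rule jacobi_factor_exponent_right[OF tendsto_cong_right_end[OF lim(1) C] C0])
    moreover have "0 < (\<beta> - \<alpha>) / 2"
      by (rule jacobi_factor_exponent_left[OF tendsto_cong_left_end[OF lim(2) C] C0])
    ultimately show False using e by auto
  qed
  then show ?thesis using C[OF x] by simp
qed

text \<open>
  For \<open>b1 = 0\<close> the defect \<open>Zd\<close> is a multiple of \<open>T\<close>, so that the equations for \<open>V\<close> and \<open>Z\<close> are
  two first-order equations for \<open>T\<close>. They differ by a linear polynomial times \<open>T\<close>, which can be
  zero only for $\lambda = -2$ or $d = -1/2$.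
\<close>
lemma T_zero_uncoupled:
  assumes b1: "b1 = 0" and x: "x \<in> {-1<..<1}"
  shows "T x = 0"
proof -
  have Nk: "N = k\<^sup>2" by (simp add: N_def b1)
  have dkr: "d * r = - k" using k r by (simp add: d Nk power2_eq_square)
  have dnz: "d \<noteq> 0" using dkr k by auto
  have e': "e = k - r" using k by (simp add: e b1 field_simps power2_eq_square)
  have g': "g = (l + 1) * r" using k by (simp add: g b1 Nk)
  have a': "2 * a = - (l + 1) * d"
  proof -
    have "(2 * a * r) * k ^ 3 = ((l + 1) * k) * k ^ 3"
      using a by (simp add: Nk s2_def b1 power2_eq_square power3_eq_cube algebra_simps)
    then have "2 * a * r = (l + 1) * k" using k by simp
    then have "(2 * a) * r = (- (l + 1) * d) * r" using dkr by algebra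
    then show ?thesis using r by simp
  qed
  have \<zeta>': "(l + 1) / N * \<zeta> x = (l + 1) * k" for x
    using k by (simp add: \<zeta>_def Nk b1 power2_eq_square)
  have \<eta>': "(l + 1) * x - g = (l + 1) * (x - r)" for x by (simp add: g' algebra_simps)
  have Zd: "Zd x = (l + 2) * d * T x" if "x \<in> {-1<..<1}" for x
  proof -
    have "Zd x = (d - 2 * a) * T x" using defect2[OF that] by (simp add: b1 algebra_simps)
    then show ?thesis unfolding a' by (simp add: algebra_simps)
  qed
  have A: "(1 - x\<^sup>2) * T' x = ((d - 1 - 2 * (l + 2) * d) * x + (e - q0 * (l + 2) * d)) * T x"
    if x: "x \<in> {-1<..<1}" for x
  proof -
    have "(2 * b1 * x + r0) * Ud x = (2 * x + q0) * Zd x - 2 * (d * x + e) * T x"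
      using defect1[of x] by (simp add: algebra_simps)
    then show ?thesis unfolding defect_T Zd[OF x] by (simp add: field_simps)
  qed
  have B: "(l + 2) * d * ((1 - x\<^sup>2) * T' x) = ((l + 2) * d * ((l - d) * x + (- g - e)) - (l + 1) * k - r0) * T x"
    if x: "x \<in> {-1<..<1}" for x
  proof -
    obtain Zd' where Z': "(Zd has_real_derivative Zd') (at x)"
      "(1 - x\<^sup>2) * Zd' = ((l - d) * x + (- g - e)) * Zd x - ((l + 1) / N * \<zeta> x + 2 * b1 * x + r0) * T x"
      using defect_Z[OF x] by blast
    have "(Zd has_real_derivative (l + 2) * d * T' x) (at x)"
      by (rule has_field_derivative_transform_within_open[of "\<lambda>x. (l + 2) * d * T x" _ _ "{-1<..<1}"])
        (use x Zd in \<open>auto intro!: derivative_eq_intros dT\<close>)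
    then have "Zd' = (l + 2) * d * T' x" using Z'(1) DERIV_unique by blast
    then have "(l + 2) * d * ((1 - x\<^sup>2) * T' x) = (1 - x\<^sup>2) * Zd'" by simp
    also have "\<dots> = ((l + 2) * d * ((l - d) * x + (- g - e)) - (l + 1) * k - r0) * T x"
      unfolding Z'(2) Zd[OF x] \<zeta>' by (simp add: b1 algebra_simps)
    finally show ?thesis .
  qed
  let ?c0 = "(l + 2) * d * (2 * e - q0 * (l + 2) * d + g) + (l + 1) * k + r0"
  let ?c1 = "- ((l + 2) * d * ((2 * d + 1) * (l + 1)))"
  have P: "poly [:?c0, ?c1:] x * T x = 0" if x: "x \<in> {-1<..<1}" for x
  proof -
    have "poly [:?c0, ?c1:] x * T x = (l + 2) * d * (((d - 1 - 2 * (l + 2) * d) * x + (e - q0 * (l + 2) * d)) * T x)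
       - ((l + 2) * d * ((l - d) * x + (- g - e)) - (l + 1) * k - r0) * T x"
      by (simp add: algebra_simps)
    then show ?thesis unfolding A[OF x, symmetric] B[OF x, symmetric] by simp
  qed
  show ?thesis
  proof (cases "[:?c0, ?c1:] = 0")
    case False
    from poly_mult_zero_imp_zero[OF continuous_T False P x] show ?thesis .
  next
    case True
    then have c: "?c0 = 0" "l = - 2 \<or> d = - 1/2" using dnz l1 by auto
    show ?thesis
    proof (cases "l = - 2")
      case True
      \<comment> \<open>Here both exponents of \<open>T\<close> may be positive, and only the first moment of the weight excludes it.\<close>
      have "r0 = k" using c(1) True by simp
      then have kr: "k = 2 * r" using k r by (simp add: r0 b1 field_simps power2_eq_square)
      have "d * r = (- 2) * r" using dkr kr by simp
      then have d2: "d = - 2" by (simp only: mult_right_cancel[OF r])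
      have "(1 - x\<^sup>2) * T' x = ((- 3) * x + r) * T x" if "x \<in> {-1<..<1}" for x
        using A[OF that] by (simp add: True d2 e' kr)
      then obtain C where C: "\<And>x. x \<in> {-1<..<1} \<Longrightarrow> T x = C * ((1 - x) powr (- (- 3 + r) / 2) * (1 + x) powr ((r - (- 3)) / 2))"
        using jacobi_first_order[OF dT] by blast
      have "((\<lambda>x. (- (1 / (2 * r))) * (4 * a * ((x - r) * z x) + 2 * r * (4 * a * v x)))
          has_integral (- (1 / (2 * r))) * (4 * a * 0 + 2 * r * 0)) {-1..1}"
        by (intro has_integral_mult_right has_integral_add moment_zz b1
            has_integral_zero_of_vanishing_primitive[OF dj right_limits(4) left_limits(4)])
      then have i0: "((\<lambda>x. (- (1 / (2 * r))) * (4 * a * ((x - r) * z x) + 2 * r * (4 * a * v x))) has_integral 0) {-1..1}"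
        by simp
      have "C = 0"
      proof (rule has_integral_zero_positive_multiple[OF i0])
        fix x :: real assume x: "x \<in> {-1<..<1}"
        have "4 * a * Z x = Zd x - ((l + 1) / N * \<zeta> x) * j x" by (simp add: Zd_def)
        then have "4 * a * Z x = 2 * r * j x" unfolding Zd[OF x] \<zeta>' by (simp add: True kr)
        moreover have "4 * a * V x = - (x - r) * j x - T x"
        proof -
          have "(l + 1) * x + (- g) = - (x - r)" using \<eta>'[of x] True by simp
          then have "T x = - (x - r) * j x - 4 * a * V x" using T_def[of x] by (simp only:)
          then show ?thesis by simp
        qed
        ultimately have "(x - r) * (4 * a * Z x) + 2 * r * (4 * a * V x) = - 2 * r * T x" by algebra
        then have "(1 - x\<^sup>2) * (4 * a * ((x - r) * z x) + 2 * r * (4 * a * v x)) = - 2 * r * T x"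
          by (simp add: V_def Z_def algebra_simps)
        then have "(- (1 / (2 * r))) * (4 * a * ((x - r) * z x) + 2 * r * (4 * a * v x)) = T x / (1 - x\<^sup>2)"
          using r interval_pos[OF x] by (simp add: field_simps)
        then show "(- (1 / (2 * r))) * (4 * a * ((x - r) * z x) + 2 * r * (4 * a * v x))
           = C * (((1 - x) powr (- (- 3 + r) / 2) * (1 + x) powr ((r - (- 3)) / 2)) / (1 - x\<^sup>2))"
          using C[OF x] by simp
        show "0 < ((1 - x) powr (- (- 3 + r) / 2) * (1 + x) powr ((r - (- 3)) / 2)) / (1 - x\<^sup>2)"
          using x interval_pos[OF x] by simp
      next
        show "continuous_on {-1<..<1} (\<lambda>x. ((1 - x) powr (- (- 3 + r) / 2) * (1 + x) powr ((r - (- 3)) / 2)) / (1 - x\<^sup>2))"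
          by (intro continuous_intros) (auto dest: interval_pos)
      qed
      then show ?thesis using C[OF x] by simp
    next
      case False
      then have d2: "d = - 1/2" using c by simp
      have kr: "k = r / 2" using dkr d2 by simp
      have q0': "q0 * r = - (3 - r\<^sup>2)" and r0': "r0 = - r / 4"
        using r by (simp_all add: q0 r0 b1 kr field_simps power2_eq_square)
      have "8 * r * ?c0 = 0" using c by simp
      then have "(l + 2) * (- 4) * (r * (2 * e + g) + q0 * r * (l + 2) / 2) + 8 * r * ((l + 1) * k + r0) = 0"
        unfolding d2 by (simp add: field_simps)
      then have "3 * ((l + 2)\<^sup>2 - (r * (l + 1))\<^sup>2) = 0"
        unfolding q0' r0' e' g' kr by (simp add: field_simps power2_eq_square)
      then have "(l + 2)\<^sup>2 = (r * (l + 1))\<^sup>2" by simp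
      then have lr: "l + 2 = r * (l + 1) \<or> l + 2 = - (r * (l + 1))" by (simp only: power2_eq_iff)
      have q: "q0 = - (3 - r\<^sup>2) / r" using q0' r by (simp add: field_simps)
      have "2 * r * (e + q0 * (l + 2) / 2) = - r\<^sup>2 - (3 - r\<^sup>2) * (l + 2)"
        using r by (simp add: q e' kr field_simps power2_eq_square)
      then have r2: "2 * r * (e + q0 * (l + 2) / 2) = - r * (2 * l + 1) \<or> 2 * r * (e + q0 * (l + 2) / 2) = r * (2 * l + 1)"
        using lr by algebra
      have \<beta>: "e + q0 * (l + 2) / 2 = l + 1/2 \<or> e + q0 * (l + 2) / 2 = - (l + 1/2)"
      proof -
        define X where "X = e + q0 * (l + 2) / 2"
        have "r * (2 * X) = r * (- (2 * l + 1)) \<or> r * (2 * X) = r * (2 * l + 1)"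
          using r2 unfolding X_def[symmetric] by (auto simp: algebra_simps)
        then have "2 * X = - (2 * l + 1) \<or> 2 * X = 2 * l + 1" 
          using mult_left_cancel[OF r, of "2 * X" "- (2 * l + 1)"] mult_left_cancel[OF r, of "2 * X" "2 * l + 1"] by blast
        then show ?thesis unfolding X_def[symmetric] by auto
      qed
      have "(1 - x\<^sup>2) * T' x = ((l + 1/2) * x + (e + q0 * (l + 2) / 2)) * T x" if "x \<in> {-1<..<1}" for x
        using A[OF that] by (simp add: d2 field_simps)
      from T_vanishing_at_end[OF this \<beta> x] show ?thesis .
    qed
  qed
qed

lemma T_zero: "x \<in> {-1<..<1} \<Longrightarrow> T x = 0"
  using T_zero_coupled T_zero_uncoupled by blast

lemma solution:
  assumes nz: "x0 \<in> {-1<..<1}" "j x0 \<noteq> 0"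
  defines "J \<equiv> \<lambda>x. (1 - x) powr (- l / 2 - 1 + g / 2 + 1 / 2) * (1 + x) powr (- l / 2 - 1 - g / 2 + 1 / 2)"
  obtains c where "c \<noteq> 0"
    and "\<And>x. x \<in> {-1<..<1} \<Longrightarrow> V x = c * J x * \<eta> x"
    and "\<And>x. x \<in> {-1<..<1} \<Longrightarrow> Z x = - c * J x * \<zeta> x"
    and "\<And>x. x \<in> {-1<..<1} \<Longrightarrow> U x * Z x - (V x)\<^sup>2 = c\<^sup>2 * (J x)\<^sup>2 * (s2 * (1 - x\<^sup>2))"
proof -
  have V: "4 * a * V x = ((l + 1) * x + (- g)) * j x" if "x \<in> {-1<..<1}" for x
    using T_zero[OF that] by (simp add: T_def)
  have ex: "- ((l + 1) + (- g)) / 2 = - l / 2 - 1 + g / 2 + 1 / 2" "((- g) - (l + 1)) / 2 = - l / 2 - 1 - g / 2 + 1 / 2"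
    by (simp_all add: field_simps)
  have Jx: "(1 - x) powr (- l / 2 - 1 + g / 2 + 1 / 2) * (1 + x) powr (- l / 2 - 1 - g / 2 + 1 / 2) = J x" for x
    by (simp add: J_def)
  obtain C where C: "C \<noteq> 0" and jC: "\<And>x. x \<in> {-1<..<1} \<Longrightarrow> j x = C * J x"
    by (rule j_of_first_order[OF _ nz, of "l + 1" "- g", unfolded ex Jx, OF V]) (assumption, blast)
  have T'0: "T' x = 0" if x: "x \<in> {-1<..<1}" for x
  proof -
    have "(T has_real_derivative 0) (at x)"
      by (rule has_field_derivative_transform_within_open[of "\<lambda>_. 0" _ _ "{-1<..<1}"]) (use x T_zero in auto)
    then show ?thesis using dT[OF x] DERIV_unique by blast
  qed
  have qr0: "(2 * x + q0) * Zd x = 0" "(2 * b1 * x + r0) * Ud x = 0" if x: "x \<in> {-1<..<1}" for x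
    using defect1[of x] defect_T[of x] T'0[OF x] T_zero[OF x] by (simp_all add: algebra_simps)
  have cZ: "continuous_on {-1<..<1} Zd" and cU: "continuous_on {-1<..<1} Ud"
    unfolding Zd_def[abs_def] Ud_def[abs_def] by (intro continuous_intros continuous_G)+
  have Zd0: "Zd x = 0" if x: "x \<in> {-1<..<1}" for x
    by (rule poly_mult_zero_imp_zero[OF cZ _ _ x, of "[:q0, 2:]"]) (use qr0(1) in \<open>auto simp: mult_ac add_ac\<close>)
  define c where "c = C * ((l + 1) / N) / (4 * a)"
  have c: "c \<noteq> 0" "4 * a * c = C * ((l + 1) / N)" using C a_nz l1 N by (auto simp: c_def)
  have Vc: "V x = c * J x * \<eta> x" if x: "x \<in> {-1<..<1}" for x
  proof -
    have "4 * a * V x = (4 * a * c) * J x * \<eta> x"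
      unfolding c(2) using V_T[of x] T_zero[OF x] jC[OF x] by (simp add: mult_ac)
    then have "4 * a * V x = 4 * a * (c * J x * \<eta> x)" by (simp add: mult.assoc)
    then show ?thesis by (rule mult_left_cancel[THEN iffD1, rotated]) (use a_nz in simp)
  qed
  have Zc: "Z x = - c * J x * \<zeta> x" if x: "x \<in> {-1<..<1}" for x
  proof -
    have "4 * a * Z x = - ((4 * a * c) * J x * \<zeta> x)"
      using Zd_def[of x] Zd0[OF x] jC[OF x] unfolding c(2) by (simp add: mult_ac add_eq_0_iff)
    then have "4 * a * Z x = 4 * a * (- c * J x * \<zeta> x)" by (simp add: mult.assoc)
    then show ?thesis by (rule mult_left_cancel[THEN iffD1, rotated]) (use a_nz in simp)
  qed
  have Jpos: "0 < J x" if "x \<in> {-1<..<1}" for x using that by (simp add: J_def)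
  have det: "U x * Z x - (V x)\<^sup>2 = c\<^sup>2 * (J x)\<^sup>2 * (s2 * (1 - x\<^sup>2))" if x: "x \<in> {-1<..<1}" for x
  proof (cases "b1 = 0 \<and> r0 = 0")
    case False
    have "Ud x = 0"
      by (rule poly_mult_zero_imp_zero[OF cU _ _ x, of "[:r0, 2 * b1:]"]) (use qr0(2) False in \<open>auto simp: mult_ac add_ac\<close>)
    then have "4 * a * U x = - ((4 * a * c) * J x * \<upsilon> x)"
      using Ud_def[of x] jC[OF x] unfolding c(2) by (simp add: mult_ac add_eq_0_iff)
    then have "4 * a * U x = 4 * a * (- c * J x * \<upsilon> x)" by (simp add: mult.assoc)
    then have Uc: "U x = - c * J x * \<upsilon> x"
      by (rule mult_left_cancel[THEN iffD1, rotated]) (use a_nz in simp)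
    have "U x * Z x - (V x)\<^sup>2 = c\<^sup>2 * (J x)\<^sup>2 * (\<zeta> x * \<upsilon> x - (\<eta> x)\<^sup>2)"
      unfolding Uc Vc[OF x] Zc[OF x] by (simp add: power2_eq_square algebra_simps)
    then show ?thesis unfolding rel_det .
  next
    \<comment> \<open>
      Here the system is triangular and leaves the first diagonal entry undetermined up to a
      multiple of \<open>J\<close>; the multiple is pinned down by the ratio of the diagonal moments.
    \<close>
    case True
    then have b10: "b1 = 0" and "r0 = 0" by auto
    have "k\<^sup>2 + b1 * (1 + r\<^sup>2) - k * r = 0" using \<open>r0 = 0\<close> r unfolding r0 divide_eq_0_iff by blast
    then have "k * (k - r) = 0" unfolding b10 by (simp add: power2_eq_square right_diff_distrib)
    then have kr: "k = r" using k by simp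
    have par: "N = r\<^sup>2" "s2 = r ^ 4" "g = (l + 1) * r"
      "\<eta> = (\<lambda>x. r\<^sup>2 * (x - r))" "\<zeta> = (\<lambda>x. r ^ 3)" "\<upsilon> = (\<lambda>x. r * (1 + r\<^sup>2 - 2 * r * x))"
      using r by (simp_all add: N_def s2_def g \<eta>_def \<zeta>_def \<upsilon>_def kr b10 power2_eq_square power3_eq_cube power4_eq_xxxx fun_eq_iff mult_ac)
    obtain c1 where c1: "\<And>x. x \<in> {-1<..<1} \<Longrightarrow>
      U x * Z x - (V x)\<^sup>2 = c1 * ((1 - x) powr (- l + g) * (1 + x) powr (- l - g))"
      using det_G[of l g] by auto
    have J2: "(1 - x) powr (- l + g) * (1 + x) powr (- l - g) = (1 - x\<^sup>2) * (J x)\<^sup>2" if x: "x \<in> {-1<..<1}" for x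
    proof -
      have p: "0 < 1 - x" "0 < 1 + x" using x by auto
      have e: "- l + g = 1 + 2 * (- l / 2 - 1 + g / 2 + 1 / 2)" "- l - g = 1 + 2 * (- l / 2 - 1 - g / 2 + 1 / 2)"
        by (simp_all add: field_simps)
      show ?thesis unfolding e powr_one_plus_double[OF p(1)] powr_one_plus_double[OF p(2)] J_def by algebra
    qed
    define \<kappa> where "\<kappa> = c1 - c\<^sup>2 * s2"
    have U\<kappa>: "(U x + c * J x * \<upsilon> x) * (- c * r ^ 3) = \<kappa> * (1 - x\<^sup>2) * J x" if x: "x \<in> {-1<..<1}" for x
    proof -
      have "J x * ((U x + c * J x * \<upsilon> x) * (- c * r ^ 3)) = U x * Z x - c\<^sup>2 * (J x)\<^sup>2 * (\<zeta> x * \<upsilon> x)"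
        unfolding Zc[OF x] unfolding par(5) by (simp add: power2_eq_square algebra_simps)
      also have "\<dots> = (U x * Z x - (V x)\<^sup>2) - c\<^sup>2 * (J x)\<^sup>2 * (\<zeta> x * \<upsilon> x - (\<eta> x)\<^sup>2)"
        unfolding Vc[OF x] by (simp add: power2_eq_square algebra_simps)
      also have "\<dots> = J x * (\<kappa> * (1 - x\<^sup>2) * J x)"
        unfolding c1[OF x] J2[OF x] rel_det \<kappa>_def by (simp add: power2_eq_square algebra_simps)
      finally show ?thesis by (rule mult_left_cancel[THEN iffD1, rotated]) (use Jpos[OF x] in simp)
    qed
    have "((\<lambda>x. (- c * r) * ((k\<^sup>2 * u x - (1 - r\<^sup>2) * z x) + (- 2 * r\<^sup>2) * v x))
       has_integral (- c * r) * (0 + (- 2 * r\<^sup>2) * 0)) {-1..1}"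
    proof (intro has_integral_mult_right has_integral_add moment_uz)
      have "((\<lambda>x. 4 * a * v x) has_integral 0) {-1..1}"
        by (rule has_integral_zero_of_vanishing_primitive[OF dj right_limits(4) left_limits(4)])
      then show "(v has_integral 0) {-1..1}"
        using has_integral_mult_right[of "\<lambda>x. 4 * a * v x" 0 _ "1 / (4 * a)"] a_nz by simp
    qed
    then have i0: "((\<lambda>x. (- c * r) * ((k\<^sup>2 * u x - (1 - r\<^sup>2) * z x) + (- 2 * r\<^sup>2) * v x)) has_integral 0) {-1..1}" by simp
    have "\<kappa> = 0"
    proof (rule has_integral_zero_positive_multiple[OF i0])
      fix x :: real assume x: "x \<in> {-1<..<1}"
      have "(1 - x\<^sup>2) * ((- c * r) * ((k\<^sup>2 * u x - (1 - r\<^sup>2) * z x) + (- 2 * r\<^sup>2) * v x))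
        = (- c * r) * (r\<^sup>2 * U x - (1 - r\<^sup>2) * Z x - 2 * r\<^sup>2 * V x)"
        by (simp add: U_def V_def Z_def kr algebra_simps)
      also have "\<dots> = (U x + c * J x * \<upsilon> x) * (- c * r ^ 3)"
        unfolding Vc[OF x] Zc[OF x] unfolding par by (simp add: power2_eq_square power3_eq_cube algebra_simps)
      also have "\<dots> = (1 - x\<^sup>2) * (\<kappa> * J x)" unfolding U\<kappa>[OF x] by simp
      finally show "(- c * r) * ((k\<^sup>2 * u x - (1 - r\<^sup>2) * z x) + (- 2 * r\<^sup>2) * v x) = \<kappa> * J x"
        by (rule mult_left_cancel[THEN iffD1, rotated]) (use interval_pos[OF x] in simp)
      show "0 < J x" by (rule Jpos[OF x])
    next
      show "continuous_on {-1<..<1} J" unfolding J_def by (intro continuous_intros) auto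
    qed
    then show ?thesis using c1[OF x] J2[OF x] by (simp add: \<kappa>_def)
  qed
  show thesis using that[OF c(1) Vc Zc det] .
qed

end

section \<open>Degenerate coefficients\<close>

context jacobi_pair
begin

text \<open>
  If both the off-diagonal entry and the antisymmetric part vanish, then so does $(q_1x+q_0)z$,
  contrary to positivity.
\<close>
lemma off_diagonal_not_zero:
  assumes q: "q1 \<noteq> 0 \<or> q0 \<noteq> 0" and V0: "\<And>x. x \<in> {-1<..<1} \<Longrightarrow> V x = 0" and j0: "\<And>x. x \<in> {-1<..<1} \<Longrightarrow> j x = 0"
  shows False
proof -
  have "Z 0 = 0"
  proof (rule poly_mult_zero_imp_zero[OF continuous_G(3), of "[:q0, q1:]"])
    show "[:q0, q1:] \<noteq> 0" using q by auto
    fix x :: real assume x: "x \<in> {-1<..<1}"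
    have v0: "v x = 0" using V0[OF x] interval_pos[OF x] by (auto simp: V_def)
    have "(V has_real_derivative 0) (at x)"
      by (rule has_field_derivative_transform_within_open[of "\<lambda>_. 0" _ _ "{-1<..<1}"]) (use x V0 in auto)
    then have sum: "((p1 * x + p0) * v x + (q1 * x + q0) * z x + (r1 * x + r0) * u x + (t1 * x + t0) * v x) / 2 = 0"
      using dV[OF x] DERIV_unique by blast
    have diff: "(q1 * x + q0) * z x - (r1 * x + r0) * u x + ((p1 * x + p0) - (t1 * x + t0)) * v x = 0"
      using j0[OF x] by (simp add: j_def)
    define Q R where "Q = (q1 * x + q0) * z x" and "R = (r1 * x + r0) * u x"
    have "Q + R = 0" "Q - R = 0"
      using sum[folded Q_def R_def] diff[folded Q_def R_def] by (simp_all add: v0)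
    then have "(q1 * x + q0) * z x = 0" by (simp add: Q_def)
    moreover have "poly [:q0, q1:] x * Z x = (1 - x\<^sup>2) * ((q1 * x + q0) * z x)" by (simp add: Z_def algebra_simps)
    ultimately show "poly [:q0, q1:] x * Z x = 0" by simp
  qed simp
  then show False using G_pos(2)[of 0] by simp
qed

text \<open>
  Two linear relations between \<open>V\<close> and \<open>Z\<close>, from \<open>second_relation\<close> and its derivative, make a
  cubic polynomial with leading coefficient $16a^2$ annihilate \<open>Z\<close>.
\<close>
lemma triangular_impossible:
  assumes a: "a \<noteq> 0" and par: "p1 = l" "t1 = l" "q1 = 2" "r1 = 0" "p0 = - l * \<beta>1" "q0 = - 2 * \<beta>2" "r0 = 0" "t0 = - l * \<beta>2"
  shows False
proof -
  define g e where "g = l * (\<beta>1 + \<beta>2) / 2" and "e = l * (\<beta>2 - \<beta>1)"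
  define P where "P x = (2 * (1 - x\<^sup>2) + 2 * ((l + 2) * x - g) * (x - \<beta>2)) * (8 * a * x + (l + 2) * e)
      + (x - \<beta>2) * (4 * l + 4 - 4 * a) * (4 * a * (1 - x\<^sup>2) - ((l + 2) * x - g) * e)" for x
  define c0 c1 c2 where "c0 = P 0" and "c1 = (P 1 - P (- 1)) / 2 - 16 * a\<^sup>2" and "c2 = (P 1 + P (- 1)) / 2 - P 0"
  have P: "P x = poly [:c0, c1, c2, 16 * a\<^sup>2:] x" for x
    unfolding c0_def c1_def c2_def P_def by (simp add: field_simps power2_eq_square)
  have sec: "4 * a * V x = ((l + 2) * x - g) * j x + 2 * Z x" if "x \<in> {-1<..<1}" for x
    using second_relation[OF that] unfolding par by (simp add: g_def field_simps)
  have jG: "(1 - x\<^sup>2) * j x = 2 * (x - \<beta>2) * Z x + e * V x" for x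
    unfolding j_def V_def Z_def par e_def by (simp add: algebra_simps)
  have "Z 0 = 0"
  proof (rule poly_mult_zero_imp_zero[OF continuous_G(3), of "[:c0, c1, c2, 16 * a\<^sup>2:]"])
    fix x :: real assume x: "x \<in> {-1<..<1}"
    have d1: "((\<lambda>x. 4 * a * V x - ((l + 2) * x - g) * j x) has_real_derivative
        2 * a * (l * (x - \<beta>1) * v x + 2 * (x - \<beta>2) * z x + l * (x - \<beta>2) * v x)
        - ((l + 2) * j x + ((l + 2) * x - g) * (4 * a * v x))) (at x)"
    proof -
      have "((\<lambda>x. 2 * V x) has_real_derivative l * (x - \<beta>1) * v x + 2 * (x - \<beta>2) * z x + l * (x - \<beta>2) * v x) (at x)"
        by (rule DERIV_cong[OF DERIV_cmult[OF dV[OF x], of 2]]) (simp add: par field_simps)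
      then have "((\<lambda>x. 2 * a * (2 * V x) - ((l + 2) * x - g) * j x) has_real_derivative
          2 * a * (l * (x - \<beta>1) * v x + 2 * (x - \<beta>2) * z x + l * (x - \<beta>2) * v x)
        - ((l + 2) * j x + ((l + 2) * x - g) * (4 * a * v x))) (at x)"
        by (intro DERIV_diff DERIV_cmult) (auto intro!: derivative_eq_intros dj[OF x])
      then show ?thesis by (simp add: mult.assoc)
    qed
    have "((\<lambda>x. 4 * a * V x - ((l + 2) * x - g) * j x) has_real_derivative 2 * (l * (x - \<beta>2) * z x)) (at x)"
      by (rule has_field_derivative_transform_within_open[of "\<lambda>x. 2 * Z x" _ _ "{-1<..<1}"])
        (use x sec dZ[OF x] in \<open>auto intro!: derivative_eq_intros simp: par algebra_simps\<close>)
    from DERIV_unique[OF d1 this]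
    have "(1 - x\<^sup>2) * (2 * a * (l * (x - \<beta>1) * v x + 2 * (x - \<beta>2) * z x + l * (x - \<beta>2) * v x)
       - ((l + 2) * j x + ((l + 2) * x - g) * (4 * a * v x)) - 2 * (l * (x - \<beta>2) * z x)) = 0"
      by (simp add: algebra_simps)
    then have "2 * a * (l * (x - \<beta>1) + l * (x - \<beta>2)) * V x + 4 * a * (x - \<beta>2) * Z x
       - (l + 2) * ((1 - x\<^sup>2) * j x) - ((l + 2) * x - g) * (4 * a) * V x - 2 * l * (x - \<beta>2) * Z x = 0"
      unfolding V_def Z_def by (simp add: algebra_simps)
    then have F1: "V x * (8 * a * x + (l + 2) * e) + (x - \<beta>2) * Z x * (4 * l + 4 - 4 * a) = 0"
      unfolding jG by (simp add: g_def field_simps)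
    have "(1 - x\<^sup>2) * (4 * a * V x) = ((l + 2) * x - g) * ((1 - x\<^sup>2) * j x) + (1 - x\<^sup>2) * (2 * Z x)"
      unfolding sec[OF x] by (simp add: algebra_simps)
    then have F2: "Z x * (2 * (1 - x\<^sup>2) + 2 * ((l + 2) * x - g) * (x - \<beta>2)) = V x * (4 * a * (1 - x\<^sup>2) - ((l + 2) * x - g) * e)"
      unfolding jG by (simp add: algebra_simps)
    show "poly [:c0, c1, c2, 16 * a\<^sup>2:] x * Z x = 0"
      unfolding P[symmetric] P_def using F1 F2 by algebra
  qed (use a in auto)
  then show False using G_pos(2)[of 0] by simp
qed

text \<open>
  The off-diagonal entry satisfies a first-order equation of its own whose two exponents add up to
  $-1$, so it cannot vanish at both ends unless it is zero. Then \<open>j\<close> is zero as well.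
\<close>
lemma diagonal_moment_impossible:
  assumes a: "a \<noteq> 0" and par: "p1 = - 1" "t1 = - 1" "q1 = 2" "r1 = 2 * b1" "p0 = \<beta>1" "q0 = - 2 * \<beta>2" "r0 = - 2 * b1 * \<beta>1" "t0 = \<beta>2"
  shows False
proof -
  define g e where "g = - (\<beta>1 + \<beta>2) / 2" and "e = \<beta>1 - \<beta>2"
  have sec: "2 * Z x - 2 * b1 * U x = 4 * a * V x - (x - g) * j x" if "x \<in> {-1<..<1}" for x
    using second_relation[OF that] unfolding par by (simp add: g_def field_simps)
  have jG: "(1 - x\<^sup>2) * j x = 2 * (x - \<beta>2) * Z x - 2 * b1 * (x - \<beta>1) * U x + e * V x" for x
    unfolding j_def U_def V_def Z_def par e_def by (simp add: algebra_simps)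
  have ode: "(1 - x\<^sup>2) * (((p1 * x + p0) * v x + (q1 * x + q0) * z x + (r1 * x + r0) * u x + (t1 * x + t0) * v x) / 2)
      = (1 * x + (- g + e * (1 - 4 * b1) / (4 * a))) * V x" (is "_ * ?dV = _") if x: "x \<in> {-1<..<1}" for x
  proof -
    have d1: "((\<lambda>x. 2 * Z x - 2 * b1 * U x) has_real_derivative
        2 * (2 * b1 * (x - \<beta>1) * v x - (x - \<beta>2) * z x) - 2 * b1 * (- (x - \<beta>1) * u x + 2 * (x - \<beta>2) * v x)) (at x)"
      using dZ[OF x] dU[OF x] unfolding par by (auto intro!: derivative_eq_intros simp: algebra_simps)
    have "((\<lambda>x. 2 * Z x - 2 * b1 * U x) has_real_derivative 4 * a * ?dV - (j x + (x - g) * (4 * a * v x))) (at x)"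
      by (rule has_field_derivative_transform_within_open[of "\<lambda>x. 4 * a * V x - (x - g) * j x" _ _ "{-1<..<1}"])
        (use x sec in \<open>auto intro!: derivative_eq_intros dV[OF x] dj[OF x]\<close>)
    from DERIV_unique[OF d1 this]
    have "(1 - x\<^sup>2) * (2 * (2 * b1 * (x - \<beta>1) * v x - (x - \<beta>2) * z x) - 2 * b1 * (- (x - \<beta>1) * u x + 2 * (x - \<beta>2) * v x))
      = (1 - x\<^sup>2) * (4 * a * ?dV - (j x + (x - g) * (4 * a * v x)))" by (simp only:)
    then have "4 * a * ((1 - x\<^sup>2) * ?dV) = 4 * a * (x - g) * V x - 4 * b1 * e * V x
        + ((1 - x\<^sup>2) * j x - (2 * (x - \<beta>2) * Z x - 2 * b1 * (x - \<beta>1) * U x))"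
      unfolding U_def V_def Z_def e_def by (simp only: ring_distribs) (simp add: algebra_simps)
    then have "4 * a * ((1 - x\<^sup>2) * ?dV) = 4 * a * (x - g) * V x - 4 * b1 * e * V x + e * V x"
      unfolding jG by (simp add: algebra_simps)
    also have "\<dots> = 4 * a * ((1 * x + (- g + e * (1 - 4 * b1) / (4 * a))) * V x)"
      using a by (simp add: field_simps)
    finally show ?thesis by (rule mult_left_cancel[THEN iffD1, rotated]) (use a in simp)
  qed
  let ?\<beta> = "- g + e * (1 - 4 * b1) / (4 * a)"
  obtain C where C: "\<And>x. x \<in> {-1<..<1} \<Longrightarrow> V x = C * ((1 - x) powr (- (1 + ?\<beta>) / 2) * (1 + x) powr ((?\<beta> - 1) / 2))"
    using jacobi_first_order[OF dV ode] by blast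
  have "C = 0"
  proof (rule ccontr)
    assume C0: "C \<noteq> 0"
    have "0 < - (1 + ?\<beta>) / 2"
      by (rule jacobi_factor_exponent_right[OF tendsto_cong_right_end[OF right_limits(2) C] C0])
    moreover have "0 < (?\<beta> - 1) / 2"
      by (rule jacobi_factor_exponent_left[OF tendsto_cong_left_end[OF left_limits(2) C] C0])
    ultimately show False by auto
  qed
  then have V0: "V x = 0" if "x \<in> {-1<..<1}" for x using C[OF that] by simp
  have j0: "j x = 0" if x: "x \<in> {-1<..<1}" for x
  proof -
    have "(1 - x\<^sup>2) * (4 * a * v x) = (0 * x + 0) * j x" if "x \<in> {-1<..<1}" for x
      using V0[OF that] interval_pos[OF that] by (auto simp: V_def)
    then obtain C where C: "\<And>x. x \<in> {-1<..<1} \<Longrightarrow> j x = C * ((1 - x) powr (- (0 + 0) / 2) * (1 + x) powr ((0 - 0) / 2))"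
      using jacobi_first_order[OF dj] by blast
    have "C = 0"
      using jacobi_factor_exponent_right[OF tendsto_cong_right_end[OF right_limits(4) C]] by force
    then show ?thesis using C[OF x] by simp
  qed
  show False by (rule off_diagonal_not_zero[OF _ V0 j0]) (use par in auto)
qed

end

text \<open>
The form is definite on polynomial rows because a row has only finitely many zeros.
\<close>
lemma weight_inner_row_pos:
  fixes f g :: "complex poly"
  assumes W: "weight_matrix W" and nz: "f \<noteq> 0 \<or> g \<noteq> 0"
  shows "weight_inner W (mat2 f g 0 0) (mat2 f g 0 0) $ 1 $ 1 \<noteq> 0"
proof
  define h where "h x = (poly f (complex_of_real x) * W x $ 1 $ 1 + poly g x * W x $ 2 $ 1) * cnj (poly f x)
    + (poly f x * W x $ 1 $ 2 + poly g x * W x $ 2 $ 2) * cnj (poly g x)" for x :: real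
  assume z: "weight_inner W (mat2 f g 0 0) (mat2 f g 0 0) $ 1 $ 1 = 0"
  have e: "integrable lborel (\<lambda>x. poly P (complex_of_real x) * W x $ i $ m * cnj (poly Q (complex_of_real x)))" for P Q i m
    using integrable_continuous_mult_supported[OF _ weight_matrix_entry(1,2)[OF W],
        of "\<lambda>x. poly P (complex_of_real x) * cnj (poly Q (complex_of_real x))" i m]
    by (simp add: continuous_intros mult_ac)
  have int: "integrable lborel h"
    unfolding h_def[abs_def] by (simp add: distrib_right) (intro Bochner_Integration.integrable_add e)
  have "(LINT x|lborel. h x) = 0" using z unfolding weight_inner_row[OF W] h_def .
  then have i0: "(LINT x|lborel. Re (h x)) = 0" using integral_Re[OF int] by simp
  have pos: "0 < Re (h x)" if x: "x \<in> {-1<..<1}" and fg: "poly f x \<noteq> 0 \<or> poly g x \<noteq> 0" for x :: real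
  proof -
    let ?y = "vector [poly f (complex_of_real x), poly g (complex_of_real x)] :: complex^2"
    have "?y \<noteq> 0" using fg by (auto simp: vec_eq_iff forall_2)
    then have "0 < Re (\<Sum>i\<in>UNIV. \<Sum>k\<in>UNIV. ?y $ i * W x $ i $ k * cnj (?y $ k))"
      using W x unfolding weight_matrix_def positive_definite_def by blast
    then show ?thesis by (simp add: h_def sum_2 algebra_simps)
  qed
  have nn: "0 \<le> Re (h x)" for x
  proof (cases "x \<in> {-1<..<1} \<and> (poly f x \<noteq> 0 \<or> poly g x \<noteq> 0)")
    case True then show ?thesis using pos[of x] by linarith
  next
    case False
    then have "h x = 0" using weight_matrix_entry_support[OF W, of x] by (auto simp: h_def)
    then show ?thesis by simp
  qed
  have "AE x in lborel. Re (h x) = 0"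
    using integral_nonneg_eq_0_iff_AE[of lborel "\<lambda>x. Re (h x)"] int nn i0 by simp
  moreover define F where "F = {x :: real. poly f x = 0 \<and> poly g x = 0}"
  have "finite F"
  proof (cases "f = 0")
    case True
    then have "finite {x. poly g x = 0}" using nz poly_roots_finite by auto
    then have "finite (complex_of_real -` {x. poly g x = 0})" by (intro finite_vimageI) (auto simp: inj_on_def)
    then show ?thesis by (rule rev_finite_subset) (auto simp: F_def)
  next
    case False
    then have "finite (complex_of_real -` {x. poly f x = 0})"
      by (intro finite_vimageI poly_roots_finite) (auto simp: inj_on_def)
    then show ?thesis by (rule rev_finite_subset) (auto simp: F_def)
  qed
  then have "AE x in lborel. x \<notin> F"
    by (intro AE_not_in finite_imp_null_set_lborel)
  ultimately have "AE x in lborel. x \<notin> {-1<..<1::real}"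
  proof eventually_elim
    case (elim x)
    then show ?case using pos[of x] by (auto simp: F_def)
  qed
  then have "emeasure lborel {x \<in> space lborel. x \<in> {-1<..<1::real}} = 0" by (rule emeasure_eq_0_AE)
  moreover have "{x \<in> space lborel. x \<in> {-1<..<1::real}} = {-1<..<1}" by auto
  ultimately have "emeasure lborel {-1<..<1::real} = 0" by (simp only:)
  then show False by simp
qed

text \<open>
  Symmetry forces the spectrum of the operator on polynomials to be real. A non-real
  eigenvalue of the coefficient of \<open>x ^ n\<close> that is not an eigenvalue of the coefficients of
  lower order would extend, by solving for the lower coefficients one after the other, to a
  polynomial eigenfunction.
\<close>
lemma no_nonreal_eigenvalue:
  fixes A11 A10 A0 :: "complex^2^2" and \<mu> \<xi>1 \<xi>2 :: complex and n :: nat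
  defines "\<Lambda> \<equiv> \<lambda>k i m. of_nat k * A11 $ i $ m + A0 $ i $ m - (if i = m then of_nat k * (of_nat k - 1) + \<mu> else 0)"
  assumes pair: "bochner_pair W (hyp_op A11 A10 A0)"
    and \<mu>: "Im \<mu> \<noteq> 0" and \<xi>: "\<xi>1 \<noteq> 0 \<or> \<xi>2 \<noteq> 0"
    and eig: "\<xi>1 * \<Lambda> n 1 1 + \<xi>2 * \<Lambda> n 2 1 = 0" "\<xi>1 * \<Lambda> n 1 2 + \<xi>2 * \<Lambda> n 2 2 = 0"
    and det: "\<And>k. k < n \<Longrightarrow> \<Lambda> k 1 1 * \<Lambda> k 2 2 - \<Lambda> k 1 2 * \<Lambda> k 2 1 \<noteq> 0"
  shows False
proof -
  define res1 where "res1 f g k = (of_nat k + 2) * (of_nat k + 1) * coeff f (k + 2) + (of_nat k + 1) * (coeff f (k + 1) * A10 $ 1 $ 1 + coeff g (k + 1) * A10 $ 2 $ 1)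
    + coeff f k * \<Lambda> k 1 1 + coeff g k * \<Lambda> k 2 1" for f g :: "complex poly" and k :: nat
  define res2 where "res2 f g k = (of_nat k + 2) * (of_nat k + 1) * coeff g (k + 2) + (of_nat k + 1) * (coeff f (k + 1) * A10 $ 1 $ 2 + coeff g (k + 1) * A10 $ 2 $ 2)
    + coeff f k * \<Lambda> k 1 2 + coeff g k * \<Lambda> k 2 2" for f g :: "complex poly" and k :: nat
  have "\<exists>f g. coeff f n = \<xi>1 \<and> coeff g n = \<xi>2 \<and> (\<forall>k. n \<le> k + m \<longrightarrow> res1 f g k = 0 \<and> res2 f g k = 0)" if "m \<le> n" for m
    using that
  proof (induction m)
    case 0
    have "res1 (monom \<xi>1 n) (monom \<xi>2 n) k = 0 \<and> res2 (monom \<xi>1 n) (monom \<xi>2 n) k = 0" if "n \<le> k" for k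
      using that eig by (cases "k = n") (auto simp: res1_def res2_def)
    then show ?case by (intro exI[of _ "monom \<xi>1 n"] exI[of _ "monom \<xi>2 n"]) simp
  next
    case (Suc m)
    then obtain f g where fg: "coeff f n = \<xi>1" "coeff g n = \<xi>2"
      "\<And>k. n \<le> k + m \<Longrightarrow> res1 f g k = 0 \<and> res2 f g k = 0" by auto
    define k0 where "k0 = n - Suc m"
    have k0: "k0 < n" "n = k0 + Suc m" using Suc.prems by (auto simp: k0_def)
    define \<Delta> where "\<Delta> = \<Lambda> k0 1 1 * \<Lambda> k0 2 2 - \<Lambda> k0 1 2 * \<Lambda> k0 2 1"
    have \<Delta>: "\<Delta> \<noteq> 0" unfolding \<Delta>_def by (rule det[OF k0(1)])
    define s where "s = (- res1 f g k0 * \<Lambda> k0 2 2 + res2 f g k0 * \<Lambda> k0 2 1) / \<Delta>"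
    define t where "t = (- res2 f g k0 * \<Lambda> k0 1 1 + res1 f g k0 * \<Lambda> k0 1 2) / \<Delta>"
    have "(s * \<Lambda> k0 1 1 + t * \<Lambda> k0 2 1) * \<Delta> = - res1 f g k0 * \<Delta>"
      using \<Delta> by (simp add: s_def t_def distrib_right) (simp add: \<Delta>_def algebra_simps)
    then have st1: "s * \<Lambda> k0 1 1 + t * \<Lambda> k0 2 1 = - res1 f g k0" using mult_right_cancel[OF \<Delta>] by blast
    have "(s * \<Lambda> k0 1 2 + t * \<Lambda> k0 2 2) * \<Delta> = - res2 f g k0 * \<Delta>"
      using \<Delta> by (simp add: s_def t_def distrib_right) (simp add: \<Delta>_def algebra_simps)
    then have st2: "s * \<Lambda> k0 1 2 + t * \<Lambda> k0 2 2 = - res2 f g k0" using mult_right_cancel[OF \<Delta>] by blast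
    let ?f = "f + monom s k0" and ?g = "g + monom t k0"
    have "res1 ?f ?g k = 0 \<and> res2 ?f ?g k = 0" if k: "n \<le> k + Suc m" for k
    proof (cases "k = k0")
      case True
      have "res1 ?f ?g k0 = res1 f g k0 + (s * \<Lambda> k0 1 1 + t * \<Lambda> k0 2 1)"
        "res2 ?f ?g k0 = res2 f g k0 + (s * \<Lambda> k0 1 2 + t * \<Lambda> k0 2 2)"
        by (simp_all add: res1_def res2_def algebra_simps)
      then show ?thesis unfolding st1 st2 True by simp
    next
      case False
      then have "res1 ?f ?g k = res1 f g k" "res2 ?f ?g k = res2 f g k" "n \<le> k + m"
        using k k0 by (auto simp: res1_def res2_def)
      then show ?thesis using fg(3) by simp
    qed
    then show ?case using fg(1,2) k0 by (intro exI[of _ ?f] exI[of _ ?g]) auto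
  qed
  from this[of n] obtain f g where fg: "coeff f n = \<xi>1" "coeff g n = \<xi>2" "\<And>k. res1 f g k = 0" "\<And>k. res2 f g k = 0"
    by auto
  let ?P = "mat2 f g 0 0"
  have c2: "coeff ([:1, 0, -1:] * pderiv (pderiv h)) k = (of_nat k + 2) * (of_nat k + 1) * coeff h (k + 2) - of_nat k * (of_nat k - 1) * coeff h k"
    for h :: "complex poly" and k
  proof -
    consider "k = 0" | "k = 1" | m where "k = Suc (Suc m)" by (metis One_nat_def not0_implies_Suc)
    then show ?thesis
      by cases (simp_all add: coeff_pderiv coeff_pCons algebra_simps numeral_2_eq_2)
  qed
  have c1: "coeff ([:\<alpha>, \<beta>:] * pderiv h) k = \<alpha> * (of_nat k + 1) * coeff h (k + 1) + \<beta> * of_nat k * coeff h k"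
    for h :: "complex poly" and \<alpha> \<beta> k
    by (cases k) (simp_all add: coeff_pderiv coeff_pCons algebra_simps)
  have act: "act ?P (hyp_op A11 A10 A0) = mat2 (smult \<mu> f) (smult \<mu> g) 0 0"
    unfolding act_row
  proof (intro arg_cong2[where f = "\<lambda>x y. mat2 x y 0 0"] poly_eqI)
    show "coeff ([:1, 0, - 1:] * pderiv (pderiv f) + [:A10 $ 1 $ 1, A11 $ 1 $ 1:] * pderiv f
         + [:A10 $ 2 $ 1, A11 $ 2 $ 1:] * pderiv g + smult (A0 $ 1 $ 1) f + smult (A0 $ 2 $ 1) g) k = coeff (smult \<mu> f) k" for k
      using fg(3)[of k] unfolding coeff_add c1 c2 coeff_smult res1_def \<Lambda>_def by (simp add: algebra_simps)
    show "coeff ([:1, 0, - 1:] * pderiv (pderiv g) + [:A10 $ 1 $ 2, A11 $ 1 $ 2:] * pderiv f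
         + [:A10 $ 2 $ 2, A11 $ 2 $ 2:] * pderiv g + smult (A0 $ 1 $ 2) f + smult (A0 $ 2 $ 2) g) k = coeff (smult \<mu> g) k" for k
      using fg(4)[of k] unfolding coeff_add c1 c2 coeff_smult res2_def \<Lambda>_def by (simp add: algebra_simps)
  qed
  have W: "weight_matrix W" using pair by (simp add: bochner_pair_def)
  have "weight_inner W (act ?P (hyp_op A11 A10 A0)) ?P $ 1 $ 1 = weight_inner W ?P (act ?P (hyp_op A11 A10 A0)) $ 1 $ 1"
    using pair by (simp add: bochner_pair_def)
  moreover have "weight_inner W (act ?P (hyp_op A11 A10 A0)) ?P $ 1 $ 1 = \<mu> * weight_inner W ?P ?P $ 1 $ 1"
    unfolding act weight_inner_row[OF W] by (simp add: algebra_simps flip: integral_mult_right_zero)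
  moreover have "weight_inner W ?P (act ?P (hyp_op A11 A10 A0)) $ 1 $ 1 = cnj \<mu> * weight_inner W ?P ?P $ 1 $ 1"
    unfolding act weight_inner_row[OF W] by (simp add: algebra_simps flip: integral_mult_right_zero)
  moreover have "weight_inner W ?P ?P $ 1 $ 1 \<noteq> 0"
    by (rule weight_inner_row_pos[OF W]) (use fg(1,2) \<xi> in \<open>metis coeff_0\<close>)
  ultimately have "\<mu> = cnj \<mu>" by simp
  then show False using \<mu> by (simp add: complex_eq_iff)
qed

section \<open>Scalar pairs inside a matrix pair\<close>

lemma forall_1': "(\<forall>i::1. P i) \<longleftrightarrow> P 1"
  by (metis num1_eq1)

lemma act_1:
  "act P (hyp_op A B C) = (\<chi> i k. [:1, 0, -1:] * pderiv (pderiv (P $ 1 $ 1)) + [:B $ 1 $ 1, A $ 1 $ 1:] * pderiv (P $ 1 $ 1)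
     + smult (C $ 1 $ 1) (P $ 1 $ 1))" for P :: "(complex poly)^1^1"
proof -
  have "act P (hyp_op A B C) = pderiv_mat 0 P ** const_mat C
      + pderiv_mat 1 P ** (\<chi> i j. [:B $ i $ j, A $ i $ j:]) + pderiv_mat 2 P ** mat [:1, 0, -1:]"
    by (simp add: act_def hyp_op_def numeral_3_eq_3 numeral_2_eq_2 lessThan_Suc add_ac)
  then show ?thesis
    by (simp add: vec_eq_iff forall_1' matrix_matrix_mult_def sum_1 pderiv_mat_def mat_def const_mat_def numeral_2_eq_2 add_ac
        mult.commute[of "pderiv _"] mult.commute[of "P $ 1 $ 1"])
qed

text \<open>The pair obtained by restricting to the multiples of one row, when the operator preserves them.\<close>
definition compress :: "complex \<Rightarrow> complex \<Rightarrow> complex^2^2 \<Rightarrow> complex^1^1" where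
  "compress y1 y2 A = (\<chi> i k. (y1 * A $ 1 $ 1 + y2 * A $ 2 $ 1) * cnj y1 + (y1 * A $ 1 $ 2 + y2 * A $ 2 $ 2) * cnj y2)"

lemma compress_nth [simp]:
  "compress y1 y2 A $ i $ k = (y1 * A $ 1 $ 1 + y2 * A $ 2 $ 1) * cnj y1 + (y1 * A $ 1 $ 2 + y2 * A $ 2 $ 2) * cnj y2"
  by (simp add: compress_def)

lemma bounded_linear_compress: "bounded_linear (compress y1 y2)"
  by (simp flip: linear_conv_bounded_linear) (auto intro!: linearI simp: vec_eq_iff algebra_simps scaleR_add_right)

text \<open>
  A row that is a left eigenvector of all coefficients of the operator spans an invariant space of
  polynomial rows, on which the pair becomes scalar.
\<close>
lemma bochner_pair_compress:
  fixes A11 A10 A0 :: "complex^2^2"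
  assumes pair: "bochner_pair W (hyp_op A11 A10 A0)" and y: "y1 \<noteq> 0 \<or> y2 \<noteq> 0"
    and e1: "y1 * A11 $ 1 $ 1 + y2 * A11 $ 2 $ 1 = \<alpha>1 * y1" "y1 * A11 $ 1 $ 2 + y2 * A11 $ 2 $ 2 = \<alpha>1 * y2"
    and e2: "y1 * A10 $ 1 $ 1 + y2 * A10 $ 2 $ 1 = \<alpha>0 * y1" "y1 * A10 $ 1 $ 2 + y2 * A10 $ 2 $ 2 = \<alpha>0 * y2"
    and e3: "y1 * A0 $ 1 $ 1 + y2 * A0 $ 2 $ 1 = \<epsilon> * y1" "y1 * A0 $ 1 $ 2 + y2 * A0 $ 2 $ 2 = \<epsilon> * y2"
  shows "bochner_pair (\<lambda>x. compress y1 y2 (W x)) (hyp_op (\<chi> i k. \<alpha>1) (\<chi> i k. \<alpha>0) (\<chi> i k. \<epsilon>) :: 1 diff_op)"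
proof -
  let ?w = "\<lambda>x. compress y1 y2 (W x)" and ?d = "hyp_op (\<chi> i k. \<alpha>1) (\<chi> i k. \<alpha>0) (\<chi> i k. \<epsilon>) :: 1 diff_op"
  have W: "weight_matrix W" using pair by (simp add: bochner_pair_def)
  have "smooth_inside ?w"
  proof -
    obtain F where F: "F 0 = W" "\<And>k x. x \<in> {-1<..<1} \<Longrightarrow> (F k has_vector_derivative F (Suc k) x) (at x)"
      using W by (auto simp: weight_matrix_def smooth_inside_def)
    then show ?thesis unfolding smooth_inside_def
      by (intro exI[of _ "\<lambda>k x. compress y1 y2 (F k x)"])
        (auto intro!: bounded_linear.has_vector_derivative[OF bounded_linear_compress])
  qed
  moreover have "positive_definite (?w x)" if x: "x \<in> {-1<..<1}" for x
  proof -
    have pd: "positive_definite (W x)" using W x by (simp add: weight_matrix_def)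
    then have herm: "ctranspose (W x) = W x" by (simp add: positive_definite_def hermitian_def)
    have h: "cnj (W x $ 1 $ 1) = W x $ 1 $ 1" "cnj (W x $ 1 $ 2) = W x $ 2 $ 1" "cnj (W x $ 2 $ 1) = W x $ 1 $ 2" "cnj (W x $ 2 $ 2) = W x $ 2 $ 2"
      using arg_cong[OF herm, of "\<lambda>A. A $ 1 $ 1"] arg_cong[OF herm, of "\<lambda>A. A $ 2 $ 1"]
        arg_cong[OF herm, of "\<lambda>A. A $ 1 $ 2"] arg_cong[OF herm, of "\<lambda>A. A $ 2 $ 2"] by simp_all
    let ?y = "vector [y1, y2] :: complex^2"
    have "?y \<noteq> 0" using y by (auto simp: vec_eq_iff forall_2)
    then have "0 < Re (\<Sum>i\<in>UNIV. \<Sum>k\<in>UNIV. ?y $ i * W x $ i $ k * cnj (?y $ k))"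
      using pd by (auto simp: positive_definite_def)
    then have pos: "0 < Re (?w x $ 1 $ 1)" by (simp add: sum_2 algebra_simps)
    have "cnj (?w x $ 1 $ 1) = ?w x $ 1 $ 1" by (simp add: h algebra_simps)
    then have "hermitian (?w x)" by (simp add: hermitian_def vec_eq_iff)
    moreover have "0 < Re (v $ 1 * ?w x $ 1 $ 1 * cnj (v $ 1))" if "v \<noteq> 0" for v :: "complex^1"
    proof -
      have "v $ 1 \<noteq> 0" using that by (simp add: vec_eq_iff forall_1')
      moreover have "v $ 1 * ?w x $ 1 $ 1 * cnj (v $ 1) = complex_of_real ((cmod (v $ 1))\<^sup>2) * ?w x $ 1 $ 1"
        by (simp only: complex_norm_square mult_ac)
      ultimately show ?thesis using pos by (simp only: Re_complex_of_real Im_complex_of_real times_complex.sel) simp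
    qed
    ultimately show ?thesis unfolding positive_definite_def by (simp add: sum_1)
  qed
  moreover have "?w x = 0" if "x \<notin> {-1<..<1}" for x
    using weight_matrix_entry_support[OF W that] by (simp add: vec_eq_iff)
  moreover have "integrable lborel (\<lambda>x. x ^ n *\<^sub>R ?w x)" for n :: nat
  proof -
    have "integrable lborel (\<lambda>x. x ^ n *\<^sub>R W x)" using W by (auto simp: weight_matrix_def)
    then have "integrable lborel (\<lambda>x. compress y1 y2 (x ^ n *\<^sub>R W x))"
      by (rule integrable_bounded_linear[OF bounded_linear_compress])
    then show ?thesis by (simp only: linear_scale[OF bounded_linear.linear[OF bounded_linear_compress]])
  qed
  ultimately have w: "weight_matrix ?w" unfolding weight_matrix_def by blast
  have inner: "weight_inner ?w P Q $ 1 $ 1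
     = weight_inner W (mat2 (smult y1 (P $ 1 $ 1)) (smult y2 (P $ 1 $ 1)) 0 0) (mat2 (smult y1 (Q $ 1 $ 1)) (smult y2 (Q $ 1 $ 1)) 0 0) $ 1 $ 1"
    for P Q :: "(complex poly)^1^1"
  proof -
    have e: "(poly_mat P x ** ?w x ** ctranspose (poly_mat Q x)) $ i $ k
        = poly (P $ 1 $ 1) x * cnj (poly (Q $ 1 $ 1) x) * ?w x $ 1 $ 1" for x i k
      by (simp add: matrix_matrix_mult_def sum_1 num1_eq1[of i] num1_eq1[of k] mult_ac)
    have "integrable lborel (\<lambda>x. poly_mat P x ** ?w x ** ctranspose (poly_mat Q x))"
      by (rule integrable_matrixI, unfold e)
        (intro integrable_continuous_mult_supported weight_matrix_entry[OF w] continuous_intros; assumption)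
    then show ?thesis
      unfolding weight_inner_def[of ?w] by (simp only: integral_matrix_nth e weight_inner_row[OF W])
        (simp add: algebra_simps)
  qed
  have act: "act (mat2 (smult y1 (P $ 1 $ 1)) (smult y2 (P $ 1 $ 1)) 0 0) (hyp_op A11 A10 A0)
      = mat2 (smult y1 (act P ?d $ 1 $ 1)) (smult y2 (act P ?d $ 1 $ 1)) 0 0" for P :: "(complex poly)^1^1"
  proof -
    let ?p = "P $ 1 $ 1"
    have row: "[:1, 0, -1:] * pderiv (pderiv (smult s ?p)) + [:b1, c1:] * pderiv (smult y1 ?p) + [:b2, c2:] * pderiv (smult y2 ?p)
        + smult d1 (smult y1 ?p) + smult d2 (smult y2 ?p)
       = smult s ([:1, 0, -1:] * pderiv (pderiv ?p) + [:\<alpha>0, \<alpha>1:] * pderiv ?p + smult \<epsilon> ?p)"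
      if "y1 * b1 + y2 * b2 = \<alpha>0 * s" "y1 * c1 + y2 * c2 = \<alpha>1 * s" "y1 * d1 + y2 * d2 = \<epsilon> * s" for s b1 b2 c1 c2 d1 d2
    proof -
      have "poly ([:1, 0, -1:] * pderiv (pderiv (smult s ?p)) + [:b1, c1:] * pderiv (smult y1 ?p) + [:b2, c2:] * pderiv (smult y2 ?p)
        + smult d1 (smult y1 ?p) + smult d2 (smult y2 ?p)) x
       = s * (1 - x * x) * poly (pderiv (pderiv ?p)) x + ((y1 * b1 + y2 * b2) + x * (y1 * c1 + y2 * c2)) * poly (pderiv ?p) x
         + (y1 * d1 + y2 * d2) * poly ?p x" for x
        by (simp add: pderiv_smult algebra_simps)
      moreover have "s * (1 - x * x) * poly (pderiv (pderiv ?p)) x + ((y1 * b1 + y2 * b2) + x * (y1 * c1 + y2 * c2)) * poly (pderiv ?p) x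
         + (y1 * d1 + y2 * d2) * poly ?p x = poly (smult s ([:1, 0, -1:] * pderiv (pderiv ?p) + [:\<alpha>0, \<alpha>1:] * pderiv ?p + smult \<epsilon> ?p)) x" for x
        unfolding that by (simp add: algebra_simps)
      ultimately show ?thesis by (intro iffD1[OF poly_eq_poly_eq_iff] ext) (simp only:)
    qed
    show ?thesis unfolding act_row act_1 using row[OF e2(1) e1(1) e3(1)] row[OF e2(2) e1(2) e3(2)] by simp
  qed
  have "weight_inner ?w (act P ?d) Q = weight_inner ?w P (act Q ?d)" for P Q
  proof -
    have "weight_inner ?w (act P ?d) Q $ 1 $ 1 = weight_inner ?w P (act Q ?d) $ 1 $ 1"
      unfolding inner act[symmetric] using pair by (simp add: bochner_pair_def)
    then show ?thesis by (simp add: vec_eq_iff forall_1')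
  qed
  then show ?thesis using w unfolding bochner_pair_def by blast
qed

section \<open>Reducibility for vanishing constant term\<close>

text \<open>
  A real matrix with non-zero upper right entry that is self-adjoint for a positive definite
  form has two distinct real eigenvalues; the rows $(\kappa_\pm, q)$ are left eigenvectors,
  where $\kappa_\pm$ are the roots of $\kappa^2 - (p - t)\kappa - qr$.
\<close>
lemma selfadjoint_distinct_roots:
  fixes p q r t u v z :: real
  assumes q: "q \<noteq> 0" and pos: "0 < u" "0 < z" "v\<^sup>2 < u * z" and sa: "q * z - r * u + (p - t) * v = 0"
  obtains \<kappa>1 \<kappa>2 where "\<kappa>1 \<noteq> \<kappa>2" and "\<kappa>1 + \<kappa>2 = p - t" and "\<kappa>1 * \<kappa>2 = - q * r"
proof -
  have "0 < (p - t)\<^sup>2 + 4 * q * r"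
  proof (cases "p = t")
    case True
    then have "r * u = q * z" using sa by simp
    then have "q * r * u = q\<^sup>2 * z" by (simp add: power2_eq_square)
    moreover have "0 < q\<^sup>2 * z" using q pos by simp
    ultimately have "0 < q * r * u" by simp
    then have "0 < q * r" using pos(1) by (rule zero_less_mult_pos2)
    then show ?thesis using True by simp
  next
    case False
    have "(q * z - r * u)\<^sup>2 = (p - t)\<^sup>2 * v\<^sup>2" using sa by algebra
    then have "(q * z + r * u)\<^sup>2 = (p - t)\<^sup>2 * v\<^sup>2 + 4 * q * r * (u * z)" by algebra
    moreover have "(p - t)\<^sup>2 * v\<^sup>2 < (p - t)\<^sup>2 * (u * z)" using False pos(3) by simp
    ultimately have "0 < (p - t)\<^sup>2 * (u * z) + 4 * q * r * (u * z)"
      using zero_le_power2[of "q * z + r * u"] by linarith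
    then have "0 < ((p - t)\<^sup>2 + 4 * q * r) * (u * z)" by (simp add: algebra_simps)
    then show ?thesis using mult_pos_pos[OF pos(1,2)] by (rule zero_less_mult_pos2)
  qed
  then obtain s where s: "s \<noteq> 0" "s\<^sup>2 = (p - t)\<^sup>2 + 4 * q * r"
    by (metis less_eq_real_def less_irrefl real_sqrt_gt_zero real_sqrt_pow2)
  show thesis
  proof (rule that[of "((p - t) + s) / 2" "((p - t) - s) / 2"])
    show "((p - t) + s) / 2 * (((p - t) - s) / 2) = - q * r"
      using s(2) by (simp add: field_simps power2_eq_square)
  qed (use s(1) in \<open>auto simp: field_simps\<close>)
qed

text \<open>
The eigenvalue of a row known to be mapped to a proportional one.
\<close>
lemma eigenrow:
  fixes q \<kappa> p11 q11 r11 t11 :: real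
  assumes q: "q \<noteq> 0" and e: "(\<kappa> * p11 + q * r11) * q = (\<kappa> * q11 + q * t11) * \<kappa>"
  obtains \<alpha> where "\<kappa> * p11 + q * r11 = \<alpha> * \<kappa>" and "\<kappa> * q11 + q * t11 = \<alpha> * q"
proof (rule that[of "(\<kappa> * q11 + q * t11) / q"])
  show "\<kappa> * p11 + q * r11 = (\<kappa> * q11 + q * t11) / q * \<kappa>" using e q by (simp add: field_simps)
qed (use q in simp)

lemma matrix_inv_inverse:
  fixes A :: "'a::semiring_1^'n^'m"
  assumes "invertible A"
  shows "A ** matrix_inv A = mat 1" and "matrix_inv A ** A = mat 1"
  using someI_ex[OF assms[unfolded invertible_def]] unfolding matrix_inv_def by blast+

context real_weight
begin

text \<open>
  Without a constant term, \<open>j\<close> vanishes, so both coefficients of the first-order term are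
  self-adjoint for \<open>W x\<close> at every \<open>x\<close>. Eigenrows of one of them diagonalise \<open>W x\<close> for all
  \<open>x\<close>, and differentiating the vanishing off-diagonal entry shows that they are eigenrows of
  the other coefficient as well.
\<close>
lemma reducible_of_zero_constant_term:
  assumes a: "a = 0" and nd: "A11 $ 1 $ 2 \<noteq> 0 \<or> A10 $ 1 $ 2 \<noteq> 0"
  shows "reducible_pair W D"
proof -
  let ?p = "\<lambda>x. A11$1$1 * x + A10$1$1" and ?q = "\<lambda>x. A11$1$2 * x + A10$1$2"
    and ?r = "\<lambda>x. A11$2$1 * x + A10$2$1" and ?t = "\<lambda>x. A11$2$2 * x + A10$2$2"
  have j0: "?q x * z x - ?r x * u x + (?p x - ?t x) * v x = 0" if "x \<in> {-1<..<1}" for x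
    using j_zero_of_a_zero[OF a that] .
  have sa1: "A11$1$2 * z x - A11$2$1 * u x + (A11$1$1 - A11$2$2) * v x = 0" if x: "x \<in> {-1<..<1}" for x
  proof -
    have "(1 - x\<^sup>2) * (A11$1$2 * z x - A11$2$1 * u x + (A11$1$1 - A11$2$2) * v x) = 0"
      using second_relation[OF x] unfolding a j_zero_of_a_zero[OF a x] by (simp add: algebra_simps)
    then show ?thesis using interval_pos[OF x] by simp
  qed
  have sa0: "A10$1$2 * z x - A10$2$1 * u x + (A10$1$1 - A10$2$2) * v x = 0" if x: "x \<in> {-1<..<1}" for x
    using j0[OF x] sa1[OF x] by algebra
  obtain mp mq mr mt where mq: "mq \<noteq> 0"
    and sa: "\<And>x. x \<in> {-1<..<1} \<Longrightarrow> mq * z x - mr * u x + (mp - mt) * v x = 0"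
  proof (cases "A11$1$2 = 0")
    case False
    show thesis by (rule that[OF False sa1])
  next
    case True
    then have "A10$1$2 \<noteq> 0" using nd by simp
    then show thesis by (rule that[OF _ sa0])
  qed
  have I0: "(0::real) \<in> {-1<..<1}" by simp
  obtain \<kappa>1 \<kappa>2 where \<kappa>: "\<kappa>1 \<noteq> \<kappa>2" "\<kappa>1 + \<kappa>2 = mp - mt" "\<kappa>1 * \<kappa>2 = - mq * mr"
    using selfadjoint_distinct_roots[OF mq entry_positive(1)[OF I0] entry_positive(2)[OF I0] entry_positive(3)[OF I0] sa[OF I0]] by blast
  have off: "\<kappa>1 * \<kappa>2 * u x + mq * (\<kappa>1 + \<kappa>2) * v x + mq\<^sup>2 * z x = 0" if x: "x \<in> {-1<..<1}" for x
    using sa[OF x] unfolding \<kappa>(2,3) by algebra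
  have doff: "\<kappa>1 * \<kappa>2 * (?p x * u x + ?q x * v x) + mq * (\<kappa>1 + \<kappa>2) * (?p x * v x + ?q x * z x)
      + mq\<^sup>2 * (?r x * v x + ?t x * z x) = 0" if x: "x \<in> {-1<..<1}" for x
  proof -
    let ?f = "\<lambda>x. \<kappa>1 * \<kappa>2 * ((1 - x\<^sup>2) * u x) + mq * (\<kappa>1 + \<kappa>2) * ((1 - x\<^sup>2) * v x) + mq\<^sup>2 * ((1 - x\<^sup>2) * z x)"
    have d1: "(?f has_real_derivative \<kappa>1 * \<kappa>2 * (?p x * u x + ?q x * v x)
       + mq * (\<kappa>1 + \<kappa>2) * ((?p x * v x + ?q x * z x + ?r x * u x + ?t x * v x) / 2) + mq\<^sup>2 * (?r x * v x + ?t x * z x)) (at x)"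
      by (rule DERIV_add[OF DERIV_add[OF DERIV_cmult[OF dU[OF x]] DERIV_cmult[OF dV[OF x]]] DERIV_cmult[OF dZ[OF x]]])
    have f0: "?f y = 0" if "y \<in> {-1<..<1}" for y
    proof -
      have "?f y = (1 - y\<^sup>2) * (\<kappa>1 * \<kappa>2 * u y + mq * (\<kappa>1 + \<kappa>2) * v y + mq\<^sup>2 * z y)"
        by (simp only: ring_distribs mult_ac)
      then show ?thesis unfolding off[OF that] by simp
    qed
    have d0: "(?f has_real_derivative 0) (at x)"
      by (rule has_field_derivative_transform_within_open[OF DERIV_const[of 0] open_greaterThanLessThan x]) (simp only: f0)
    note E = DERIV_unique[OF d1 d0]
    have S: "?p x * v x + ?q x * z x + ?r x * u x + ?t x * v x = 2 * (?p x * v x + ?q x * z x)"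
      using j0[OF x] by algebra
    have half: "(2 * y) / 2 = y" for y :: real by simp
    show ?thesis using E unfolding S half .
  qed
  have eig: "(\<kappa> * ?p x + mq * ?r x) * mq = (\<kappa> * ?q x + mq * ?t x) * \<kappa>"
    if x: "x \<in> {-1<..<1}" and \<kappa>': "\<kappa> = \<kappa>1 \<and> \<kappa>' = \<kappa>2 \<or> \<kappa> = \<kappa>2 \<and> \<kappa>' = \<kappa>1" for x \<kappa> \<kappa>'
  proof -
    define X Y where "X = u x * \<kappa>' + v x * mq" and "Y = v x * \<kappa>' + z x * mq"
    have o: "\<kappa> * X + mq * Y = 0" using off[OF x] \<kappa>' unfolding X_def Y_def by (auto simp: algebra_simps power2_eq_square)
    have "(\<kappa> * ?p x + mq * ?r x) * X + (\<kappa> * ?q x + mq * ?t x) * Y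
      = \<kappa> * \<kappa>' * (?p x * u x + ?q x * v x) + mq * \<kappa> * (?p x * v x + ?q x * z x) + mq * \<kappa>' * (?r x * u x + ?t x * v x)
        + mq\<^sup>2 * (?r x * v x + ?t x * z x)" unfolding X_def Y_def by (simp add: algebra_simps power2_eq_square)
    also have "?r x * u x + ?t x * v x = ?p x * v x + ?q x * z x" using j0[OF x] by algebra
    also have "\<kappa> * \<kappa>' * (?p x * u x + ?q x * v x) + mq * \<kappa> * (?p x * v x + ?q x * z x) + mq * \<kappa>' * (?p x * v x + ?q x * z x)
        + mq\<^sup>2 * (?r x * v x + ?t x * z x) = 0" using doff[OF x] \<kappa>' by (auto simp: algebra_simps)
    finally have d: "(\<kappa> * ?p x + mq * ?r x) * X + (\<kappa> * ?q x + mq * ?t x) * Y = 0" .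
    have X: "X \<noteq> 0"
    proof
      assume "X = 0"
      then have "Y = 0" using o mq by simp
      then have "mq * (u x * z x - (v x)\<^sup>2) = 0" using \<open>X = 0\<close> unfolding X_def Y_def by algebra
      then show False using mq entry_positive(3)[OF x] by simp
    qed
    define c1 c2 where "c1 = \<kappa> * ?p x + mq * ?r x" and "c2 = \<kappa> * ?q x + mq * ?t x"
    have "X * (c1 * mq - c2 * \<kappa>) = mq * (c1 * X + c2 * Y) - c2 * (\<kappa> * X + mq * Y)" by algebra
    also have "\<dots> = 0" using o d[folded c1_def c2_def] by simp
    finally have "X * (c1 * mq - c2 * \<kappa>) = 0" .
    then have "X * ((\<kappa> * ?p x + mq * ?r x) * mq - (\<kappa> * ?q x + mq * ?t x) * \<kappa>) = 0"
      unfolding c1_def c2_def .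
    then show ?thesis using X by simp
  qed
  have coeffs: "(\<kappa> * A11$1$1 + mq * A11$2$1) * mq = (\<kappa> * A11$1$2 + mq * A11$2$2) * \<kappa>
      \<and> (\<kappa> * A10$1$1 + mq * A10$2$1) * mq = (\<kappa> * A10$1$2 + mq * A10$2$2) * \<kappa>"
    if \<kappa>': "\<kappa> = \<kappa>1 \<and> \<kappa>' = \<kappa>2 \<or> \<kappa> = \<kappa>2 \<and> \<kappa>' = \<kappa>1" for \<kappa> \<kappa>'
  proof -
    have "(\<kappa> * (A11$1$1 * 0 + A10$1$1) + mq * (A11$2$1 * 0 + A10$2$1)) * mq
        = (\<kappa> * (A11$1$2 * 0 + A10$1$2) + mq * (A11$2$2 * 0 + A10$2$2)) * \<kappa>"
      by (rule eig[OF _ \<kappa>']) simp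
    then have 0: "(\<kappa> * A10$1$1 + mq * A10$2$1) * mq = (\<kappa> * A10$1$2 + mq * A10$2$2) * \<kappa>" by simp
    have "(\<kappa> * (A11$1$1 * (1/2) + A10$1$1) + mq * (A11$2$1 * (1/2) + A10$2$1)) * mq
        = (\<kappa> * (A11$1$2 * (1/2) + A10$1$2) + mq * (A11$2$2 * (1/2) + A10$2$2)) * \<kappa>"
      by (rule eig[OF _ \<kappa>']) simp
    then have "(\<kappa> * A11$1$1 + mq * A11$2$1) * mq + 2 * ((\<kappa> * A10$1$1 + mq * A10$2$1) * mq)
        = (\<kappa> * A11$1$2 + mq * A11$2$2) * \<kappa> + 2 * ((\<kappa> * A10$1$2 + mq * A10$2$2) * \<kappa>)"
      by (simp add: field_simps)
    then show ?thesis using 0 by simp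
  qed
  note c12 = coeffs[of \<kappa>1 \<kappa>2, OF disjI1, OF conjI, OF HOL.refl HOL.refl]
  note c21 = coeffs[of \<kappa>2 \<kappa>1, OF disjI2, OF conjI, OF HOL.refl HOL.refl]
  obtain \<alpha>1 where \<alpha>1: "\<kappa>1 * A11$1$1 + mq * A11$2$1 = \<alpha>1 * \<kappa>1" "\<kappa>1 * A11$1$2 + mq * A11$2$2 = \<alpha>1 * mq"
    by (rule eigenrow[OF mq c12[THEN conjunct1]])
  obtain \<alpha>0 where \<alpha>0: "\<kappa>1 * A10$1$1 + mq * A10$2$1 = \<alpha>0 * \<kappa>1" "\<kappa>1 * A10$1$2 + mq * A10$2$2 = \<alpha>0 * mq"
    by (rule eigenrow[OF mq c12[THEN conjunct2]])
  obtain \<beta>1 where \<beta>1: "\<kappa>2 * A11$1$1 + mq * A11$2$1 = \<beta>1 * \<kappa>2" "\<kappa>2 * A11$1$2 + mq * A11$2$2 = \<beta>1 * mq"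
    by (rule eigenrow[OF mq c21[THEN conjunct1]])
  obtain \<beta>0 where \<beta>0: "\<kappa>2 * A10$1$1 + mq * A10$2$1 = \<beta>0 * \<kappa>2" "\<kappa>2 * A10$1$2 + mq * A10$2$2 = \<beta>0 * mq"
    by (rule eigenrow[OF mq c21[THEN conjunct2]])
  let ?w1 = "\<lambda>x. compress \<kappa>1 mq (W x)" and ?w2 = "\<lambda>x. compress \<kappa>2 mq (W x)"
  let ?d1 = "hyp_op (\<chi> i k. complex_of_real \<alpha>1) (\<chi> i k. complex_of_real \<alpha>0) (\<chi> i k. 0) :: 1 diff_op"
  let ?d2 = "hyp_op (\<chi> i k. complex_of_real \<beta>1) (\<chi> i k. complex_of_real \<beta>0) (\<chi> i k. 0) :: 1 diff_op"
  note of_real = of_real_mult[symmetric, where 'a = complex] of_real_add[symmetric, where 'a = complex]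
  have b1: "bochner_pair ?w1 ?d1"
    by (rule bochner_pair_compress[OF pair[unfolded D_eq]])
      (use mq \<alpha>1 \<alpha>0 in \<open>simp_all add: A0_of_def a of_real del: of_real_mult of_real_add\<close>)
  have b2: "bochner_pair ?w2 ?d2"
    by (rule bochner_pair_compress[OF pair[unfolded D_eq]])
      (use mq \<beta>1 \<beta>0 in \<open>simp_all add: A0_of_def a of_real del: of_real_mult of_real_add\<close>)
  define U where "U = cmat (mat2 \<kappa>1 mq \<kappa>2 mq)"
  define s m where "s = complex_of_real (1 / (\<kappa>1 - \<kappa>2))" and "m = complex_of_real (1 / mq)"
  have sm: "s * (complex_of_real \<kappa>1 - complex_of_real \<kappa>2) = 1" "complex_of_real mq * m = 1"
    using \<kappa>(1) mq by (simp_all add: s_def m_def)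
  define U' where "U' = mat2 s (- s) (- complex_of_real \<kappa>2 * m * s) (complex_of_real \<kappa>1 * m * s)"
  have "(U ** U') $ 1 $ 1 = 1" "(U ** U') $ 1 $ 2 = 0" "(U ** U') $ 2 $ 1 = 0" "(U ** U') $ 2 $ 2 = 1"
    unfolding matrix_mult_2_nth U_def U'_def cmat_nth mat2_nth using sm by algebra+
  then have UU'1: "U ** U' = mat 1" by (intro mat2_eqI) (simp_all add: mat_def)
  have "(U' ** U) $ 1 $ 1 = 1" "(U' ** U) $ 1 $ 2 = 0" "(U' ** U) $ 2 $ 1 = 0" "(U' ** U) $ 2 $ 2 = 1"
    unfolding matrix_mult_2_nth U_def U'_def cmat_nth mat2_nth using sm by algebra+
  then have "U' ** U = mat 1" by (intro mat2_eqI) (simp_all add: mat_def)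
  note UU' = UU'1 this
  have inv: "invertible U" using UU' unfolding invertible_def by blast
  have U'_eq: "matrix_inv U = U'"
  proof -
    have "U ** matrix_inv U = mat 1" by (rule matrix_inv_inverse(1)[OF inv])
    then have "U' ** (U ** matrix_inv U) = U'" by simp
    then show ?thesis unfolding matrix_mul_assoc UU'(2) by simp
  qed
  have cw: "conj_weight U W = (\<lambda>x. direct_sum (?w1 x) (?w2 x))"
  proof (rule ext)
    fix x
    show "conj_weight U W x = direct_sum (?w1 x) (?w2 x)"
    proof (cases "x \<in> {-1<..<1}")
      case True
      have "complex_of_real (\<kappa>1 * \<kappa>2 * u x + mq * (\<kappa>1 + \<kappa>2) * v x + mq\<^sup>2 * z x) = 0"
        using off[OF True] by simp
      then show ?thesis
        by (intro mat2_eqI) (simp_all add: conj_weight_def direct_sum_def matrix_mult_2_nth U_def W_eq algebra_simps power2_eq_square)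
    next
      case False
      then show ?thesis
        by (intro mat2_eqI) (simp_all add: conj_weight_def direct_sum_def matrix_mult_2_nth U_def W_eq entry_support)
    qed
  qed
  have cu: "const_mat U ** const_mat U' = mat 1"
    by (rule mat2_eqI; use arg_cong[OF UU'(1), of "\<lambda>A. A $ 1 $ 1"] arg_cong[OF UU'(1), of "\<lambda>A. A $ 1 $ 2"]
       arg_cong[OF UU'(1), of "\<lambda>A. A $ 2 $ 1"] arg_cong[OF UU'(1), of "\<lambda>A. A $ 2 $ 2"] in
       \<open>simp add: matrix_mult_2_nth mat_def one_pCons mult_ac\<close>)
  have conjI: "const_mat U ** A ** const_mat (matrix_inv U) = E" if "const_mat U ** A = E ** const_mat U" for A E
    unfolding that U'_eq by (simp add: cu flip: matrix_mul_assoc)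
  have co: "conj_op U D = map2 direct_sum ?d1 ?d2"
  proof -
    have 0: "const_mat U ** const_mat (cmat (A0_of a)) = direct_sum (const_mat (\<chi> i k. 0)) (const_mat (\<chi> i k. 0)) ** const_mat U"
      by (rule mat2_eqI; simp add: matrix_mult_2_nth direct_sum_def A0_of_def a)
    have 1: "const_mat U ** (\<chi> i j. [:cmat A10 $ i $ j, cmat A11 $ i $ j:])
      = direct_sum (\<chi> i j. [:(\<chi> i k. complex_of_real \<alpha>0) $ i $ j, (\<chi> i k. complex_of_real \<alpha>1) $ i $ j:])
         (\<chi> i j. [:(\<chi> i k. complex_of_real \<beta>0) $ i $ j, (\<chi> i k. complex_of_real \<beta>1) $ i $ j:]) ** const_mat U"
      by (rule mat2_eqI; use \<alpha>1 \<alpha>0 \<beta>1 \<beta>0 in \<open>simp add: matrix_mult_2_nth direct_sum_def U_def mult.commute flip: of_real_mult of_real_add\<close>)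
    have 2: "const_mat U ** mat [:1, 0, - 1:] = direct_sum (mat [:1, 0, - 1:]) (mat [:1, 0, - 1:]) ** const_mat U"
      by (rule mat2_eqI; simp add: matrix_mult_2_nth direct_sum_def mat_def mult.commute)
    show ?thesis unfolding D_eq conj_op_def hyp_op_def list.map conjI[OF 0] conjI[OF 1] conjI[OF 2] by simp
  qed
  have "pair_equiv (W, D) (conj_weight U W, conj_op U D)"
    by (rule pair_equiv.conjugation[OF pair_equiv.refl inv])
  then show ?thesis unfolding reducible_pair_def cw co using b1 b2 by blast
qed

end

section \<open>Normal forms of the weight\<close>

lemma real_weight_of_pair:
  assumes pair: "bochner_pair W D" and real: "real_pair W D"
    and D: "D = hyp_op (cmat A11) (cmat A10) (cmat (A0_of a))"
  obtains u v z where "real_weight W D A11 A10 a u v z"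
proof -
  have W: "weight_matrix W" using pair by (simp add: bochner_pair_def)
  have re: "W x $ i $ k = complex_of_real (Re (W x $ i $ k))" for x i k
    using real by (simp add: real_pair_def of_real_Re)
  have sym: "Re (W x $ 2 $ 1) = Re (W x $ 1 $ 2)" for x
  proof (cases "x \<in> {-1<..<1}")
    case True
    then have "ctranspose (W x) = W x"
      using W by (simp add: weight_matrix_def positive_definite_def hermitian_def)
    from arg_cong[OF this, of "\<lambda>A. Re (A $ 1 $ 2)"] show ?thesis by simp
  next
    case False
    then show ?thesis by (simp only: weight_matrix_entry_support[OF W False])
  qed
  have "W = (\<lambda>x. cmat (mat2 (Re (W x $ 1 $ 1)) (Re (W x $ 1 $ 2)) (Re (W x $ 1 $ 2)) (Re (W x $ 2 $ 2))))"
  proof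
    fix x
    show "W x = cmat (mat2 (Re (W x $ 1 $ 1)) (Re (W x $ 1 $ 2)) (Re (W x $ 1 $ 2)) (Re (W x $ 2 $ 2)))"
      by (rule mat2_eqI, unfold cmat_nth mat2_nth) (rule re, rule re, rule re[of x 2 1, unfolded sym], rule re)
  qed
  then have "real_weight W D A11 A10 a (\<lambda>x. Re (W x $ 1 $ 1)) (\<lambda>x. Re (W x $ 1 $ 2)) (\<lambda>x. Re (W x $ 2 $ 2))"
    using pair D by unfold_locales
  then show thesis by (rule that)
qed

lemma scaleR_cmat_nth: "(r *\<^sub>R cmat A) $ i $ k = complex_of_real (r * A $ i $ k)"
  by (simp add: scaleR_conv_of_real[where 'a = complex])

lemma jacobi_factor_pos: "x \<in> {-1<..<1} \<Longrightarrow> 0 < jacobi_factor l g \<sigma>m \<sigma>p x"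
  by (simp add: jacobi_factor_def)

lemma diagonal_conjugation:
  "conj_weight (cmat (mat2 \<alpha> 0 0 \<beta>)) (\<lambda>x. cmat (mat2 (u x) (v x) (v x) (z x))) x
    = cmat (mat2 (\<alpha>\<^sup>2 * u x) (\<alpha> * \<beta> * v x) (\<alpha> * \<beta> * v x) (\<beta>\<^sup>2 * z x))"
  by (rule mat2_eqI) (simp_all add: conj_weight_def matrix_mult_2_nth power2_eq_square mult_ac)

lemma invertible_diagonal:
  assumes "\<alpha> \<noteq> 0" "\<beta> \<noteq> 0"
  shows "invertible (cmat (mat2 \<alpha> 0 0 \<beta>))"
proof -
  have "cmat (mat2 \<alpha> 0 0 \<beta>) ** cmat (mat2 (1/\<alpha>) 0 0 (1/\<beta>)) = mat 1" "cmat (mat2 (1/\<alpha>) 0 0 (1/\<beta>)) ** cmat (mat2 \<alpha> 0 0 \<beta>) = mat 1"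
    by (rule mat2_eqI; use assms in \<open>simp add: matrix_mult_2_nth mat_def\<close>)+
  then show ?thesis unfolding invertible_def by blast
qed

context real_weight
begin

text \<open>
  The first diagonal entry is recovered from the determinant, which is the reason for the shape of
  the normal forms.
\<close>
lemma similar_to_sym_with_det:
  assumes ab: "\<alpha> \<noteq> 0" "\<beta> \<noteq> 0"
    and v: "\<And>x. x \<in> {-1<..<1} \<Longrightarrow> \<alpha> * \<beta> * v x = jacobi_factor l g \<sigma>m \<sigma>p x * q12 x"
    and z: "\<And>x. x \<in> {-1<..<1} \<Longrightarrow> \<beta>\<^sup>2 * z x = jacobi_factor l g \<sigma>m \<sigma>p x * q22 x"
    and det: "\<And>x. x \<in> {-1<..<1} \<Longrightarrow> (\<alpha> * \<beta>)\<^sup>2 * (u x * z x - (v x)\<^sup>2) = (jacobi_factor l g \<sigma>m \<sigma>p x)\<^sup>2 * \<delta> x"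
  shows "similar_to_form W l g \<sigma>m \<sigma>p (\<lambda>x. sym_with_det (\<delta> x) (q12 x) (q22 x))"
  unfolding similar_to_form_def weight_of_form_def
proof (intro exI conjI ballI)
  show "invertible (cmat (mat2 \<alpha> 0 0 \<beta>))" by (rule invertible_diagonal[OF ab])
  fix x :: real assume x: "x \<in> {-1<..<1}"
  define J where "J = jacobi_factor l g \<sigma>m \<sigma>p x"
  have J: "J > 0" unfolding J_def by (rule jacobi_factor_pos[OF x])
  have q22: "q22 x \<noteq> 0" using z[OF x] ab entry_positive(2)[OF x] by auto
  have "J\<^sup>2 * (\<delta> x + (q12 x)\<^sup>2) = (\<alpha> * \<beta>)\<^sup>2 * (u x * z x - (v x)\<^sup>2) + (\<alpha> * \<beta> * v x)\<^sup>2"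
    unfolding det[OF x] v[OF x] J_def by (simp add: power_mult_distrib distrib_left)
  also have "\<dots> = (\<alpha>\<^sup>2 * u x) * (\<beta>\<^sup>2 * z x)" by (simp add: power_mult_distrib algebra_simps)
  also have "\<dots> = J * ((\<alpha>\<^sup>2 * u x) * q22 x)" unfolding z[OF x] J_def by simp
  finally have "J * (J * (\<delta> x + (q12 x)\<^sup>2)) = J * ((\<alpha>\<^sup>2 * u x) * q22 x)" by (simp only: power2_eq_square mult.assoc)
  then have "J * (\<delta> x + (q12 x)\<^sup>2) = (\<alpha>\<^sup>2 * u x) * q22 x"
    by (rule mult_left_cancel[THEN iffD1, rotated]) (use J in simp)
  then have u: "\<alpha>\<^sup>2 * u x = J * ((\<delta> x + (q12 x)\<^sup>2) / q22 x)" using q22 by (simp add: field_simps)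
  have "conj_weight (cmat (mat2 \<alpha> 0 0 \<beta>)) W x
    = cmat (mat2 (J * ((\<delta> x + (q12 x)\<^sup>2) / q22 x)) (J * q12 x) (J * q12 x) (J * q22 x))"
    unfolding W_eq diagonal_conjugation u v[OF x] z[OF x] J_def ..
  also have "\<dots> = J *\<^sub>R cmat (sym_with_det (\<delta> x) (q12 x) (q22 x))"
    by (rule mat2_eqI) (simp_all only: scaleR_cmat_nth cmat_nth mat2_nth sym_with_det_def)
  finally show "conj_weight (cmat (mat2 \<alpha> 0 0 \<beta>)) W x = jacobi_factor l g \<sigma>m \<sigma>p x *\<^sub>R cmat (sym_with_det (\<delta> x) (q12 x) (q22 x))"
    unfolding J_def .
qed

text \<open>
  A diagonal similarity has two free scalars: they absorb the constant \<open>c\<close> and the relative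
  factor \<open>\<tau>\<close> of the two entries. The sign of \<open>s\<close> is the one that makes the second diagonal
  entry positive.
\<close>
lemma similar_of_solution:
  assumes c: "c \<noteq> 0" and \<tau>: "\<tau> \<noteq> 0" and s2: "s2 > 0"
    and v: "\<And>x. x \<in> {-1<..<1} \<Longrightarrow> v x = c * jacobi_factor l g \<sigma>m \<sigma>p x * (E x / (1 - x\<^sup>2))"
    and z: "\<And>x. x \<in> {-1<..<1} \<Longrightarrow> z x = \<tau> * c * jacobi_factor l g \<sigma>m \<sigma>p x * (F x / (1 - x\<^sup>2))"
    and det: "\<And>x. x \<in> {-1<..<1} \<Longrightarrow> u x * z x - (v x)\<^sup>2 = c\<^sup>2 * (jacobi_factor l g \<sigma>m \<sigma>p x)\<^sup>2 * (s2 * \<delta> x)"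
  shows "\<exists>s. s\<^sup>2 = s2 \<and> s \<noteq> 0 \<and>
    similar_to_form W l g \<sigma>m \<sigma>p (\<lambda>x. sym_with_det (\<delta> x) (1 / ((1 - x\<^sup>2) * s) * E x) (1 / ((1 - x\<^sup>2) * s) * F x))"
proof (intro exI conjI)
  define s where "s = sgn (\<tau> * c) * sqrt s2"
  have s: "s\<^sup>2 = s2" "s \<noteq> 0" using c \<tau> s2 by (simp_all add: s_def power_mult_distrib sgn_if)
  show "s\<^sup>2 = s2" "s \<noteq> 0" by (fact s)+
  define C where "C = c * s"
  have "\<tau> * C = \<bar>\<tau> * c\<bar> * sqrt s2" unfolding abs_sgn[of "\<tau> * c"] by (simp add: C_def s_def mult_ac)
  then have "\<tau> * C > 0" using c \<tau> s2 by simp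
  then have C: "C \<noteq> 0" "\<tau> * C > 0" by auto
  define \<beta> where "\<beta> = 1 / sqrt (\<tau> * C)"
  define \<alpha> where "\<alpha> = sqrt (\<tau> * C) / C"
  have ab: "\<alpha> \<noteq> 0" "\<beta> \<noteq> 0" using C \<tau> by (simp_all add: \<alpha>_def \<beta>_def)
  have ab1: "\<alpha> * \<beta> = 1 / C" and b2: "\<beta>\<^sup>2 = 1 / (\<tau> * C)"
    using C \<tau> by (simp_all add: \<alpha>_def \<beta>_def power_divide)
  let ?J = "jacobi_factor l g \<sigma>m \<sigma>p"
  show "similar_to_form W l g \<sigma>m \<sigma>p (\<lambda>x. sym_with_det (\<delta> x) (1 / ((1 - x\<^sup>2) * s) * E x) (1 / ((1 - x\<^sup>2) * s) * F x))"
  proof (rule similar_to_sym_with_det[OF ab])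
    fix x :: real assume x: "x \<in> {-1<..<1}"
    define R where "R = 1 - x\<^sup>2"
    have \<rho>: "R \<noteq> 0" using interval_pos[OF x] by (simp add: R_def)
    show "\<alpha> * \<beta> * v x = ?J x * (1 / ((1 - x\<^sup>2) * s) * E x)"
      unfolding ab1 v[OF x] C_def R_def[symmetric] using c s(2) \<rho> by (simp add: field_simps)
    show "\<beta>\<^sup>2 * z x = ?J x * (1 / ((1 - x\<^sup>2) * s) * F x)"
      unfolding b2 z[OF x] C_def R_def[symmetric] using c s(2) \<rho> \<tau> by (simp add: field_simps)
    show "(\<alpha> * \<beta>)\<^sup>2 * (u x * z x - (v x)\<^sup>2) = (?J x)\<^sup>2 * \<delta> x"
      unfolding ab1 det[OF x] C_def s(1)[symmetric] using c s(2) by (simp add: power_divide power_mult_distrib)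
  qed
qed

lemma rational_of_solution:
  assumes c: "c \<noteq> 0"
    and v: "\<And>x. x \<in> {-1<..<1} \<Longrightarrow> v x = c * jacobi_factor l g \<sigma>m \<sigma>p x * (poly E x / (1 - x\<^sup>2))"
    and z: "\<And>x. x \<in> {-1<..<1} \<Longrightarrow> z x = c * jacobi_factor l g \<sigma>m \<sigma>p x * (poly F x / (1 - x\<^sup>2))"
    and det: "\<And>x. x \<in> {-1<..<1} \<Longrightarrow> u x * z x - (v x)\<^sup>2 = c\<^sup>2 * (jacobi_factor l g \<sigma>m \<sigma>p x)\<^sup>2 * (poly \<delta> x / (1 - x\<^sup>2)\<^sup>2)"
  shows "\<exists>Q. rational_on_interval Q \<and> (\<forall>x\<in>{-1<..<1}. transpose (Q x) = Q x) \<and> weight_of_form W l g \<sigma>m \<sigma>p Q"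
proof -
  let ?J = "jacobi_factor l g \<sigma>m \<sigma>p"
  define Q where "Q x = mat2 (u x / ?J x) (v x / ?J x) (v x / ?J x) (z x / ?J x)" for x
  have J: "?J x > 0" if "x \<in> {-1<..<1}" for x by (rule jacobi_factor_pos[OF that])
  have F: "poly F x \<noteq> 0" if "x \<in> {-1<..<1}" for x using z[OF that] entry_positive(2)[OF that] by auto
  have \<rho>: "poly [:1, 0, -1:] x = 1 - x\<^sup>2" for x :: real by (simp add: power2_eq_square)
  have \<rho>0: "1 - x\<^sup>2 \<noteq> 0" if "x \<in> {-1<..<1}" for x :: real using interval_pos[OF that] by simp
  have zQ: "\<exists>p q. \<forall>x\<in>{-1<..<1}. poly q x \<noteq> 0 \<and> z x / ?J x = poly p x / poly q x"
  proof (intro exI ballI conjI)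
    fix x :: real assume x: "x \<in> {-1<..<1}"
    show "poly [:1, 0, -1:] x \<noteq> 0" unfolding \<rho> by (rule \<rho>0[OF x])
    show "z x / ?J x = poly (smult c F) x / poly [:1, 0, -1:] x" unfolding z[OF x] \<rho> using J[OF x] by simp
  qed
  have vQ: "\<exists>p q. \<forall>x\<in>{-1<..<1}. poly q x \<noteq> 0 \<and> v x / ?J x = poly p x / poly q x"
  proof (intro exI ballI conjI)
    fix x :: real assume x: "x \<in> {-1<..<1}"
    show "poly [:1, 0, -1:] x \<noteq> 0" unfolding \<rho> by (rule \<rho>0[OF x])
    show "v x / ?J x = poly (smult c E) x / poly [:1, 0, -1:] x" unfolding v[OF x] \<rho> using J[OF x] by simp
  qed
  have uQ: "\<exists>p q. \<forall>x\<in>{-1<..<1}. poly q x \<noteq> 0 \<and> u x / ?J x = poly p x / poly q x"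
  proof (intro exI ballI conjI)
    fix x :: real assume x: "x \<in> {-1<..<1}"
    define R j where "R = 1 - x\<^sup>2" and "j = ?J x"
    have R: "R \<noteq> 0" "j \<noteq> 0" using \<rho>0[OF x] J[OF x] by (simp_all add: R_def j_def)
    have Rv: "R * v x = c * j * poly E x" and Rz: "R * z x = c * j * poly F x"
      unfolding v[OF x] z[OF x] R_def[symmetric] j_def[symmetric] using R by simp_all
    have Rd: "R\<^sup>2 * (u x * z x - (v x)\<^sup>2) = c\<^sup>2 * j\<^sup>2 * poly \<delta> x"
      unfolding det[OF x] R_def[symmetric] j_def[symmetric] using R by simp
    have "(c * j) * (u x * poly F x * R) = R * u x * (R * z x)" unfolding Rz by (simp only: mult_ac)
    also have "\<dots> = R\<^sup>2 * (u x * z x - (v x)\<^sup>2) + (R * v x)\<^sup>2" by algebra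
    also have "\<dots> = (c * j) * (c * j * (poly \<delta> x + (poly E x)\<^sup>2))" unfolding Rd Rv by algebra
    finally have "u x * poly F x * R = c * j * (poly \<delta> x + (poly E x)\<^sup>2)"
      by (rule mult_left_cancel[THEN iffD1, rotated]) (use c R in simp)
    then have "u x / j = c * (poly \<delta> x + (poly E x)\<^sup>2) / (R * poly F x)"
      using R F[OF x] by (simp add: divide_eq_eq eq_divide_eq mult_ac)
    then show "u x / ?J x = poly (smult c (\<delta> + E\<^sup>2)) x / poly ([:1, 0, -1:] * F) x"
      unfolding poly_mult \<rho> j_def R_def by simp
    show "poly ([:1, 0, -1:] * F) x \<noteq> 0" unfolding poly_mult \<rho> using \<rho>0[OF x] F[OF x] by simp
  qed
  have "rational_on_interval Q"
    unfolding rational_on_interval_def forall_2 Q_def mat2_nth by (intro conjI uQ vQ zQ)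
  moreover have "transpose (Q x) = Q x" for x by (rule mat2_eqI) (simp_all add: transpose_def Q_def)
  moreover have "weight_of_form W l g \<sigma>m \<sigma>p Q"
    unfolding weight_of_form_def
  proof
    fix x :: real assume x: "x \<in> {-1<..<1}"
    show "W x = ?J x *\<^sub>R cmat (Q x)"
      unfolding W_eq Q_def by (rule mat2_eqI) (use J[OF x] in \<open>simp_all only: scaleR_cmat_nth cmat_nth mat2_nth, simp_all\<close>)
  qed
  ultimately show ?thesis by blast
qed

lemma det_of_trace:
  assumes tr: "A11$1$1 + A11$2$2 = 2 * l" "A10$1$1 + A10$2$2 = - 2 * g"
  shows "\<exists>U. invertible U \<and> (\<forall>x\<in>{-1<..<1}. det (conj_weight U W x)
          = complex_of_real ((1 - x) powr (- l - 2 + g) * (1 + x) powr (- l - 2 - g)))"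
proof -
  obtain c where c: "c > 0" "\<And>x. x \<in> {-1<..<1} \<Longrightarrow>
    (1 - x\<^sup>2) * u x * ((1 - x\<^sup>2) * z x) - ((1 - x\<^sup>2) * v x)\<^sup>2 = c * ((1 - x) powr (- l + g) * (1 + x) powr (- l - g))"
    using det_G[OF tr] by blast
  define \<alpha> where "\<alpha> = 1 / sqrt c"
  have \<alpha>: "\<alpha> \<noteq> 0" "\<alpha>\<^sup>2 * c = 1" using c(1) by (simp_all add: \<alpha>_def power_divide)
  have "det (conj_weight (cmat (mat2 \<alpha> 0 0 1)) W x)
      = complex_of_real ((1 - x) powr (- l - 2 + g) * (1 + x) powr (- l - 2 - g))" if x: "x \<in> {-1<..<1}" for x
  proof -
    have p: "0 < 1 - x" "0 < 1 + x" using x by auto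
    have e: "- l + g = (- l - 2 + g) + 2" "- l - g = (- l - 2 - g) + 2" by auto
    have "(1 - x\<^sup>2)\<^sup>2 * (u x * z x - (v x)\<^sup>2) = c * ((1 - x) powr ((- l - 2 + g) + 2) * (1 + x) powr ((- l - 2 - g) + 2))"
      using c(2)[OF x] unfolding e[symmetric] by (simp add: power2_eq_square algebra_simps)
    also have "\<dots> = (1 - x\<^sup>2)\<^sup>2 * (c * ((1 - x) powr (- l - 2 + g) * (1 + x) powr (- l - 2 - g)))"
    proof -
      have "(1 - x\<^sup>2)\<^sup>2 = (1 - x)\<^sup>2 * (1 + x)\<^sup>2" by (simp add: power2_eq_square algebra_simps)
      moreover have "y powr (w + 2) = y powr w * y\<^sup>2" if "0 < y" for y w :: real
        using that by (simp add: powr_add)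
      ultimately show ?thesis by (simp only: p mult_ac)
    qed
    finally have d: "u x * z x - (v x)\<^sup>2 = c * ((1 - x) powr (- l - 2 + g) * (1 + x) powr (- l - 2 - g))"
      by (rule mult_left_cancel[THEN iffD1, rotated]) (use interval_pos[OF x] in simp)
    have "det (conj_weight (cmat (mat2 \<alpha> 0 0 1)) W x) = complex_of_real (\<alpha>\<^sup>2 * (u x * z x - (v x)\<^sup>2))"
      unfolding W_eq diagonal_conjugation det_2 by (simp add: power2_eq_square algebra_simps)
    also have "\<alpha>\<^sup>2 * (u x * z x - (v x)\<^sup>2) = (1 - x) powr (- l - 2 + g) * (1 + x) powr (- l - 2 - g)"
      unfolding d using \<alpha>(2) by (simp flip: mult.assoc)
    finally show ?thesis .
  qed
  then show ?thesis using invertible_diagonal[OF \<alpha>(1), of 1] by (intro exI[of _ "cmat (mat2 \<alpha> 0 0 1)"]) simp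
qed

text \<open>
  With a constant term $\mathrm{diag}(a,-a)$, $a \neq 0$, the zeroth moment is diagonal, so that
  the quotient \<open>B\<close> of the first two moments gives the first moments of the entries.
\<close>
lemma moments:
  assumes a: "a \<noteq> 0" and B: "moment W 1 ** matrix_inv (moment W 0) = cmat B"
  obtains m1 m2 where "m1 > 0" and "m2 > 0"
    and "(u has_integral m1) {-1..1}" and "(z has_integral m2) {-1..1}" 
    and "((\<lambda>x. x * z x) has_integral B$2$2 * m2) {-1..1}" and "((\<lambda>x. x * v x) has_integral B$1$2 * m2) {-1..1}"
    and "B$1$2 * m2 = B$2$1 * m1"
proof -
  have int: "integrable lborel (\<lambda>x. x ^ n *\<^sub>R W x)" for n
    using weight by (simp add: weight_matrix_def)
  have mom: "moment W n $ i $ k = (LINT x|lborel. x ^ n *\<^sub>R (W x $ i $ k))" for n i k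
    unfolding moment_def integral_matrix_nth[OF int] by simp
  have fe: "f = u \<or> f = v \<or> f = z \<Longrightarrow> integrable lborel (\<lambda>x. x ^ n * f x)" for f :: "real \<Rightarrow> real" and n :: nat
    using entry_lborel entry_support by (intro integrable_continuous_mult_supported) (auto intro!: continuous_intros)
  define I where "I f n = (LINT x|lborel. x ^ n * f x)" for f :: "real \<Rightarrow> real" and n :: nat
  have hi: "((\<lambda>x. x ^ n * f x) has_integral I f n) {-1..1}" if "f = u \<or> f = v \<or> f = z" for f n
    unfolding I_def by (rule supported_integrable_Icc(2)[OF fe[OF that]]) (use that entry_support in auto)
  have lint: "(LINT x|lborel. x ^ n *\<^sub>R complex_of_real (f x)) = complex_of_real (I f n)" for f n
    unfolding I_def integral_complex_of_real[symmetric] by (intro Bochner_Integration.integral_cong HOL.refl) (simp add: scaleR_conv_of_real)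
  have we: "W x $ 1 $ 1 = complex_of_real (u x)" "W x $ 1 $ 2 = complex_of_real (v x)"
    "W x $ 2 $ 1 = complex_of_real (v x)" "W x $ 2 $ 2 = complex_of_real (z x)" for x
    by (simp_all add: W_eq)
  have me: "moment W n $ 1 $ 1 = complex_of_real (I u n)" "moment W n $ 1 $ 2 = complex_of_real (I v n)"
    "moment W n $ 2 $ 1 = complex_of_real (I v n)" "moment W n $ 2 $ 2 = complex_of_real (I z n)" for n
    by (simp_all only: mom we lint)
  have "((\<lambda>x. 4 * a * v x) has_integral 0) {-1..1}"
    by (rule has_integral_zero_of_vanishing_primitive[OF dj right_limits(4) left_limits(4)])
  moreover have "((\<lambda>x. 4 * a * v x) has_integral 4 * a * I v 0) {-1..1}"
    using has_integral_mult_right[OF hi[of v 0], of "4 * a"] by simp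
  ultimately have "4 * a * I v 0 = 0" by (rule has_integral_unique[symmetric])
  then have v0: "I v 0 = 0" using a by simp
  have pos: "I f 0 > 0" if f: "f = u \<or> f = z" for f
  proof -
    have h: "(f has_integral I f 0) {-1..1}" using hi[of f 0] f by auto
    have nn: "0 \<le> f x" for x using entry_positive(1,2)[of x] entry_support[of x] f by (cases "x \<in> {-1<..<1}") auto
    have "I f 0 \<noteq> 0"
    proof
      assume "I f 0 = 0"
      then have "(f has_integral 0) {-1..1}" using h by simp
      then have "(1::real) = 0"
        by (rule has_integral_zero_positive_multiple[of f _ f]) (use f entry_positive entry_continuous in auto)
      then show False by simp
    qed
    moreover have "0 \<le> I f 0" by (rule has_integral_nonneg[OF h]) (rule nn)
    ultimately show ?thesis by simp
  qed
  have nz: "complex_of_real (I u 0) \<noteq> 0" "complex_of_real (I z 0) \<noteq> 0" using pos[of u] pos[of z] by auto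
  have "moment W 0 = cmat (mat2 (I u 0) 0 0 (I z 0))"
    by (rule mat2_eqI) (simp_all add: me v0)
  then have inv: "invertible (moment W 0)" using invertible_diagonal nz by simp
  have "moment W 1 = (moment W 1 ** matrix_inv (moment W 0)) ** moment W 0"
    by (simp add: matrix_inv_inverse(2)[OF inv] flip: matrix_mul_assoc)
  then have M: "moment W 1 = cmat B ** moment W 0" unfolding B .
  have e: "complex_of_real (I v 1) = complex_of_real (B$1$2 * I z 0)" "complex_of_real (I v 1) = complex_of_real (B$2$1 * I u 0)"
    "complex_of_real (I z 1) = complex_of_real (B$2$2 * I z 0)"
    using arg_cong[OF M, of "\<lambda>A. A $ 1 $ 2"] arg_cong[OF M, of "\<lambda>A. A $ 2 $ 1"] arg_cong[OF M, of "\<lambda>A. A $ 2 $ 2"]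
    unfolding matrix_mult_2_nth me by (simp_all add: v0)
  show thesis
  proof (rule that[of "I u 0" "I z 0"])
    show "((\<lambda>x. x * z x) has_integral B$2$2 * I z 0) {-1..1}" using hi[of z 1] e(3) by (simp only: of_real_eq_iff) simp
    show "((\<lambda>x. x * v x) has_integral B$1$2 * I z 0) {-1..1}" using hi[of v 1] e(1) by (simp only: of_real_eq_iff) simp
    show "B$1$2 * I z 0 = B$2$1 * I u 0" using e(1,2) by (simp only: of_real_eq_iff)
  qed (use pos hi[of u 0] hi[of z 0] in auto)
qed

end

section \<open>Coordinates, determinant and the first family\<close>

lemma A11_of_nth [simp]:
  "A11_of b c d l $ 1 $ 1 = l + d" "A11_of b c d l $ 1 $ 2 = b + c"
  "A11_of b c d l $ 2 $ 1 = b - c" "A11_of b c d l $ 2 $ 2 = l - d"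
  by (simp_all add: A11_of_def)

lemma A10_of_nth:
  fixes b c d l a B11 B12 B21 B22 :: real
  defines "A10 \<equiv> A10_of (A11_of b c d l) (A0_of a) (mat2 B11 B12 B21 B22)"
  shows "A10 $ 1 $ 1 = - ((l + d) * B11 + (b + c) * B21)"
    and "A10 $ 1 $ 2 = - 2 * a * B12 - ((l + d) * B12 + (b + c) * B22)"
    and "A10 $ 2 $ 1 = 2 * a * B21 - ((b - c) * B11 + (l - d) * B21)"
    and "A10 $ 2 $ 2 = - ((b - c) * B12 + (l - d) * B22)"
  by (simp_all add: A10_def A10_of_def A0_of_def matrix_mult_2_nth)

lemma gamma_of_eq:
  "gamma_of (A11_of b c d l) (mat2 B11 B12 B21 B22) = 1 / 2 * ((l + d) * B11 + (b + c) * B21 + (b - c) * B12 + (l - d) * B22)"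
  by (simp add: gamma_of_def trace_def sum_2 matrix_mult_2_nth)

text \<open>
  An irreducible real pair with given coordinates. In the notation of \<open>real_weight\<close> the
  first-order coefficients are now functions of the coordinates.
\<close>
locale coordinates = real_weight W D "A11_of b c d l" "A10_of (A11_of b c d l) (A0_of a) (mat2 B11 B12 B21 B22)" a u v z
  for W D b c d l B11 B12 B21 B22 a u v z +
  fixes g :: real
  assumes irreducible: "\<not> reducible_pair W D"
    and quotient: "moment W 1 ** matrix_inv (moment W 0) = cmat (mat2 B11 B12 B21 B22)"
    and g: "g = 1 / 2 * ((l + d) * B11 + (b + c) * B21 + (b - c) * B12 + (l - d) * B22)"
begin

abbreviation "J \<equiv> jacobi_factor l g"

lemma a_nonzero:
  assumes "b + c \<noteq> 0 \<or> - 2 * a * B12 - ((l + d) * B12 + (b + c) * B22) \<noteq> 0"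
  shows "a \<noteq> 0"
  using reducible_of_zero_constant_term irreducible assms by (auto simp: A10_of_nth)

abbreviation "jj \<equiv> \<lambda>x. (A11_of b c d l$1$2 * x + A10_of (A11_of b c d l) (A0_of a) (mat2 B11 B12 B21 B22)$1$2) * z x
      - (A11_of b c d l$2$1 * x + A10_of (A11_of b c d l) (A0_of a) (mat2 B11 B12 B21 B22)$2$1) * u x
      + ((A11_of b c d l$1$1 * x + A10_of (A11_of b c d l) (A0_of a) (mat2 B11 B12 B21 B22)$1$1)
        - (A11_of b c d l$2$2 * x + A10_of (A11_of b c d l) (A0_of a) (mat2 B11 B12 B21 B22)$2$2)) * v x"

text \<open>
  If \<open>j\<close> vanished identically, then so would \<open>v\<close>, contrary to \<open>off_diagonal_not_zero\<close> or to
  $\int xv = B_{12}\int z$.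
\<close>
lemma j_nonzero:
  assumes a: "a \<noteq> 0" and nd: "b + c \<noteq> 0 \<or> B12 \<noteq> 0"
  shows "\<exists>x0. x0 \<in> {-1<..<1} \<and> jj x0 \<noteq> 0"
proof (rule ccontr)
  assume "\<not> ?thesis"
  then have j0: "jj x = 0" if "x \<in> {-1<..<1}" for x using that by blast
  have v0: "v x = 0" if x: "x \<in> {-1<..<1}" for x
  proof -
    have "(jj has_real_derivative 0) (at x)"
      by (rule has_field_derivative_transform_within_open[OF DERIV_const[of 0] open_greaterThanLessThan x]) (simp only: j0)
    then have "4 * a * v x = 0" using dj[OF x] DERIV_unique by blast
    then show ?thesis using a by simp
  qed
  have V0: "(1 - x\<^sup>2) * v x = 0" if "x \<in> {-1<..<1}" for x using v0[OF that] by simp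
  show False
  proof (cases "b + c = 0")
    case False
    show False by (rule off_diagonal_not_zero[OF _ V0 j0]) (use False in simp_all)
  next
    case True
    then have B12: "B12 \<noteq> 0" using nd by simp
    obtain m1 m2 where m: "m2 > 0" "((\<lambda>x. x * v x) has_integral mat2 B11 B12 B21 B22$1$2 * m2) {-1..1}"
      using moments[OF a quotient] by blast
    have "x * v x = 0" for x using v0[of x] entry_support(2)[of x] by (cases "x \<in> {-1<..<1}") auto
    then have "(\<lambda>x. x * v x) = (\<lambda>_. 0)" by (rule ext)
    then have "((\<lambda>_ :: real. 0 :: real) has_integral B12 * m2) {-1..1}" using m(2) by (simp only: mat2_nth)
    then have "B12 * m2 = 0" using has_integral_0 has_integral_unique by blast
    then show False using m(1) B12 by simp
  qed
qed

lemma divide_interval: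
  fixes x y w :: real
  assumes "x \<in> {-1<..<1}" and "(1 - x\<^sup>2) * y = w"
  shows "y = w / (1 - x\<^sup>2)"
  using assms interval_pos[OF assms(1)] by (simp add: field_simps)

lemma det_divide_interval:
  fixes x w :: real
  assumes "x \<in> {-1<..<1}" and "(1 - x\<^sup>2) * u x * ((1 - x\<^sup>2) * z x) - ((1 - x\<^sup>2) * v x)\<^sup>2 = w"
  shows "u x * z x - (v x)\<^sup>2 = w / (1 - x\<^sup>2)\<^sup>2"
proof -
  have "(1 - x\<^sup>2)\<^sup>2 * (u x * z x - (v x)\<^sup>2) = w" unfolding assms(2)[symmetric] by algebra
  moreover have "(1 - x\<^sup>2)\<^sup>2 \<noteq> 0" using interval_pos[OF assms(1)] by simp
  ultimately show ?thesis by (simp add: eq_divide_eq mult.commute)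
qed

lemma det_claim:
  "\<exists>U. invertible U \<and> (\<forall>x\<in>{-1<..<1}. det (conj_weight U W x)
          = complex_of_real ((1 - x) powr (- l - 2 + g) * (1 + x) powr (- l - 2 - g)))"
  by (rule det_of_trace) (simp_all add: A10_of_nth g)

text \<open>
  The abbreviation $h = \lambda(B_{11}-B_{22})/2$ equals $rB_{22}$ for $a \neq 1$, but is defined for
  $a = 1$ too.
\<close>
lemma family_I_solution:
  assumes F: "family_I (a, b, c, d, l, B11, B12, B21, B22)"
  defines "h \<equiv> l * (B11 - B22) / 2"
  obtains k where "k \<noteq> 0" and "2 * a + l \<noteq> 0" and "0 < ((l + 2)\<^sup>2 - 4 * a\<^sup>2) / (4 - h\<^sup>2)" and "g = a * h"
    and "\<And>x. x \<in> {-1<..<1} \<Longrightarrow> v x = k * J 0 0 x * (((l + 2) * x - g) / (1 - x\<^sup>2))"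
    and "\<And>x. x \<in> {-1<..<1} \<Longrightarrow> z x = - k * J 0 0 x * (((l + 2 - 2 * a) * (x\<^sup>2 + h * x + 1) + 4 * a - a * h\<^sup>2) / (2 * a + l) / (1 - x\<^sup>2))"
    and "\<And>x. x \<in> {-1<..<1} \<Longrightarrow> u x * z x - (v x)\<^sup>2 = k\<^sup>2 * (J 0 0 x)\<^sup>2 * (((l + 2)\<^sup>2 - 4 * a\<^sup>2) / (4 - h\<^sup>2))"
proof -
  have F': "b = 0" "c = 0" "d = 0" "B12 = 1" "(a - 1) * B11 = (a + 1) * B22"
    "B22\<^sup>2 * l\<^sup>2 = ((4 * a\<^sup>2 - l\<^sup>2) * B21 + 4) * (a - 1)\<^sup>2" using F by simp_all
  have a: "a \<noteq> 0"
  proof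
    assume a0: "a = 0"
    then have "l = 0" using a_nonzero F' by auto
    then show False using F'(6) a0 by simp
  qed
  obtain x0 where x0: "x0 \<in> {-1<..<1}" "jj x0 \<noteq> 0"
    using j_nonzero[OF a] F'(4) by auto
  have gl: "g = l * (B11 + B22) / 2" unfolding g F' by (simp add: algebra_simps)
  have gh: "g = a * h"
  proof -
    have "B11 + B22 = a * (B11 - B22)" using F'(5) by (simp add: algebra_simps)
    then show ?thesis unfolding gl h_def by simp
  qed
  have J: "J 0 0 x = (1 - x) powr (- l / 2 - 1 + g / 2) * (1 + x) powr (- l / 2 - 1 - g / 2)" for x
    by (simp add: jacobi_factor_def)
  obtain k where k: "k \<noteq> 0" "- 2 * a - l \<noteq> 0" "4 - h\<^sup>2 \<noteq> 0"
    and V: "\<And>x. x \<in> {-1<..<1} \<Longrightarrow> (1 - x\<^sup>2) * v x = k * J 0 0 x * ((l + 2) * x - g)"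
    and Z: "\<And>x. x \<in> {-1<..<1} \<Longrightarrow> (1 - x\<^sup>2) * z x = k * J 0 0 x
        * (((l + 2 - 2 * a) * (x\<^sup>2 + h * x + 1) + 4 * a - a * h\<^sup>2) / (- 2 * a - l))"
    and D: "\<And>x. x \<in> {-1<..<1} \<Longrightarrow> (1 - x\<^sup>2) * u x * ((1 - x\<^sup>2) * z x) - ((1 - x\<^sup>2) * v x)\<^sup>2
        = k\<^sup>2 * (J 0 0 x)\<^sup>2 * ((1 - x\<^sup>2)\<^sup>2 * ((l + 2)\<^sup>2 - 4 * a\<^sup>2) / (4 - h\<^sup>2))"
  proof (rule solution_family_I[of l g h x0, folded J])
    show "A10_of (A11_of b c d l) (A0_of a) (mat2 B11 B12 B21 B22) $ 1 $ 1 = - g - h"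
      "A10_of (A11_of b c d l) (A0_of a) (mat2 B11 B12 B21 B22) $ 2 $ 2 = - g + h"
      unfolding A10_of_nth gl h_def F' by (simp_all add: field_simps)
    show q: "A10_of (A11_of b c d l) (A0_of a) (mat2 B11 B12 B21 B22) $ 1 $ 2 = - 2 * a - l"
      unfolding A10_of_nth F' by simp
    fix k
    assume "k \<noteq> 0" "A10_of (A11_of b c d l) (A0_of a) (mat2 B11 B12 B21 B22) $ 1 $ 2 \<noteq> 0" "4 - h\<^sup>2 \<noteq> 0"
      and "\<And>x. x \<in> {-1<..<1} \<Longrightarrow> (1 - x\<^sup>2) * v x = k * J 0 0 x * ((l + 2) * x - g)"
      and "\<And>x. x \<in> {-1<..<1} \<Longrightarrow> (1 - x\<^sup>2) * z x = k * J 0 0 x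
        * (((l + 2 - 2 * a) * (x\<^sup>2 + h * x + 1) + 4 * a - a * h\<^sup>2) / A10_of (A11_of b c d l) (A0_of a) (mat2 B11 B12 B21 B22) $ 1 $ 2)"
      and "\<And>x. x \<in> {-1<..<1} \<Longrightarrow> (1 - x\<^sup>2) * u x * ((1 - x\<^sup>2) * z x) - ((1 - x\<^sup>2) * v x)\<^sup>2
        = k\<^sup>2 * (J 0 0 x)\<^sup>2 * ((1 - x\<^sup>2)\<^sup>2 * ((l + 2)\<^sup>2 - 4 * a\<^sup>2) / (4 - h\<^sup>2))"
    then show thesis unfolding q by (rule that)
  qed (use a gh x0 F' in simp_all)
  let ?S = "((l + 2)\<^sup>2 - 4 * a\<^sup>2) / (4 - h\<^sup>2)"
  have det: "u x * z x - (v x)\<^sup>2 = k\<^sup>2 * (J 0 0 x)\<^sup>2 * ?S" if x: "x \<in> {-1<..<1}" for x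
  proof -
    have "u x * z x - (v x)\<^sup>2 = k\<^sup>2 * (J 0 0 x)\<^sup>2 * ((1 - x\<^sup>2)\<^sup>2 * ((l + 2)\<^sup>2 - 4 * a\<^sup>2) / (4 - h\<^sup>2)) / (1 - x\<^sup>2)\<^sup>2"
      by (rule det_divide_interval[OF x D[OF x]])
    then show ?thesis using interval_pos[OF x] by simp
  qed
  have S: "0 < ?S"
  proof -
    have "0 < k\<^sup>2 * (J 0 0 0)\<^sup>2 * ?S" using det[of 0] entry_positive(3)[of 0] by simp
    moreover have "J 0 0 0 \<noteq> 0" using jacobi_factor_pos[of 0 l g 0 0] by simp
    then have "0 < k\<^sup>2 * (J 0 0 0)\<^sup>2" using k(1) by simp
    ultimately show ?thesis by (simp only: zero_less_mult_pos)
  qed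
  show thesis
  proof (rule that[OF k(1) _ S gh])
    show "2 * a + l \<noteq> 0" using k(2) by simp
    fix x :: real assume x: "x \<in> {-1<..<1}"
    show "v x = k * J 0 0 x * (((l + 2) * x - g) / (1 - x\<^sup>2))" using divide_interval[OF x V[OF x]] by simp
    define Y where "Y = (l + 2 - 2 * a) * (x\<^sup>2 + h * x + 1) + 4 * a - a * h\<^sup>2"
    have "- 2 * a - l = - (2 * a + l)" by simp
    then show "z x = - k * J 0 0 x * (((l + 2 - 2 * a) * (x\<^sup>2 + h * x + 1) + 4 * a - a * h\<^sup>2) / (2 * a + l) / (1 - x\<^sup>2))"
      using divide_interval[OF x Z[OF x]] unfolding Y_def[symmetric] by (simp only: divide_minus_right) simp
    show "u x * z x - (v x)\<^sup>2 = k\<^sup>2 * (J 0 0 x)\<^sup>2 * ?S" by (rule det[OF x])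
  qed
qed

lemma family_I_rational:
  assumes F: "family_I (a, b, c, d, l, B11, B12, B21, B22)"
  shows "\<exists>Q. rational_on_interval Q \<and> (\<forall>x\<in>{-1<..<1}. transpose (Q x) = Q x) \<and> weight_of_form W l g 0 0 Q"
proof -
  define h where "h = l * (B11 - B22) / 2"
  define S where "S = ((l + 2)\<^sup>2 - 4 * a\<^sup>2) / (4 - h\<^sup>2)"
  obtain k where k: "k \<noteq> 0" "2 * a + l \<noteq> 0"
    "\<And>x. x \<in> {-1<..<1} \<Longrightarrow> v x = k * J 0 0 x * (((l + 2) * x - g) / (1 - x\<^sup>2))"
    "\<And>x. x \<in> {-1<..<1} \<Longrightarrow> z x = - k * J 0 0 x * (((l + 2 - 2 * a) * (x\<^sup>2 + h * x + 1) + 4 * a - a * h\<^sup>2) / (2 * a + l) / (1 - x\<^sup>2))"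
    "\<And>x. x \<in> {-1<..<1} \<Longrightarrow> u x * z x - (v x)\<^sup>2 = k\<^sup>2 * (J 0 0 x)\<^sup>2 * S"
    using family_I_solution[OF F, folded h_def, folded S_def] by metis
  show ?thesis
  proof (rule rational_of_solution[OF k(1), of l g 0 0 "[:- g, l + 2:]"
      "smult (- 1 / (2 * a + l)) [:l + 2 - 2 * a + 4 * a - a * h\<^sup>2, (l + 2 - 2 * a) * h, l + 2 - 2 * a:]" "smult S ([:1, 0, -1:]\<^sup>2)"])
    fix x :: real assume x: "x \<in> {-1<..<1}"
    show "v x = k * J 0 0 x * (poly [:- g, l + 2:] x / (1 - x\<^sup>2))" unfolding k(3)[OF x] by (simp add: mult_ac)
    have "poly [:l + 2 - 2 * a + 4 * a - a * h\<^sup>2, (l + 2 - 2 * a) * h, l + 2 - 2 * a:] x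
      = (l + 2 - 2 * a) * (x\<^sup>2 + h * x + 1) + 4 * a - a * h\<^sup>2"
      by (simp add: algebra_simps power2_eq_square)
    then have "poly (smult (- 1 / (2 * a + l)) [:l + 2 - 2 * a + 4 * a - a * h\<^sup>2, (l + 2 - 2 * a) * h, l + 2 - 2 * a:]) x
      = - (((l + 2 - 2 * a) * (x\<^sup>2 + h * x + 1) + 4 * a - a * h\<^sup>2) / (2 * a + l))"
      by (simp only: poly_smult) simp
    then show "z x = k * J 0 0 x * (poly (smult (- 1 / (2 * a + l)) [:l + 2 - 2 * a + 4 * a - a * h\<^sup>2, (l + 2 - 2 * a) * h, l + 2 - 2 * a:]) x / (1 - x\<^sup>2))"
      unfolding k(4)[OF x] by simp
    have "poly (smult S ([:1, 0, -1:]\<^sup>2)) x = S * (1 - x\<^sup>2)\<^sup>2" by (simp add: power2_eq_square algebra_simps)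
    moreover have "(1 - x\<^sup>2)\<^sup>2 \<noteq> 0" using interval_pos[OF x] by simp
    then have "S * (1 - x\<^sup>2)\<^sup>2 / (1 - x\<^sup>2)\<^sup>2 = S" by (rule nonzero_mult_div_cancel_right)
    ultimately show "u x * z x - (v x)\<^sup>2 = k\<^sup>2 * (J 0 0 x)\<^sup>2 * (poly (smult S ([:1, 0, -1:]\<^sup>2)) x / (1 - x\<^sup>2)\<^sup>2)"
      unfolding k(5)[OF x] by (simp only:)
  qed
qed

lemma family_I_form:
  assumes F: "family_I (a, b, c, d, l, B11, B12, B21, B22)" and a1: "a \<noteq> 1"
  shows "let r = l / (a - 1) in
          g = a * r * B22
          \<and> D = hyp_op
              (cmat (mat2 l 0 0 l))
              (cmat (mat2 (- B22 * l * ((a + 1) / (a - 1))) (- 2 * a - l)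
                          (1 / (2 * a + l) * (B22\<^sup>2 * (l\<^sup>2 / (a - 1)\<^sup>2) - 4)) (- B22 * l)))
              (cmat (mat2 a 0 0 (- a)))
          \<and> (\<exists>s. s\<^sup>2 = (r - 2) * (a - 1) * ((r + 2) * a - (r - 2)) / (4 - r\<^sup>2 * B22\<^sup>2)
                \<and> similar_to_form W l g 0 0 (Q_I a r B22 s))"
proof -
  define r where "r = l / (a - 1)"
  have F': "b = 0" "c = 0" "d = 0" "B12 = 1" "(a - 1) * B11 = (a + 1) * B22"
    "B22\<^sup>2 * l\<^sup>2 = ((4 * a\<^sup>2 - l\<^sup>2) * B21 + 4) * (a - 1)\<^sup>2" using F by simp_all
  have a1': "a - 1 \<noteq> 0" using a1 by simp
  have lr: "l = r * (a - 1)" using a1' by (simp add: r_def)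
  have B11: "B11 = B22 * ((a + 1) / (a - 1))" using F'(5) a1' by (simp add: field_simps)
  define h where "h = l * (B11 - B22) / 2"
  have h: "h = r * B22" unfolding h_def lr B11 using a1' by (simp add: field_simps)
  obtain k where k: "k \<noteq> 0" "2 * a + l \<noteq> 0" "0 < ((l + 2)\<^sup>2 - 4 * a\<^sup>2) / (4 - h\<^sup>2)" "g = a * h"
    "\<And>x. x \<in> {-1<..<1} \<Longrightarrow> v x = k * J 0 0 x * (((l + 2) * x - g) / (1 - x\<^sup>2))"
    "\<And>x. x \<in> {-1<..<1} \<Longrightarrow> z x = - k * J 0 0 x * (((l + 2 - 2 * a) * (x\<^sup>2 + h * x + 1) + 4 * a - a * h\<^sup>2) / (2 * a + l) / (1 - x\<^sup>2))"
    "\<And>x. x \<in> {-1<..<1} \<Longrightarrow> u x * z x - (v x)\<^sup>2 = k\<^sup>2 * (J 0 0 x)\<^sup>2 * (((l + 2)\<^sup>2 - 4 * a\<^sup>2) / (4 - h\<^sup>2))"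
    using family_I_solution[OF F, folded h_def] by metis
  have D: "D = hyp_op (cmat (mat2 l 0 0 l))
              (cmat (mat2 (- B22 * l * ((a + 1) / (a - 1))) (- 2 * a - l)
                          (1 / (2 * a + l) * (B22\<^sup>2 * (l\<^sup>2 / (a - 1)\<^sup>2) - 4)) (- B22 * l)))
              (cmat (mat2 a 0 0 (- a)))"
  proof -
    have "A11_of b c d l = mat2 l 0 0 l" by (rule mat2_eqI) (simp_all add: F')
    moreover have "B22\<^sup>2 * (l\<^sup>2 / (a - 1)\<^sup>2) - 4 = (4 * a\<^sup>2 - l\<^sup>2) * B21"
      using F'(6) a1' by (simp add: field_simps)
    then have "B22\<^sup>2 * (l\<^sup>2 / (a - 1)\<^sup>2) - 4 = (2 * a + l) * ((2 * a - l) * B21)" by algebra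
    then have e21: "1 / (2 * a + l) * (B22\<^sup>2 * (l\<^sup>2 / (a - 1)\<^sup>2) - 4) = (2 * a - l) * B21"
      using k(2) by simp
    have e11: "- B22 * l * ((a + 1) / (a - 1)) = - (l * B11)" unfolding B11 by simp
    have "A10_of (A11_of b c d l) (A0_of a) (mat2 B11 B12 B21 B22)
      = mat2 (- B22 * l * ((a + 1) / (a - 1))) (- 2 * a - l) (1 / (2 * a + l) * (B22\<^sup>2 * (l\<^sup>2 / (a - 1)\<^sup>2) - 4)) (- B22 * l)"
      unfolding e11 e21 by (intro mat2_eqI) (simp_all add: A10_of_nth F' algebra_simps)
    ultimately show ?thesis unfolding D_eq by (simp only: A0_of_def)
  qed
  have S: "((l + 2)\<^sup>2 - 4 * a\<^sup>2) / (4 - h\<^sup>2) = (r - 2) * (a - 1) * ((r + 2) * a - (r - 2)) / (4 - r\<^sup>2 * B22\<^sup>2)"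
  proof -
    have "(l + 2)\<^sup>2 - 4 * a\<^sup>2 = (r - 2) * (a - 1) * ((r + 2) * a - (r - 2))" unfolding lr by algebra
    then show ?thesis unfolding h by (simp only: power_mult_distrib)
  qed
  obtain s where s: "s\<^sup>2 = ((l + 2)\<^sup>2 - 4 * a\<^sup>2) / (4 - h\<^sup>2)" "s \<noteq> 0"
    and sim: "similar_to_form W l g 0 0 (\<lambda>x. sym_with_det 1 (1 / ((1 - x\<^sup>2) * s) * ((l + 2) * x - g))
       (1 / ((1 - x\<^sup>2) * s) * (((l + 2 - 2 * a) * (x\<^sup>2 + h * x + 1) + 4 * a - a * h\<^sup>2) / (2 * a + l))))"
    using similar_of_solution[OF k(1) _ k(3), of "- 1" l g 0 0 "\<lambda>x. (l + 2) * x - g"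
        "\<lambda>x. ((l + 2 - 2 * a) * (x\<^sup>2 + h * x + 1) + 4 * a - a * h\<^sup>2) / (2 * a + l)" "\<lambda>_. 1"] k(5-7) by (auto simp: mult_ac)
  have "(\<lambda>x. sym_with_det 1 (1 / ((1 - x\<^sup>2) * s) * ((l + 2) * x - g))
       (1 / ((1 - x\<^sup>2) * s) * (((l + 2 - 2 * a) * (x\<^sup>2 + h * x + 1) + 4 * a - a * h\<^sup>2) / (2 * a + l)))) = Q_I a r B22 s"
  proof
    fix x
    have "(l + 2) * x - g = - a * r * B22 + a * r * x - (r - 2) * x"
      unfolding k(4) h lr by (simp add: algebra_simps)
    moreover have "(l + 2 - 2 * a) * (x\<^sup>2 + h * x + 1) + 4 * a - a * h\<^sup>2
      = - r\<^sup>2 * a * B22\<^sup>2 + (a - 1) * (r * (r - 2) * B22 * x + (r - 2) * (x\<^sup>2 + 1)) + 4 * a"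
      unfolding h lr by algebra
    moreover have "2 * a + l = (a - 1) * r + 2 * a" unfolding lr by algebra
    ultimately show "sym_with_det 1 (1 / ((1 - x\<^sup>2) * s) * ((l + 2) * x - g))
       (1 / ((1 - x\<^sup>2) * s) * (((l + 2 - 2 * a) * (x\<^sup>2 + h * x + 1) + 4 * a - a * h\<^sup>2) / (2 * a + l))) = Q_I a r B22 s x"
      unfolding Q_I_def by (simp only:)
  qed
  then have sim': "similar_to_form W l g 0 0 (Q_I a r B22 s)" using sim by (simp only:)
  show ?thesis unfolding Let_def r_def[symmetric]
    using D s(1) sim' S k(4) h by (intro conjI exI[of _ s]) (simp_all only: mult.assoc)
qed

end

section \<open>The second family in coordinates\<close>

context coordinates
begin

lemma scale_positive:
  assumes k: "k \<noteq> 0" and det: "u 0 * z 0 - (v 0)\<^sup>2 = k\<^sup>2 * (J \<sigma>m \<sigma>p 0)\<^sup>2 * S"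
  shows "0 < S"
proof -
  have "0 < k\<^sup>2 * (J \<sigma>m \<sigma>p 0)\<^sup>2 * S" using det entry_positive(3)[of 0] by simp
  moreover have "J \<sigma>m \<sigma>p 0 \<noteq> 0" using jacobi_factor_pos[of 0 l g \<sigma>m \<sigma>p] by simp
  then have "0 < k\<^sup>2 * (J \<sigma>m \<sigma>p 0)\<^sup>2" using k by simp
  ultimately show ?thesis by (simp only: zero_less_mult_pos)
qed

lemma family_II_coefficients:
  assumes F: "family_II (a, b, c, d, l, B11, B12, B21, B22)"
  defines "m \<equiv> (4 * a - 2 * l - 1) * B21" and "A10 \<equiv> A10_of (A11_of b c d l) (A0_of a) (mat2 B11 B12 B21 B22)"
  shows "A10 $ 1 $ 1 = (l - 1/2) + (2 * a + 1) * m - 4 * a" and "A10 $ 1 $ 2 = 6 - 2 * m"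
    and "A10 $ 2 $ 1 = m / 2" and "A10 $ 2 $ 2 = (l + 1/2) + (2 * a - 1) * m - 4 * a + 2"
    and "g = 4 * a - l - 1 - 2 * a * m"
proof -
  have F': "b = 1" "c = 1" "d = - (1/2)" "2 * l - 1 \<noteq> 0" "2 * l + 1 \<noteq> 0" using F by simp_all
  define w1 w2 where "w1 = (1 - 2 * a * B21) / (2 * l - 1)" and "w2 = (1 - 2 * a * B21) / (2 * l + 1)"
  have w: "(2 * l - 1) * w1 = 1 - 2 * a * B21" "(2 * l + 1) * w2 = 1 - 2 * a * B21"
    using F'(4,5) by (simp_all add: w1_def w2_def)
  have B: "B11 = (4 * a + 2) * B21 - 1 + 8 * a * w1" "B22 = (4 * a - 2) * B21 - 1 + (8 * a - 4) * w2" "B12 = - 4 * B21 - 8 * w2"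
    using F unfolding w1_def w2_def by simp_all
  have p: "2 * (A10 $ 1 $ 1) = (2 * l - 1) + 2 * (2 * a + 1) * m - 8 * a"
  proof -
    have "2 * (A10 $ 1 $ 1) = - ((2 * l - 1) * B11 + 4 * B21)"
      unfolding A10_def A10_of_nth F' by (simp add: algebra_simps)
    also have "\<dots> = - ((2 * l - 1) * ((4 * a + 2) * B21 - 1) + 8 * a * ((2 * l - 1) * w1) + 4 * B21)"
      unfolding B(1) by (simp add: algebra_simps)
    also have "\<dots> = (2 * l - 1) + 2 * (2 * a + 1) * m - 8 * a"
      unfolding w(1) m_def by (simp add: algebra_simps)
    finally show ?thesis .
  qed
  then show p0: "A10 $ 1 $ 1 = (l - 1/2) + (2 * a + 1) * m - 4 * a" by (simp add: field_simps)
  have "A10 $ 1 $ 2 = - ((2 * a + l - 1/2) * B12 + 2 * B22)"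
    unfolding A10_def A10_of_nth F' by (simp add: algebra_simps)
  also have "\<dots> = (4 * l + 2 - 8 * a + 0) * B21 + 2 + 4 * ((2 * l + 1) * w2) + 8 * a * B21"
    unfolding B(2,3) by (simp add: algebra_simps)
  also have "\<dots> = 6 - 2 * m" unfolding w(2) m_def by (simp add: algebra_simps)
  finally show "A10 $ 1 $ 2 = 6 - 2 * m" .
  show "A10 $ 2 $ 1 = m / 2" unfolding A10_def A10_of_nth F' m_def by (simp add: field_simps)
  have t: "2 * (A10 $ 2 $ 2) = (2 * l + 1) + 2 * (2 * a - 1) * m - 8 * a + 4"
  proof -
    have "2 * (A10 $ 2 $ 2) = - ((2 * l + 1) * B22)"
      unfolding A10_def A10_of_nth F' by (simp add: algebra_simps)
    also have "\<dots> = - ((2 * l + 1) * ((4 * a - 2) * B21 - 1) + (8 * a - 4) * ((2 * l + 1) * w2))"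
      unfolding B(2) by (simp add: algebra_simps)
    also have "\<dots> = (2 * l + 1) + 2 * (2 * a - 1) * m - 8 * a + 4"
      unfolding w(2) m_def by (simp add: algebra_simps)
    finally show ?thesis .
  qed
  then show t0: "A10 $ 2 $ 2 = (l + 1/2) + (2 * a - 1) * m - 4 * a + 2" by (simp add: field_simps)
  have "2 * g = - (A10 $ 1 $ 1 + A10 $ 2 $ 2)"
    unfolding A10_def A10_of_nth g by (simp add: algebra_simps)
  then show "g = 4 * a - l - 1 - 2 * a * m"
    unfolding p0 t0 by (simp add: algebra_simps)
qed

lemma family_II_solution:
  assumes F: "family_II (a, b, c, d, l, B11, B12, B21, B22)"
  defines "m \<equiv> (4 * a - 2 * l - 1) * B21"
  obtains k where "k \<noteq> 0" and "0 < a * (2 * l + 3 - 4 * a) / m"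
    and "\<And>x. x \<in> {-1<..<1} \<Longrightarrow> v x = k * J 0 1 x * (((l + 3/2) * (x + 1) - 4 * a + 2 * a * m) / (1 - x\<^sup>2))"
    and "\<And>x. x \<in> {-1<..<1} \<Longrightarrow> z x = k * J 0 1 x * (((l + 3/2 - 2 * a) * (x + 1) + 2 * a * m) / 2 / (1 - x\<^sup>2))"
    and "\<And>x. x \<in> {-1<..<1} \<Longrightarrow> u x * z x - (v x)\<^sup>2 = k\<^sup>2 * (J 0 1 x)\<^sup>2 * (a * (2 * l + 3 - 4 * a) / m * (1 / (1 + x)))"
proof -
  have F': "b = 1" "c = 1" "d = - (1/2)" using F by simp_all
  note co = family_II_coefficients[OF F, folded m_def]
  have a: "a \<noteq> 0" using a_nonzero F' by simp
  obtain x0 where x0: "x0 \<in> {-1<..<1}" "jj x0 \<noteq> 0"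
    using j_nonzero[OF a] F' by auto
  have J: "J 0 1 x = (1 - x) powr (- l / 2 - 1 + g / 2) * (1 + x) powr (- l / 2 - 1 - g / 2 + 1 / 2)" for x
    by (simp add: jacobi_factor_def)
  obtain k where k: "k \<noteq> 0" "m \<noteq> 0"
    and V: "\<And>x. x \<in> {-1<..<1} \<Longrightarrow> (1 - x\<^sup>2) * v x = k * J 0 1 x * ((l + 3/2) * (x + 1) - 4 * a + 2 * a * m)"
    and Z: "\<And>x. x \<in> {-1<..<1} \<Longrightarrow> (1 - x\<^sup>2) * z x = k * J 0 1 x * (((l + 3/2 - 2 * a) * (x + 1) + 2 * a * m) / 2)"
    and D: "\<And>x. x \<in> {-1<..<1} \<Longrightarrow> (1 - x\<^sup>2) * u x * ((1 - x\<^sup>2) * z x) - ((1 - x\<^sup>2) * v x)\<^sup>2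
        = k\<^sup>2 * (J 0 1 x)\<^sup>2 * (a * (2 * l + 3 - 4 * a) / m * ((1 + x) * (1 - x)\<^sup>2))"
  proof (rule solution_family_II[of l m g x0, folded J])
    fix k
    assume "k \<noteq> 0" "m \<noteq> 0"
      and "\<And>x. x \<in> {-1<..<1} \<Longrightarrow> (1 - x\<^sup>2) * v x = k * J 0 1 x * ((l + 3/2) * (x + 1) - 4 * a + 2 * a * m)"
      and "\<And>x. x \<in> {-1<..<1} \<Longrightarrow> (1 - x\<^sup>2) * z x = k * J 0 1 x * (((l + 3/2 - 2 * a) * (x + 1) + 2 * a * m) / 2)"
      and "\<And>x. x \<in> {-1<..<1} \<Longrightarrow> (1 - x\<^sup>2) * u x * ((1 - x\<^sup>2) * z x) - ((1 - x\<^sup>2) * v x)\<^sup>2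
        = k\<^sup>2 * (J 0 1 x)\<^sup>2 * (a * (2 * l + 3 - 4 * a) / m * ((1 + x) * (1 - x)\<^sup>2))"
    then show thesis by (rule that)
  next
    show "A11_of b c d l $ 1 $ 1 = l - 1/2" "A11_of b c d l $ 1 $ 2 = 2"
      "A11_of b c d l $ 2 $ 1 = 0" "A11_of b c d l $ 2 $ 2 = l + 1/2" by (simp_all add: F')
  qed (rule a co x0)+
  let ?S = "a * (2 * l + 3 - 4 * a) / m"
  have det: "u x * z x - (v x)\<^sup>2 = k\<^sup>2 * (J 0 1 x)\<^sup>2 * (?S * (1 / (1 + x)))" if x: "x \<in> {-1<..<1}" for x
  proof -
    have "u x * z x - (v x)\<^sup>2 = k\<^sup>2 * (J 0 1 x)\<^sup>2 * (?S * ((1 + x) * (1 - x)\<^sup>2)) / (1 - x\<^sup>2)\<^sup>2"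
      by (rule det_divide_interval[OF x D[OF x]])
    moreover have "(1 - x\<^sup>2)\<^sup>2 = (1 + x) * ((1 + x) * (1 - x)\<^sup>2)" by algebra
    moreover have "(1 + x) * (1 - x)\<^sup>2 \<noteq> 0" using x by auto
    then have "y * (w * ((1 + x) * (1 - x)\<^sup>2)) / ((1 + x) * ((1 + x) * (1 - x)\<^sup>2)) = y * (w * (1 / (1 + x)))" for y w
      by simp
    ultimately show ?thesis by (simp only:)
  qed
  show thesis
  proof (rule that[OF k(1)])
    show "0 < ?S" by (rule scale_positive[OF k(1), of 0 1]) (use det[of 0] in simp)
    fix x :: real assume x: "x \<in> {-1<..<1}"
    show "v x = k * J 0 1 x * (((l + 3/2) * (x + 1) - 4 * a + 2 * a * m) / (1 - x\<^sup>2))"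
      using divide_interval[OF x V[OF x]] by simp
    show "z x = k * J 0 1 x * (((l + 3/2 - 2 * a) * (x + 1) + 2 * a * m) / 2 / (1 - x\<^sup>2))"
      using divide_interval[OF x Z[OF x]] by simp
    show "u x * z x - (v x)\<^sup>2 = k\<^sup>2 * (J 0 1 x)\<^sup>2 * (?S * (1 / (1 + x)))" by (rule det[OF x])
  qed
qed

lemma family_II_rational:
  assumes F: "family_II (a, b, c, d, l, B11, B12, B21, B22)"
  shows "\<exists>Q. rational_on_interval Q \<and> (\<forall>x\<in>{-1<..<1}. transpose (Q x) = Q x) \<and> weight_of_form W l g 0 1 Q"
proof -
  define m where "m = (4 * a - 2 * l - 1) * B21"
  define S where "S = a * (2 * l + 3 - 4 * a) / m"
  obtain k where k: "k \<noteq> 0"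
    "\<And>x. x \<in> {-1<..<1} \<Longrightarrow> v x = k * J 0 1 x * (((l + 3/2) * (x + 1) - 4 * a + 2 * a * m) / (1 - x\<^sup>2))"
    "\<And>x. x \<in> {-1<..<1} \<Longrightarrow> z x = k * J 0 1 x * (((l + 3/2 - 2 * a) * (x + 1) + 2 * a * m) / 2 / (1 - x\<^sup>2))"
    "\<And>x. x \<in> {-1<..<1} \<Longrightarrow> u x * z x - (v x)\<^sup>2 = k\<^sup>2 * (J 0 1 x)\<^sup>2 * (S * (1 / (1 + x)))"
    using family_II_solution[OF F, folded m_def, folded S_def] by metis
  let ?E = "[:l + 3/2 - 4 * a + 2 * a * m, l + 3/2:]"
  let ?F = "smult (1/2) [:l + 3/2 - 2 * a + 2 * a * m, l + 3/2 - 2 * a:]"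
  let ?D = "smult S ([:1, 1:] * [:1, - 1:]\<^sup>2)"
  show ?thesis
  proof (rule rational_of_solution[OF k(1), of l g 0 1 ?E ?F ?D])
    fix x :: real assume x: "x \<in> {-1<..<1}"
    have "poly ?E x = (l + 3/2) * (x + 1) - 4 * a + 2 * a * m" by (simp add: algebra_simps)
    then show "v x = k * J 0 1 x * (poly ?E x / (1 - x\<^sup>2))" unfolding k(2)[OF x] by (simp only:)
    have "poly ?F x = ((l + 3/2 - 2 * a) * (x + 1) + 2 * a * m) / 2" by (simp add: algebra_simps)
    then show "z x = k * J 0 1 x * (poly ?F x / (1 - x\<^sup>2))" unfolding k(3)[OF x] by (simp only:)
    have "poly ?D x = S * ((1 + x) * (1 - x)\<^sup>2)" by (simp add: power2_eq_square algebra_simps)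
    moreover have "(1 - x\<^sup>2)\<^sup>2 = (1 + x) * ((1 + x) * (1 - x)\<^sup>2)" by algebra
    moreover have "(1 + x) * (1 - x)\<^sup>2 \<noteq> 0" using x by auto
    then have "S * ((1 + x) * (1 - x)\<^sup>2) / ((1 + x) * ((1 + x) * (1 - x)\<^sup>2)) = S * (1 / (1 + x))" by simp
    ultimately show "u x * z x - (v x)\<^sup>2 = k\<^sup>2 * (J 0 1 x)\<^sup>2 * (poly ?D x / (1 - x\<^sup>2)\<^sup>2)"
      unfolding k(4)[OF x] by (simp only:)
  qed
qed

lemma family_II_form:
  assumes F: "family_II (a, b, c, d, l, B11, B12, B21, B22)"
  shows "let r = 4 * a - 2 * l - 1 in
          g = r * (1 - 2 * a * B21) + l
          \<and> D = hyp_op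
              (cmat (mat2 (l - 1 / 2) 2 0 (l + 1 / 2)))
              (cmat (mat2 (l - 1 / 2) 2 0 (l + 1 / 2)
                   + mat2 ((2 * a + 1) * r * B21 - 4 * a) (- 2 * r * B21 + 4)
                          (r / 2 * B21) ((2 * a - 1) * r * B21 - 4 * a + 2)))
              (cmat (mat2 a 0 0 (- a)))
          \<and> (\<exists>s. s\<^sup>2 = a * (3 - 4 * a + 2 * l) / (B21 * r)
                \<and> similar_to_form W l g 0 1 (Q_II a l r B21 s))"
proof -
  define r where "r = 4 * a - 2 * l - 1"
  define m where "m = r * B21"
  note co = family_II_coefficients[OF F, folded r_def, folded m_def]
  have F': "b = 1" "c = 1" "d = - (1/2)" using F by simp_all
  obtain k where k: "k \<noteq> 0" "0 < a * (2 * l + 3 - 4 * a) / m"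
    "\<And>x. x \<in> {-1<..<1} \<Longrightarrow> v x = k * J 0 1 x * (((l + 3/2) * (x + 1) - 4 * a + 2 * a * m) / (1 - x\<^sup>2))"
    "\<And>x. x \<in> {-1<..<1} \<Longrightarrow> z x = k * J 0 1 x * (((l + 3/2 - 2 * a) * (x + 1) + 2 * a * m) / 2 / (1 - x\<^sup>2))"
    "\<And>x. x \<in> {-1<..<1} \<Longrightarrow> u x * z x - (v x)\<^sup>2 = k\<^sup>2 * (J 0 1 x)\<^sup>2 * (a * (2 * l + 3 - 4 * a) / m * (1 / (1 + x)))"
    using family_II_solution[OF F, folded r_def, folded m_def] by metis
  have gr: "g = r * (1 - 2 * a * B21) + l" unfolding co(5) m_def r_def by (simp add: algebra_simps)
  have D: "D = hyp_op (cmat (mat2 (l - 1 / 2) 2 0 (l + 1 / 2)))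
              (cmat (mat2 (l - 1 / 2) 2 0 (l + 1 / 2)
                   + mat2 ((2 * a + 1) * r * B21 - 4 * a) (- 2 * r * B21 + 4)
                          (r / 2 * B21) ((2 * a - 1) * r * B21 - 4 * a + 2)))
              (cmat (mat2 a 0 0 (- a)))"
  proof -
    have "A11_of b c d l = mat2 (l - 1 / 2) 2 0 (l + 1 / 2)" by (rule mat2_eqI) (simp_all add: F')
    moreover have "A10_of (A11_of b c d l) (A0_of a) (mat2 B11 B12 B21 B22)
      = mat2 (l - 1 / 2) 2 0 (l + 1 / 2) + mat2 ((2 * a + 1) * r * B21 - 4 * a) (- 2 * r * B21 + 4)
                          (r / 2 * B21) ((2 * a - 1) * r * B21 - 4 * a + 2)"
      by (rule mat2_eqI) (unfold vector_add_component mat2_nth co(1-4) m_def, simp_all)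
    ultimately show ?thesis unfolding D_eq by (simp only: A0_of_def)
  qed
  define E F where "E x = (l + 3/2) * (x + 1) - 4 * a + 2 * a * m" and "F x = 2 * ((l + 3/2 - 2 * a) * (x + 1) + 2 * a * m)" for x
  have "\<exists>s. s\<^sup>2 = a * (2 * l + 3 - 4 * a) / m \<and> s \<noteq> 0 \<and>
    similar_to_form W l g 0 1 (\<lambda>x. sym_with_det (1 / (1 + x)) (1 / ((1 - x\<^sup>2) * s) * E x) (1 / ((1 - x\<^sup>2) * s) * F x))"
  \<comment> \<open>the second diagonal entry of the normal form is four times that of the solution\<close>
  proof (rule similar_of_solution[OF k(1) _ k(2), of "1/4"])
    fix x :: real assume x: "x \<in> {-1<..<1}"
    show "v x = k * J 0 1 x * (E x / (1 - x\<^sup>2))" unfolding E_def by (rule k(3)[OF x])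
    have "t * (y / 2 / R) = 1 / 4 * t * (2 * y / R)" for t y R :: real by simp
    then show "z x = 1 / 4 * k * J 0 1 x * (F x / (1 - x\<^sup>2))" unfolding k(4)[OF x] F_def by (simp only: mult.assoc)
    show "u x * z x - (v x)\<^sup>2 = k\<^sup>2 * (J 0 1 x)\<^sup>2 * (a * (2 * l + 3 - 4 * a) / m * (1 / (1 + x)))" by (rule k(5)[OF x])
  qed simp
  then obtain s where s: "s\<^sup>2 = a * (2 * l + 3 - 4 * a) / m"
    and sim: "similar_to_form W l g 0 1 (\<lambda>x. sym_with_det (1 / (1 + x)) (1 / ((1 - x\<^sup>2) * s) * E x) (1 / ((1 - x\<^sup>2) * s) * F x))"
    by blast
  have "(\<lambda>x. sym_with_det (1 / (1 + x)) (1 / ((1 - x\<^sup>2) * s) * E x) (1 / ((1 - x\<^sup>2) * s) * F x)) = Q_II a l r B21 s"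
  proof
    fix x
    define t where "t = (1 - x\<^sup>2) * s"
    have E: "E x = 1 / 2 * (4 * a * r * B21 - 8 * a + 2 * x * l + 3 * x + 2 * l + 3)"
      unfolding E_def m_def by (simp add: field_simps)
    have F: "F x = 4 * a * r * B21 - 4 * a * x - 4 * a + 2 * x * l + 3 * x + 2 * l + 3"
      unfolding F_def m_def by (simp add: field_simps)
    have h: "1 / t * (1 / 2 * y) = 1 / 2 / t * y" for y by simp
    show "sym_with_det (1 / (1 + x)) (1 / ((1 - x\<^sup>2) * s) * E x) (1 / ((1 - x\<^sup>2) * s) * F x) = Q_II a l r B21 s x"
      unfolding Q_II_def E F t_def[symmetric] h ..
  qed
  then have sim': "similar_to_form W l g 0 1 (Q_II a l r B21 s)" using sim by (simp only:)
  have "s\<^sup>2 = a * (3 - 4 * a + 2 * l) / (B21 * r)" unfolding s m_def by (simp add: mult.commute add_ac diff_add_eq)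
  then show ?thesis unfolding Let_def r_def[symmetric] using gr D sim' by blast
qed

end

section \<open>The third family in coordinates\<close>

text \<open>
  In terms of $k = \lambda B_{21}$ and $y = \lambda B_{12}$ the defining relations of the family say
  $ky = 1-r^2$ and $rd = -(k+b_1y)$; after multiplication by \<open>d\<close> or \<open>r\<close> all coefficients of the
  operator become polynomials in these quantities.
\<close>
lemma family_III_parameter_identities:
  fixes b1 l r k a d B11 B12 B21 B22 y :: real
  assumes l: "l \<noteq> 0" and k: "k \<noteq> 0" and r: "r \<noteq> 0" and N: "k\<^sup>2 + b1 * (1 - r\<^sup>2) \<noteq> 0"
    and kB: "k = l * B21" and y: "y = l * B12" and ky: "k * y = 1 - r\<^sup>2" and rd: "r * d = - (k + b1 * y)"
    and F: "2 * a * d + (l + 1) * (4 * b1 + d\<^sup>2) = 0" "B11 * d = (b1 * B12 - B21) * l - 2 * B21"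
      "B22 * d = (b1 * B12 - B21) * l + 2 * b1 * B12"
  defines "N \<equiv> k\<^sup>2 + b1 * (1 - r\<^sup>2)"
  defines "e \<equiv> (k\<^sup>2 - k * r - b1 * (1 - r\<^sup>2)) / k"
  defines "g \<equiv> (l + 1) * r * (k\<^sup>2 - b1 * (1 - r\<^sup>2)) / N"
  shows "2 * a * (k * r * N) = (l + 1) * ((k\<^sup>2 + b1 * (r - 1)\<^sup>2) * (k\<^sup>2 + b1 * (r + 1)\<^sup>2))"
    and "d = - N / (k * r)"
    and "- ((l + d) * B11 + 2 * B21) = - g + e"
    and "- 2 * a * B12 - ((l + d) * B12 + 2 * B22) = - (k\<^sup>2 * (1 + r\<^sup>2) + b1 * (1 - r\<^sup>2)\<^sup>2 + k * r * (1 - r\<^sup>2)) / (k\<^sup>2 * r)"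
    and "2 * a * B21 - (2 * b1 * B11 + (l - d) * B21) = (k\<^sup>2 + b1 * (1 + r\<^sup>2) - k * r) / r"
    and "- (2 * b1 * B12 + (l - d) * B22) = - g - e"
    and "b1 = 0 \<Longrightarrow> B22 = r"
proof -
  have N': "N = - (k * (r * d))" unfolding N_def rd ky[symmetric] by algebra
  have N0: "N \<noteq> 0" using N by (simp add: N_def)
  then have d: "d \<noteq> 0" using N' by auto
  show "2 * a * (k * r * N) = (l + 1) * ((k\<^sup>2 + b1 * (r - 1)\<^sup>2) * (k\<^sup>2 + b1 * (r + 1)\<^sup>2))"
  proof -
    have "(k\<^sup>2 + b1 * (r - 1)\<^sup>2) * (k\<^sup>2 + b1 * (r + 1)\<^sup>2) = N\<^sup>2 + 4 * b1 * k\<^sup>2 * r\<^sup>2" unfolding N_def by algebra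
    also have "\<dots> = (k * r)\<^sup>2 * (4 * b1 + d\<^sup>2)" unfolding N' by algebra
    finally show ?thesis unfolding N' using F(1) by algebra
  qed
  show dN: "d = - N / (k * r)" unfolding N' using k r by simp
  have yB: "b1 * y - k = (b1 * B12 - B21) * l" unfolding y kB by algebra
  have lB: "l * (B11 - B22) = 2 * r"
  proof -
    have "l * ((B11 - B22) * d) = l * (- 2 * (B21 + b1 * B12))" using F(2,3) by algebra
    also have "\<dots> = - 2 * (k + b1 * y)" unfolding kB y by algebra
    also have "\<dots> = 2 * (r * d)" unfolding rd by algebra
    finally have "d * (l * (B11 - B22)) = d * (2 * r)" by algebra
    then show ?thesis by (rule mult_left_cancel[THEN iffD1, rotated]) (rule d)
  qed
  have gd: "g * d = (l + 1) * (b1 * y - k)"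
  proof -
    have "k\<^sup>2 - b1 * (1 - r\<^sup>2) = k * (k - b1 * y)" unfolding ky[symmetric] by algebra
    then have "g = (l + 1) * r * (k * (k - b1 * y)) / (- (k * (r * d)))" unfolding g_def N' by simp
    then have "g * (- (k * (r * d))) = (l + 1) * r * (k * (k - b1 * y))"
      by (rule nonzero_eq_divide_eq[THEN iffD1, rotated]) (use k r d in simp)
    then have "(k * r) * (g * d) = (k * r) * ((l + 1) * (b1 * y - k))" by algebra
    then show ?thesis by (rule mult_left_cancel[THEN iffD1, rotated]) (use k r in simp)
  qed
  have av: "l * (B11 + B22) = 2 * g"
  proof -
    have "d * (l * (B11 + B22)) = l * (2 * (b1 * y - k)) + 2 * (l * (b1 * B12) - l * B21)" unfolding yB using F(2,3) by algebra
    also have "\<dots> = d * (2 * g)" using gd unfolding kB y by algebra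
    finally show ?thesis by (rule mult_left_cancel[THEN iffD1, rotated]) (rule d)
  qed
  have lB11: "l * B11 = g + r" and lB22: "l * B22 = g - r" using lB av by (simp_all add: algebra_simps)
  have e: "e = k - r - b1 * y"
    unfolding e_def ky[symmetric] using k by (simp add: field_simps power2_eq_square)
  show "- ((l + d) * B11 + 2 * B21) = - g + e"
    unfolding e using lB11 F(2) yB by algebra
  show "- (2 * b1 * B12 + (l - d) * B22) = - g - e"
    unfolding e using lB22 F(3) yB by algebra
  show "- 2 * a * B12 - ((l + d) * B12 + 2 * B22) = - (k\<^sup>2 * (1 + r\<^sup>2) + b1 * (1 - r\<^sup>2)\<^sup>2 + k * r * (1 - r\<^sup>2)) / (k\<^sup>2 * r)" (is "?q = ?q'")
  proof -
    have "d * ?q = d * (- 2 * r + d * y - y)"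
      using F(1,3) rd unfolding y kB by algebra
    then have "?q = - 2 * r + d * y - y" by (rule mult_left_cancel[THEN iffD1, rotated]) (rule d)
    then have "k\<^sup>2 * r * ?q = - (k\<^sup>2 * (1 + r\<^sup>2) + b1 * (1 - r\<^sup>2)\<^sup>2 + k * r * (1 - r\<^sup>2))"
      using rd ky by algebra
    then show ?thesis using k r by (simp add: eq_divide_eq mult.commute)
  qed
  show "2 * a * B21 - (2 * b1 * B11 + (l - d) * B21) = (k\<^sup>2 + b1 * (1 + r\<^sup>2) - k * r) / r" (is "?r = ?r'")
  proof -
    have "d * ?r = d * (2 * b1 * r - k * d - k)"
      using F(1,2) rd unfolding y kB by algebra
    then have "?r = 2 * b1 * r - k * d - k" by (rule mult_left_cancel[THEN iffD1, rotated]) (rule d)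
    then have "r * ?r = k\<^sup>2 + b1 * (1 + r\<^sup>2) - k * r"
      using rd ky by algebra
    then show ?thesis using r by (simp add: eq_divide_eq mult.commute)
  qed
  show "B22 = r" if "b1 = 0"
  proof -
    have "d * B22 = d * r" using F(3) rd that unfolding kB by algebra
    then show ?thesis by (rule mult_left_cancel[THEN iffD1, rotated]) (rule d)
  qed
qed

lemma family_III_operator_entries:
  fixes b1 l r k N :: real
  assumes k: "k \<noteq> 0" and r: "r \<noteq> 0" and N: "N \<noteq> 0" "N = k\<^sup>2 + b1 * (1 - r\<^sup>2)" and r1: "1 - r\<^sup>2 \<noteq> 0"
  defines "w \<equiv> b1 * (1 - r\<^sup>2)"
  defines "g \<equiv> (l + 1) * r * (k\<^sup>2 - b1 * (1 - r\<^sup>2)) / N"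
    and "e \<equiv> (k\<^sup>2 - k * r - b1 * (1 - r\<^sup>2)) / k"
  shows "k - l * r - 2 * r + w * ((- k\<^sup>2 + 2 * k * r * (l + 1)) / (k * N)) + - (b1\<^sup>2 * (1 - r\<^sup>2)\<^sup>2) / (k * N) = - g + e"
    and "- ((k * (r\<^sup>2 + 1) - r * (r\<^sup>2 - 1)) / (k * r)) + w * ((r - 1) * (r + 1) / (k\<^sup>2 * r))
      = - (k\<^sup>2 * (1 + r\<^sup>2) + b1 * (1 - r\<^sup>2)\<^sup>2 + k * r * (1 - r\<^sup>2)) / (k\<^sup>2 * r)"
    and "k * (k - r) / r + w * ((r\<^sup>2 + 1) / (r * (1 - r\<^sup>2))) = (k\<^sup>2 + b1 * (1 + r\<^sup>2) - k * r) / r"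
    and "- k - l * r + w * ((k\<^sup>2 + 2 * k * r * (l + 1)) / (k * N)) + - (- (b1\<^sup>2 * (1 - r\<^sup>2)\<^sup>2) / (k * N)) = - g - e"
proof -
  have w: "w = N - k\<^sup>2" unfolding N(2) w_def by simp
  have w2: "b1\<^sup>2 * (1 - r\<^sup>2)\<^sup>2 = (N - k\<^sup>2)\<^sup>2" unfolding w[symmetric] w_def by (simp add: power_mult_distrib)
  have wg: "b1 * (1 - r\<^sup>2) = N - k\<^sup>2" using w by (simp only: w_def)
  show "k - l * r - 2 * r + w * ((- k\<^sup>2 + 2 * k * r * (l + 1)) / (k * N)) + - (b1\<^sup>2 * (1 - r\<^sup>2)\<^sup>2) / (k * N) = - g + e"
    "- k - l * r + w * ((k\<^sup>2 + 2 * k * r * (l + 1)) / (k * N)) + - (- (b1\<^sup>2 * (1 - r\<^sup>2)\<^sup>2) / (k * N)) = - g - e"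
    unfolding w2 w g_def e_def wg using k N(1) by (simp_all add: field_simps power2_eq_square)
  show "- ((k * (r\<^sup>2 + 1) - r * (r\<^sup>2 - 1)) / (k * r)) + w * ((r - 1) * (r + 1) / (k\<^sup>2 * r))
      = - (k\<^sup>2 * (1 + r\<^sup>2) + b1 * (1 - r\<^sup>2)\<^sup>2 + k * r * (1 - r\<^sup>2)) / (k\<^sup>2 * r)"
    unfolding w_def using k r by (simp add: field_simps power2_eq_square)
  define t where "t = 1 - r\<^sup>2"
  have "b1 * t * ((r\<^sup>2 + 1) / (r * t)) = b1 * (r\<^sup>2 + 1) / r" using r1 unfolding t_def[symmetric] by simp
  then show "k * (k - r) / r + w * ((r\<^sup>2 + 1) / (r * (1 - r\<^sup>2))) = (k\<^sup>2 + b1 * (1 + r\<^sup>2) - k * r) / r"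
    unfolding w_def t_def using r by (simp add: field_simps power2_eq_square)
qed

context coordinates
begin

text \<open>
  If $d = 0$, then $B_{21} = -b_1B_{12}$, while $B_{12}\int z = B_{21}\int u$ and, unless
  $b_1 = 0$, also $\lambda = -1$. For $b_1 \ge 0$ this forces
  $B_{12} = B_{21} = 0$, and the system is one of the two impossible ones. For $b_1 < 0$ the
  coefficient $-n(n-1) + nA_{11} + A_0$ of $x^n$ has, for large \<open>n\<close>, the non-real eigenvalues
  $-n^2 \pm i\sqrt{-a^2-4b_1n^2}$.
\<close>
lemma family_III_nonzero:
  assumes F: "family_III (a, b, c, d, l, B11, B12, B21, B22)"
  shows "a \<noteq> 0" and "d \<noteq> 0" and "B12 = 0 \<longleftrightarrow> B21 = 0"
proof -
  define b1 where "b1 = b - 1"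
  have b: "b = b1 + 1" and c: "c = 1 - b1" using F by (simp_all add: b1_def)
  have F': "2 * a * d + (l + 1) * (4 * b1 + d\<^sup>2) = 0" "B11 * d = (b1 * B12 - B21) * l - 2 * B21"
    "B22 * d = (b1 * B12 - B21) * l + 2 * b1 * B12"
    using F unfolding family_III.simps b1_def by blast+
  show a: "a \<noteq> 0" using a_nonzero b c by simp
  obtain m1 m2 where m: "m1 > 0" "m2 > 0" "B12 * m2 = B21 * m1"
    using moments[OF a quotient] by (metis mat2_nth)
  show B0: "B12 = 0 \<longleftrightarrow> B21 = 0" using m by auto
  show "d \<noteq> 0"
  proof
    assume d: "d = 0"
    have e: "(b1 * B12 - B21) * l - 2 * B21 = 0" "(b1 * B12 - B21) * l + 2 * b1 * B12 = 0"
      unfolding F'(2,3)[symmetric] d by simp_all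
    have B1: "B21 = - b1 * B12" using e by algebra
    then have "- 2 * ((l + 1) * B21) = (b1 * B12 - B21) * l - 2 * B21" by algebra
    then have B2: "(l + 1) * B21 = 0" unfolding e(1) by simp
    have B3: "(l + 1) * b1 = 0" using F'(1) unfolding d by simp
    note B = B1 B2 B3
    consider "b1 = 0" | "b1 > 0" | "b1 < 0" by linarith
    then show False
    proof cases
      case 1
      then have "B21 = 0" "B12 = 0" using B B0 by auto
      then show False
        by (intro triangular_impossible[OF a, of l B11 B22]) (simp_all add: A10_of_nth b c d 1)
    next
      case 2
      then have l: "l = - 1" using B(3) by simp
      have "B12 * (m2 + b1 * m1) = 0" using m(3) B(1) by algebra
      moreover have "m2 + b1 * m1 > 0" using m 2 by (simp add: add_pos_pos)
      ultimately have "B12 = 0" "B21 = 0" using B0 by auto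
      then show False
        by (intro diagonal_moment_impossible[OF a, of b1 B11 B22]) (simp_all add: A10_of_nth b c d l)
    next
      case 3
      then have l: "l = - 1" using B(3) by simp
      obtain n :: nat where n: "a\<^sup>2 / (- 4 * b1) < real n" using reals_Archimedean2 by blast
      have "0 \<le> a\<^sup>2 / (- 4 * b1)" by (rule divide_nonneg_pos) (use 3 in simp_all)
      then have n0: "0 < n" using n by (cases n) auto
      have p: "0 < - 4 * b1" using 3 by simp
      have "a\<^sup>2 < real n * (- 4 * b1)" using n unfolding pos_divide_less_eq[OF p] .
      also have "\<dots> = (- 4 * b1) * real n" by (rule mult.commute)
      also have "\<dots> \<le> (- 4 * b1) * (real n)\<^sup>2"
        using n0 3 by (intro mult_left_mono) (simp_all add: power2_eq_square)
      finally have neg: "0 < - (a\<^sup>2 + 4 * b1 * (real n)\<^sup>2)" by simp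
      \<comment> \<open>the imaginary part of the eigenvalue; its real part is $-n^2$\<close>
      define \<omega> where "\<omega> = sqrt (- (a\<^sup>2 + 4 * b1 * (real n)\<^sup>2))"
      have w: "\<omega>\<^sup>2 = - (a\<^sup>2 + 4 * b1 * (real n)\<^sup>2)" "\<omega> \<noteq> 0" using neg by (simp_all add: \<omega>_def)
      have kn: "real k * real k \<noteq> real n * real n" if "k < n" for k
      proof -
        have "(real k)\<^sup>2 < (real n)\<^sup>2" using that by (intro power_strict_mono) simp_all
        then show ?thesis by (simp add: power2_eq_square)
      qed
      show False
      proof (rule no_nonreal_eigenvalue[OF pair[unfolded D_eq], of "Complex (- (real n)\<^sup>2) \<omega>" "Complex a \<omega>" "2 * of_nat n" n])
        show "Im (Complex (- (real n)\<^sup>2) \<omega>) \<noteq> 0" using w(2) by simp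
        show "Complex a \<omega> \<noteq> 0 \<or> 2 * of_nat n \<noteq> (0::complex)" using n0 by simp
      qed (use w in \<open>simp_all add: A0_of_def b c d l complex_eq_iff\<close>, use kn in \<open>simp_all add: power2_eq_square algebra_simps\<close>)
    qed
  qed
qed

lemma family_III_solution:
  assumes F: "family_III (a, b, c, d, l, B11, B12, B21, B22)"
  defines "A10 \<equiv> A10_of (A11_of b c d l) (A0_of a) (mat2 B11 B12 B21 B22)"
  obtains r k e q0 r0 N s2 \<eta> \<zeta> \<upsilon> where "r\<^sup>2 = 1 - l\<^sup>2 * B12 * B21" and "1 - r\<^sup>2 \<noteq> 0" and "l \<noteq> 0"
    and "family_III_parameters (b - 1) l r (l * B21) a d e q0 r0 g N s2 \<eta> \<zeta> \<upsilon>"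
    and "A10 $ 1 $ 1 = - g + e" "A10 $ 1 $ 2 = q0" "A10 $ 2 $ 1 = r0" "A10 $ 2 $ 2 = - g - e"
    and "k \<noteq> 0" and "0 < s2"
    and "\<And>x. x \<in> {-1<..<1} \<Longrightarrow> v x = k * J 1 1 x * (\<eta> x / (1 - x\<^sup>2))"
    and "\<And>x. x \<in> {-1<..<1} \<Longrightarrow> z x = - 1 * k * J 1 1 x * (\<zeta> x / (1 - x\<^sup>2))"
    and "\<And>x. x \<in> {-1<..<1} \<Longrightarrow> u x * z x - (v x)\<^sup>2 = k\<^sup>2 * (J 1 1 x)\<^sup>2 * (s2 * (1 / (1 - x\<^sup>2)))"
proof -
  define b1 where "b1 = b - 1"
  have b: "b = b1 + 1" and c: "c = 1 - b1" using F by (simp_all add: b1_def)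
  have F': "2 * a * d + (l + 1) * (4 * b1 + d\<^sup>2) = 0" "B11 * d = (b1 * B12 - B21) * l - 2 * B21"
    "B22 * d = (b1 * B12 - B21) * l + 2 * b1 * B12" "1 - l\<^sup>2 * B12 * B21 \<noteq> 0"
    "d\<^sup>2 = l\<^sup>2 * ((B21 + b1 * B12)\<^sup>2 / (1 - l\<^sup>2 * B12 * B21))"
    using F unfolding family_III.simps b1_def by blast+
  have bc: "b + c = 2" "b - c = 2 * b1" using b c by simp_all
  note nz = family_III_nonzero[OF F]
  have a: "a \<noteq> 0" and d: "d \<noteq> 0" by (fact nz)+
  obtain m1 m2 where m: "m1 > 0" "m2 > 0" "(u has_integral m1) {-1..1}" "(z has_integral m2) {-1..1}"
    "((\<lambda>x. x * z x) has_integral B22 * m2) {-1..1}" "B12 * m2 = B21 * m1"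
    using moments[OF a quotient] by (metis mat2_nth)
  \<comment> \<open>the square root of $1-\lambda^2B_{12}B_{21}$ for which $d$ has the sign required by the relation $rd = -(k+b_1y)$\<close>
  define r where "r = - l * (B21 + b1 * B12) / d"
  define k where "k = l * B21"
  define y where "y = l * B12"
  have r2: "r\<^sup>2 = 1 - l\<^sup>2 * B12 * B21"
  proof -
    define \<Delta> where "\<Delta> = 1 - l\<^sup>2 * B12 * B21"
    have "d\<^sup>2 * \<Delta> = (l * (B21 + b1 * B12))\<^sup>2" unfolding F'(5) \<Delta>_def[symmetric] using F'(4)[folded \<Delta>_def]
      by (simp add: power_mult_distrib)
    then have "\<Delta> = (l * (B21 + b1 * B12))\<^sup>2 / d\<^sup>2" using d by (simp add: eq_divide_eq mult.commute)
    then show ?thesis unfolding r_def \<Delta>_def[symmetric] by (simp add: power_divide)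
  qed
  have r: "r \<noteq> 0" using r2 F'(4) by auto
  have l: "l \<noteq> 0" using r by (auto simp: r_def)
  have B: "B21 \<noteq> 0" "B12 \<noteq> 0" using r nz(3) by (auto simp: r_def)
  have k: "k \<noteq> 0" using l B by (simp add: k_def)
  have ky: "k * y = 1 - r\<^sup>2" unfolding r2 k_def y_def by (simp add: power2_eq_square)
  have r1: "1 - r\<^sup>2 \<noteq> 0" unfolding ky[symmetric] using k l B by (simp add: y_def)
  have rd: "r * d = - (k + b1 * y)" unfolding r_def k_def y_def using d by (simp add: field_simps)
  have N: "k\<^sup>2 + b1 * (1 - r\<^sup>2) \<noteq> 0"
  proof -
    have "k\<^sup>2 + b1 * (1 - r\<^sup>2) = - (k * (r * d))" unfolding rd ky[symmetric] by algebra
    then show ?thesis using k r d by simp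
  qed
  note id = family_III_parameter_identities[OF l k r N k_def y_def ky rd F'(1-3)]
  define N where "N = k\<^sup>2 + b1 * (1 - r\<^sup>2)"
  define e where "e = (k\<^sup>2 - k * r - b1 * (1 - r\<^sup>2)) / k"
  define q0 where "q0 = - (k\<^sup>2 * (1 + r\<^sup>2) + b1 * (1 - r\<^sup>2)\<^sup>2 + k * r * (1 - r\<^sup>2)) / (k\<^sup>2 * r)"
  define r0 where "r0 = (k\<^sup>2 + b1 * (1 + r\<^sup>2) - k * r) / r"
  define s2 where "s2 = (k\<^sup>2 + b1 * (r - 1)\<^sup>2) * (k\<^sup>2 + b1 * (r + 1)\<^sup>2)"
  define g' where "g' = (l + 1) * r * (k\<^sup>2 - b1 * (1 - r\<^sup>2)) / N"
  define \<eta> where "\<eta> = (\<lambda>x. k\<^sup>2 * (x - r) + b1 * (x + r) * (1 - r\<^sup>2))"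
  define \<zeta> where "\<zeta> = (\<lambda>x. k * (k\<^sup>2 + b1 * (r\<^sup>2 + 2 * x * r + 1)))"
  define \<upsilon> where "\<upsilon> = (\<lambda>x. k * (1 + r\<^sup>2 - 2 * r * x) + b1 * (1 - r\<^sup>2)\<^sup>2 / k)"
  note id' = id[folded N_def, folded e_def q0_def r0_def s2_def g'_def]
  have co: "A10 $ 1 $ 1 = - g' + e" "A10 $ 1 $ 2 = q0" "A10 $ 2 $ 1 = r0" "A10 $ 2 $ 2 = - g' - e"
    unfolding A10_def A10_of_nth bc using id'(3-6) by simp_all
  have "2 * g = - (A10 $ 1 $ 1 + A10 $ 2 $ 2)"
    unfolding A10_def A10_of_nth g by (simp add: algebra_simps)
  then have gg: "g = g'" unfolding co by simp
  note co' = co[folded gg]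
  have P: "family_III_parameters b1 l r k a d e q0 r0 g N s2 \<eta> \<zeta> \<upsilon>"
    using k r N a id'(1,2) by unfold_locales (simp_all add: N_def e_def q0_def r0_def s2_def gg g'_def \<eta>_def \<zeta>_def \<upsilon>_def)
  have jp: "jacobi_pair u v z a (l + d) (- g + e) 2 q0 (2 * b1) r0 (l - d) (- g - e)"
    using jacobi_pair_axioms by (simp only: A11_of_nth co'[unfolded A10_def] bc)
  define jf where "jf x = (2 * x + q0) * z x - (2 * b1 * x + r0) * u x + (((l + d) * x + (- g + e)) - ((l - d) * x + (- g - e))) * v x" for x
  have jj: "jj x = jf x" for x
    unfolding jf_def by (simp only: A11_of_nth co'[unfolded A10_def] bc)
  obtain x0 where x0: "x0 \<in> {-1<..<1}" "jf x0 \<noteq> 0"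
    using j_nonzero[OF a] bc unfolding jj by auto
  interpret III: family_III_pair u v z a l d g e q0 b1 r0 "\<lambda>x. (1 - x\<^sup>2) * u x" "\<lambda>x. (1 - x\<^sup>2) * v x" "\<lambda>x. (1 - x\<^sup>2) * z x"
    "\<lambda>x. (2 * x + q0) * z x - (2 * b1 * x + r0) * u x + (((l + d) * x + (- g + e)) - ((l - d) * x + (- g - e))) * v x" r k N s2 \<eta> \<zeta> \<upsilon>
  proof -
    have zz: "((\<lambda>x. (x - r) * z x) has_integral 0) {-1..1}" if "b1 = 0"
      using has_integral_diff[OF m(5) has_integral_mult_right[OF m(4), of r]] id'(7)[OF that]
      by (simp add: left_diff_distrib)
    have "k\<^sup>2 * m1 - (1 - r\<^sup>2) * m2 = 0" unfolding ky[symmetric] k_def y_def using m(6) by algebra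
    then have uz: "((\<lambda>x. k\<^sup>2 * u x - (1 - r\<^sup>2) * z x) has_integral 0) {-1..1}"
      using has_integral_diff[OF has_integral_mult_right[OF m(3), of "k\<^sup>2"] has_integral_mult_right[OF m(4), of "1 - r\<^sup>2"]] by simp
    show "family_III_pair u v z a l d g e q0 b1 r0 r k N s2 \<eta> \<zeta> \<upsilon>"
      by (intro family_III_pair.intro family_III_pair_axioms.intro jp P zz uz)
  qed
  have J: "J 1 1 x = (1 - x) powr (- l / 2 - 1 + g / 2 + 1 / 2) * (1 + x) powr (- l / 2 - 1 - g / 2 + 1 / 2)" for x
    by (simp add: jacobi_factor_def)
  obtain C where C: "C \<noteq> 0"
    and V: "\<And>x. x \<in> {-1<..<1} \<Longrightarrow> (1 - x\<^sup>2) * v x = C * J 1 1 x * \<eta> x"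
    and Z: "\<And>x. x \<in> {-1<..<1} \<Longrightarrow> (1 - x\<^sup>2) * z x = - C * J 1 1 x * \<zeta> x"
    and D: "\<And>x. x \<in> {-1<..<1} \<Longrightarrow> (1 - x\<^sup>2) * u x * ((1 - x\<^sup>2) * z x) - ((1 - x\<^sup>2) * v x)\<^sup>2
        = C\<^sup>2 * (J 1 1 x)\<^sup>2 * (s2 * (1 - x\<^sup>2))"
  proof (rule III.solution[OF x0[unfolded jf_def], folded J])
    fix C
    assume "C \<noteq> 0" and "\<And>x. x \<in> {-1<..<1} \<Longrightarrow> (1 - x\<^sup>2) * v x = C * J 1 1 x * \<eta> x"
      and "\<And>x. x \<in> {-1<..<1} \<Longrightarrow> (1 - x\<^sup>2) * z x = - C * J 1 1 x * \<zeta> x"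
      and "\<And>x. x \<in> {-1<..<1} \<Longrightarrow> (1 - x\<^sup>2) * u x * ((1 - x\<^sup>2) * z x) - ((1 - x\<^sup>2) * v x)\<^sup>2
        = C\<^sup>2 * (J 1 1 x)\<^sup>2 * (s2 * (1 - x\<^sup>2))"
    then show thesis by (rule that)
  qed
  have det: "u x * z x - (v x)\<^sup>2 = C\<^sup>2 * (J 1 1 x)\<^sup>2 * (s2 * (1 / (1 - x\<^sup>2)))" if x: "x \<in> {-1<..<1}" for x
  proof -
    define R where "R = 1 - x\<^sup>2"
    have R: "R \<noteq> 0" using interval_pos[OF x] by (simp add: R_def)
    have "u x * z x - (v x)\<^sup>2 = C\<^sup>2 * (J 1 1 x)\<^sup>2 * (s2 * R) / R\<^sup>2"
      unfolding R_def by (rule det_divide_interval[OF x D[OF x]])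
    also have "\<dots> = C\<^sup>2 * (J 1 1 x)\<^sup>2 * (s2 * (1 / R))" using R by (simp add: power2_eq_square)
    finally show ?thesis unfolding R_def .
  qed
  show thesis
  proof (rule that[OF r2 r1 l P[unfolded k_def b1_def] co' C])
    show "0 < s2" by (rule scale_positive[OF C, of 1 1]) (use det[of 0] in simp)
    fix x :: real assume x: "x \<in> {-1<..<1}"
    show "v x = C * J 1 1 x * (\<eta> x / (1 - x\<^sup>2))"
      using divide_interval[OF x V[OF x]] by simp
    show "z x = - 1 * C * J 1 1 x * (\<zeta> x / (1 - x\<^sup>2))"
      using divide_interval[OF x Z[OF x]] by simp
    show "u x * z x - (v x)\<^sup>2 = C\<^sup>2 * (J 1 1 x)\<^sup>2 * (s2 * (1 / (1 - x\<^sup>2)))" by (rule det[OF x])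
  qed
qed

lemma family_III_rational:
  assumes F: "family_III (a, b, c, d, l, B11, B12, B21, B22)"
  shows "\<exists>Q. rational_on_interval Q \<and> (\<forall>x\<in>{-1<..<1}. transpose (Q x) = Q x) \<and> weight_of_form W l g 1 1 Q"
proof -
  define b1 k where "b1 = b - 1" and "k = l * B21"
  obtain r C e q0 r0 N s2 \<eta> \<zeta> \<upsilon> where
    P: "family_III_parameters b1 l r k a d e q0 r0 g N s2 \<eta> \<zeta> \<upsilon>" and C: "C \<noteq> 0"
    and sol: "\<And>x. x \<in> {-1<..<1} \<Longrightarrow> v x = C * J 1 1 x * (\<eta> x / (1 - x\<^sup>2))"
    "\<And>x. x \<in> {-1<..<1} \<Longrightarrow> z x = - 1 * C * J 1 1 x * (\<zeta> x / (1 - x\<^sup>2))"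
    "\<And>x. x \<in> {-1<..<1} \<Longrightarrow> u x * z x - (v x)\<^sup>2 = C\<^sup>2 * (J 1 1 x)\<^sup>2 * (s2 * (1 / (1 - x\<^sup>2)))"
    using family_III_solution[OF F, folded b1_def k_def] by metis
  interpret family_III_parameters b1 l r k a d e q0 r0 g N s2 \<eta> \<zeta> \<upsilon> by (rule P)
  let ?E = "[:- k\<^sup>2 * r + b1 * r * (1 - r\<^sup>2), k\<^sup>2 + b1 * (1 - r\<^sup>2):]"
  let ?F = "[:- k * (k\<^sup>2 + b1 * (r\<^sup>2 + 1)), - 2 * k * b1 * r:]"
  let ?D = "smult s2 [:1, 0, - 1:]"
  show ?thesis
  proof (rule rational_of_solution[OF C, of l g 1 1 ?E ?F ?D])
    fix x :: real assume x: "x \<in> {-1<..<1}"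
    have "poly ?E x = \<eta> x" unfolding \<eta>_def by (simp add: algebra_simps)
    then show "v x = C * J 1 1 x * (poly ?E x / (1 - x\<^sup>2))" unfolding sol(1)[OF x] by (simp only:)
    have "poly ?F x = - \<zeta> x" unfolding \<zeta>_def by (simp add: algebra_simps)
    then show "z x = C * J 1 1 x * (poly ?F x / (1 - x\<^sup>2))" unfolding sol(2)[OF x] by simp
    have "poly ?D x = s2 * (1 - x\<^sup>2)" by (simp add: power2_eq_square algebra_simps)
    moreover have "s2 * R / R\<^sup>2 = s2 * (1 / R)" for R :: real by (simp add: power2_eq_square)
    ultimately show "u x * z x - (v x)\<^sup>2 = C\<^sup>2 * (J 1 1 x)\<^sup>2 * (poly ?D x / (1 - x\<^sup>2)\<^sup>2)"
      unfolding sol(3)[OF x] by (simp only:)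
  qed
qed

lemma family_III_form:
  assumes F: "family_III (a, b, c, d, l, B11, B12, B21, B22)"
  shows "\<exists>r s.
          r\<^sup>2 = 1 - l\<^sup>2 * B12 * B21
          \<and> s\<^sup>2 = (B21\<^sup>2 * l\<^sup>2 + (b - 1) * (r - 1)\<^sup>2) * (B21\<^sup>2 * l\<^sup>2 + (b - 1) * (r + 1)\<^sup>2)
          \<and> g = (l + 1) * r * (B21\<^sup>2 * l\<^sup>2 + (b - 1) * (r\<^sup>2 - 1)) / (B21\<^sup>2 * l\<^sup>2 - (b - 1) * (r\<^sup>2 - 1))
          \<and> D = hyp_op
              (cmat (mat2
                 ((B21 * l\<^sup>2 * r - B21\<^sup>2 * l\<^sup>2 + (b - 1) * (r\<^sup>2 - 1)) / (B21 * l * r)) 2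
                 (2 * b - 2) ((B21 * l\<^sup>2 * r + B21\<^sup>2 * l\<^sup>2 - (b - 1) * (r\<^sup>2 - 1)) / (B21 * l * r))))
              (cmat (mat2
                     (B21 * l - l * r - 2 * r) (- ((B21 * l * (r\<^sup>2 + 1) - r * (r\<^sup>2 - 1)) / (B21 * l * r)))
                     (B21 * l * (B21 * l - r) / r) (- l * (B21 + r))
                 + ((b - 1) * (1 - r\<^sup>2)) *\<^sub>R mat2
                     ((- B21\<^sup>2 * l\<^sup>2 + 2 * B21 * r * l * (l + 1)) / (B21 * l * ((b - 1) * (1 - r\<^sup>2) + B21\<^sup>2 * l\<^sup>2)))
                     ((r - 1) * (r + 1) / (B21\<^sup>2 * l\<^sup>2 * r))
                     ((r\<^sup>2 + 1) / (r * (1 - r\<^sup>2)))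
                     ((B21\<^sup>2 * l\<^sup>2 + 2 * B21 * l * r * (l + 1)) / (B21 * l * ((b - 1) * (1 - r\<^sup>2) + B21\<^sup>2 * l\<^sup>2)))
                 + (- ((b - 1)\<^sup>2 * (1 - r\<^sup>2)\<^sup>2) / (B21 * l * ((b - 1) * (1 - r\<^sup>2) + B21\<^sup>2 * l\<^sup>2)))
                     *\<^sub>R mat2 1 0 0 (-1)))
              (cmat (((l + 1) * ((b - 1) * (r - 1)\<^sup>2 + B21\<^sup>2 * l\<^sup>2) * ((b - 1) * (r + 1)\<^sup>2 + B21\<^sup>2 * l\<^sup>2)
                      / (2 * B21 * l * r * ((b - 1) * (1 - r\<^sup>2) + B21\<^sup>2 * l\<^sup>2))) *\<^sub>R mat2 1 0 0 (-1)))
          \<and> similar_to_form W l g 1 1 (Q_III b l r B21 s)"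
proof -
  define b1 k where "b1 = b - 1" and "k = l * B21"
  obtain r C e q0 r0 N s2 \<eta> \<zeta> \<upsilon> where r2: "r\<^sup>2 = 1 - l\<^sup>2 * B12 * B21" and r1: "1 - r\<^sup>2 \<noteq> 0"
    and P: "family_III_parameters b1 l r k a d e q0 r0 g N s2 \<eta> \<zeta> \<upsilon>"
    and co: "A10_of (A11_of b c d l) (A0_of a) (mat2 B11 B12 B21 B22) $ 1 $ 1 = - g + e"
      "A10_of (A11_of b c d l) (A0_of a) (mat2 B11 B12 B21 B22) $ 1 $ 2 = q0"
      "A10_of (A11_of b c d l) (A0_of a) (mat2 B11 B12 B21 B22) $ 2 $ 1 = r0"
      "A10_of (A11_of b c d l) (A0_of a) (mat2 B11 B12 B21 B22) $ 2 $ 2 = - g - e"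
    and C: "C \<noteq> 0" "0 < s2"
    and sol: "\<And>x. x \<in> {-1<..<1} \<Longrightarrow> v x = C * J 1 1 x * (\<eta> x / (1 - x\<^sup>2))"
    "\<And>x. x \<in> {-1<..<1} \<Longrightarrow> z x = - 1 * C * J 1 1 x * (\<zeta> x / (1 - x\<^sup>2))"
    "\<And>x. x \<in> {-1<..<1} \<Longrightarrow> u x * z x - (v x)\<^sup>2 = C\<^sup>2 * (J 1 1 x)\<^sup>2 * (s2 * (1 / (1 - x\<^sup>2)))"
    by (rule family_III_solution[OF F, folded b1_def k_def]) blast
  interpret family_III_parameters b1 l r k a d e q0 r0 g N s2 \<eta> \<zeta> \<upsilon> by (rule P)
  have bc: "b + c = 2" "b - c = 2 * b - 2" using F by simp_all
  have Bl: "B21 * l = k" "B21\<^sup>2 * l\<^sup>2 = k\<^sup>2" "B21 * l\<^sup>2 * r = k * l * r" "2 * B21 * r * l * (l + 1) = 2 * k * r * (l + 1)"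
    "2 * B21 * l * r * (l + 1) = 2 * k * r * (l + 1)" "- B21\<^sup>2 * l\<^sup>2 = - k\<^sup>2" "2 * B21 * l * r = 2 * k * r"
    "- l * (B21 + r) = - k - l * r"
    unfolding k_def by (simp_all add: power2_eq_square algebra_simps)
  note en = family_III_operator_entries(1,4)[OF k r N N_def r1, of l, folded g e]
    family_III_operator_entries(2)[OF k r N N_def r1, folded q0] family_III_operator_entries(3)[OF k r N N_def r1, folded r0]
  have Nc: "b1 * (1 - r\<^sup>2) + k\<^sup>2 = N" unfolding N_def by simp
  have A11: "A11_of b c d l = mat2
                 ((B21 * l\<^sup>2 * r - B21\<^sup>2 * l\<^sup>2 + (b - 1) * (r\<^sup>2 - 1)) / (B21 * l * r)) 2
                 (2 * b - 2) ((B21 * l\<^sup>2 * r + B21\<^sup>2 * l\<^sup>2 - (b - 1) * (r\<^sup>2 - 1)) / (B21 * l * r))"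
  proof (rule mat2_eqI; unfold mat2_nth A11_of_nth Bl b1_def[symmetric])
    show "l + d = (k * l * r - k\<^sup>2 + b1 * (r\<^sup>2 - 1)) / (k * r)"
      "l - d = (k * l * r + k\<^sup>2 - b1 * (r\<^sup>2 - 1)) / (k * r)"
      unfolding d N_def using k r by (simp_all add: field_simps)
  qed (fact bc)+
  have A10: "A10_of (A11_of b c d l) (A0_of a) (mat2 B11 B12 B21 B22) = mat2
                     (B21 * l - l * r - 2 * r) (- ((B21 * l * (r\<^sup>2 + 1) - r * (r\<^sup>2 - 1)) / (B21 * l * r)))
                     (B21 * l * (B21 * l - r) / r) (- l * (B21 + r))
                 + ((b - 1) * (1 - r\<^sup>2)) *\<^sub>R mat2
                     ((- B21\<^sup>2 * l\<^sup>2 + 2 * B21 * r * l * (l + 1)) / (B21 * l * ((b - 1) * (1 - r\<^sup>2) + B21\<^sup>2 * l\<^sup>2)))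
                     ((r - 1) * (r + 1) / (B21\<^sup>2 * l\<^sup>2 * r))
                     ((r\<^sup>2 + 1) / (r * (1 - r\<^sup>2)))
                     ((B21\<^sup>2 * l\<^sup>2 + 2 * B21 * l * r * (l + 1)) / (B21 * l * ((b - 1) * (1 - r\<^sup>2) + B21\<^sup>2 * l\<^sup>2)))
                 + (- ((b - 1)\<^sup>2 * (1 - r\<^sup>2)\<^sup>2) / (B21 * l * ((b - 1) * (1 - r\<^sup>2) + B21\<^sup>2 * l\<^sup>2)))
                     *\<^sub>R mat2 1 0 0 (-1)"
    unfolding Bl b1_def[symmetric] Nc
    by (rule mat2_eqI; unfold co vector_add_component vector_scaleR_component mat2_nth real_scaleR_def)
      (simp_all only: en mult_1_right mult_minus1_right mult_zero_right add_0_right)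
  have A0: "A0_of a = ((l + 1) * ((b - 1) * (r - 1)\<^sup>2 + B21\<^sup>2 * l\<^sup>2) * ((b - 1) * (r + 1)\<^sup>2 + B21\<^sup>2 * l\<^sup>2)
                      / (2 * B21 * l * r * ((b - 1) * (1 - r\<^sup>2) + B21\<^sup>2 * l\<^sup>2))) *\<^sub>R mat2 1 0 0 (-1)"
  proof -
    have "a = (l + 1) * s2 / (2 * k * r * N)"
      using a k r N by (simp add: eq_divide_eq mult_ac)
    also have "(l + 1) * s2 = (l + 1) * (b1 * (r - 1)\<^sup>2 + k\<^sup>2) * (b1 * (r + 1)\<^sup>2 + k\<^sup>2)"
      unfolding s2_def by (simp add: add.commute)
    finally show ?thesis
      unfolding Bl b1_def[symmetric] Nc A0_of_def
      by (intro mat2_eqI) (unfold vector_scaleR_component mat2_nth real_scaleR_def, simp_all)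
  qed
  have D: "D = hyp_op (cmat (A11_of b c d l)) (cmat (A10_of (A11_of b c d l) (A0_of a) (mat2 B11 B12 B21 B22))) (cmat (A0_of a))"
    by (rule D_eq)
  have g': "g = (l + 1) * r * (B21\<^sup>2 * l\<^sup>2 + (b - 1) * (r\<^sup>2 - 1)) / (B21\<^sup>2 * l\<^sup>2 - (b - 1) * (r\<^sup>2 - 1))"
  proof -
    have "k\<^sup>2 - b1 * (1 - r\<^sup>2) = k\<^sup>2 + b1 * (r\<^sup>2 - 1)" "N = k\<^sup>2 - b1 * (r\<^sup>2 - 1)"
      unfolding N_def by (simp_all add: algebra_simps)
    then show ?thesis using g unfolding Bl b1_def[symmetric] by (simp only:)
  qed
  have "\<exists>s. s\<^sup>2 = s2 \<and> s \<noteq> 0 \<and>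
    similar_to_form W l g 1 1 (\<lambda>x. sym_with_det (1 / (1 - x\<^sup>2)) (1 / ((1 - x\<^sup>2) * s) * \<eta> x) (1 / ((1 - x\<^sup>2) * s) * \<zeta> x))"
    by (rule similar_of_solution[OF C(1) _ C(2), of "- 1"]) (use sol in simp_all)
  then obtain s where s: "s\<^sup>2 = s2"
    and sim: "similar_to_form W l g 1 1 (\<lambda>x. sym_with_det (1 / (1 - x\<^sup>2)) (1 / ((1 - x\<^sup>2) * s) * \<eta> x) (1 / ((1 - x\<^sup>2) * s) * \<zeta> x))"
    by blast
  have "(\<lambda>x. sym_with_det (1 / (1 - x\<^sup>2)) (1 / ((1 - x\<^sup>2) * s) * \<eta> x) (1 / ((1 - x\<^sup>2) * s) * \<zeta> x)) = Q_III b l r B21 s"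
  proof
    fix x
    have "1 / t * (k * y) = k / t * y" for t y :: real by simp
    then show "sym_with_det (1 / (1 - x\<^sup>2)) (1 / ((1 - x\<^sup>2) * s) * \<eta> x) (1 / ((1 - x\<^sup>2) * s) * \<zeta> x) = Q_III b l r B21 s x"
      unfolding Q_III_def \<eta>_def \<zeta>_def Bl b1_def[symmetric] by (simp only:)
  qed
  then have sim': "similar_to_form W l g 1 1 (Q_III b l r B21 s)" using sim by (simp only:)
  show ?thesis
  proof (rule exI[of _ r], rule exI[of _ s], intro conjI)
    show "s\<^sup>2 = (B21\<^sup>2 * l\<^sup>2 + (b - 1) * (r - 1)\<^sup>2) * (B21\<^sup>2 * l\<^sup>2 + (b - 1) * (r + 1)\<^sup>2)"
      unfolding s s2_def Bl b1_def[symmetric] ..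
  qed (rule r2 g' sim' D[unfolded A10, unfolded A11, unfolded A0])+
qed

end

section \<open>The weights of all irreducible pairs\<close>

theorem theorem1p7:
  fixes W :: "real \<Rightarrow> complex^2^2" and D :: "2 diff_op"
    and a b c d l B11 B12 B21 B22 \<gamma> :: real
    and pt :: point
  assumes pt: "pt = (a, b, c, d, l, B11, B12, B21, B22)"
    and in_space: "pt \<in> classifying_space"
    and pair: "corresponds_to W D pt"
    and gamma: "\<gamma> = gamma_of (A11_of b c d l) (mat2 B11 B12 B21 B22)"
  shows "\<gamma> = 1 / 2 * ((l + d) * B11 + (b + c) * B21 + (b - c) * B12 + (l - d) * B22)
    \<and> (\<exists>Q \<sigma>m \<sigma>p. \<sigma>m \<in> {0, 1} \<and> \<sigma>p \<in> {0, 1} \<and> rational_on_interval Q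
          \<and> (\<forall>x\<in>{-1<..<1}. transpose (Q x) = Q x) \<and> weight_of_form W l \<gamma> \<sigma>m \<sigma>p Q)
    \<and> (\<exists>U. invertible U \<and> (\<forall>x\<in>{-1<..<1}. det (conj_weight U W x)
          = complex_of_real ((1 - x) powr (- l - 2 + \<gamma>) * (1 + x) powr (- l - 2 - \<gamma>))))
    \<and> (family_I pt \<and> a \<noteq> 1 \<longrightarrow> (let r = l / (a - 1) in
          \<gamma> = a * r * B22
          \<and> D = hyp_op
              (cmat (mat2 l 0 0 l))
              (cmat (mat2 (- B22 * l * ((a + 1) / (a - 1))) (- 2 * a - l)
                          (1 / (2 * a + l) * (B22\<^sup>2 * (l\<^sup>2 / (a - 1)\<^sup>2) - 4)) (- B22 * l)))
              (cmat (mat2 a 0 0 (- a)))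
          \<and> (\<exists>s. s\<^sup>2 = (r - 2) * (a - 1) * ((r + 2) * a - (r - 2)) / (4 - r\<^sup>2 * B22\<^sup>2)
                \<and> similar_to_form W l \<gamma> 0 0 (Q_I a r B22 s))))
    \<and> (family_II pt \<longrightarrow> (let r = 4 * a - 2 * l - 1 in
          \<gamma> = r * (1 - 2 * a * B21) + l
          \<and> D = hyp_op
              (cmat (mat2 (l - 1 / 2) 2 0 (l + 1 / 2)))
              (cmat (mat2 (l - 1 / 2) 2 0 (l + 1 / 2)
                   + mat2 ((2 * a + 1) * r * B21 - 4 * a) (- 2 * r * B21 + 4)
                          (r / 2 * B21) ((2 * a - 1) * r * B21 - 4 * a + 2)))
              (cmat (mat2 a 0 0 (- a)))
          \<and> (\<exists>s. s\<^sup>2 = a * (3 - 4 * a + 2 * l) / (B21 * r)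
                \<and> similar_to_form W l \<gamma> 0 1 (Q_II a l r B21 s))))
    \<and> (family_III pt \<longrightarrow> (\<exists>r s.
          r\<^sup>2 = 1 - l\<^sup>2 * B12 * B21
          \<and> s\<^sup>2 = (B21\<^sup>2 * l\<^sup>2 + (b - 1) * (r - 1)\<^sup>2) * (B21\<^sup>2 * l\<^sup>2 + (b - 1) * (r + 1)\<^sup>2)
          \<and> \<gamma> = (l + 1) * r * (B21\<^sup>2 * l\<^sup>2 + (b - 1) * (r\<^sup>2 - 1)) / (B21\<^sup>2 * l\<^sup>2 - (b - 1) * (r\<^sup>2 - 1))
          \<and> D = hyp_op
              (cmat (mat2
                 ((B21 * l\<^sup>2 * r - B21\<^sup>2 * l\<^sup>2 + (b - 1) * (r\<^sup>2 - 1)) / (B21 * l * r)) 2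
                 (2 * b - 2) ((B21 * l\<^sup>2 * r + B21\<^sup>2 * l\<^sup>2 - (b - 1) * (r\<^sup>2 - 1)) / (B21 * l * r))))
              (cmat (mat2
                     (B21 * l - l * r - 2 * r) (- ((B21 * l * (r\<^sup>2 + 1) - r * (r\<^sup>2 - 1)) / (B21 * l * r)))
                     (B21 * l * (B21 * l - r) / r) (- l * (B21 + r))
                 + ((b - 1) * (1 - r\<^sup>2)) *\<^sub>R mat2
                     ((- B21\<^sup>2 * l\<^sup>2 + 2 * B21 * r * l * (l + 1)) / (B21 * l * ((b - 1) * (1 - r\<^sup>2) + B21\<^sup>2 * l\<^sup>2)))
                     ((r - 1) * (r + 1) / (B21\<^sup>2 * l\<^sup>2 * r))
                     ((r\<^sup>2 + 1) / (r * (1 - r\<^sup>2)))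
                     ((B21\<^sup>2 * l\<^sup>2 + 2 * B21 * l * r * (l + 1)) / (B21 * l * ((b - 1) * (1 - r\<^sup>2) + B21\<^sup>2 * l\<^sup>2)))
                 + (- ((b - 1)\<^sup>2 * (1 - r\<^sup>2)\<^sup>2) / (B21 * l * ((b - 1) * (1 - r\<^sup>2) + B21\<^sup>2 * l\<^sup>2)))
                     *\<^sub>R mat2 1 0 0 (-1)))
              (cmat (((l + 1) * ((b - 1) * (r - 1)\<^sup>2 + B21\<^sup>2 * l\<^sup>2) * ((b - 1) * (r + 1)\<^sup>2 + B21\<^sup>2 * l\<^sup>2)
                      / (2 * B21 * l * r * ((b - 1) * (1 - r\<^sup>2) + B21\<^sup>2 * l\<^sup>2))) *\<^sub>R mat2 1 0 0 (-1)))
          \<and> similar_to_form W l \<gamma> 1 1 (Q_III b l r B21 s)))"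
proof -
  have co: "has_coordinates W D (a, b, c, d, l, B11, B12, B21, B22)" and p: "bochner_pair W D"
    and re: "real_pair W D" and ir: "\<not> reducible_pair W D"
    using pair unfolding corresponds_to_def pt by auto
  have D: "D = hyp_op (cmat (A11_of b c d l)) (cmat (A10_of (A11_of b c d l) (A0_of a) (mat2 B11 B12 B21 B22))) (cmat (A0_of a))"
    and quo: "moment W 1 ** matrix_inv (moment W 0) = cmat (mat2 B11 B12 B21 B22)"
    using co unfolding has_coordinates.simps Let_def by auto
  obtain u v z where rw: "real_weight W D (A11_of b c d l) (A10_of (A11_of b c d l) (A0_of a) (mat2 B11 B12 B21 B22)) a u v z"
    using real_weight_of_pair[OF p re D] by blast
  have g: "\<gamma> = 1 / 2 * ((l + d) * B11 + (b + c) * B21 + (b - c) * B12 + (l - d) * B22)"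
    unfolding gamma by (rule gamma_of_eq)
  interpret coordinates W D b c d l B11 B12 B21 B22 a u v z \<gamma>
    by (intro coordinates.intro coordinates_axioms.intro rw ir quo g)
  have "family_I pt \<or> family_II pt \<or> family_III pt"
    using in_space by (auto simp: classifying_space_def)
  then have rational: "\<exists>Q \<sigma>m \<sigma>p. \<sigma>m \<in> {0, 1} \<and> \<sigma>p \<in> {0, 1} \<and> rational_on_interval Q
          \<and> (\<forall>x\<in>{-1<..<1}. transpose (Q x) = Q x) \<and> weight_of_form W l \<gamma> \<sigma>m \<sigma>p Q"
  proof (elim disjE)
    assume "family_I pt"
    then obtain Q where Q: "rational_on_interval Q" "\<forall>x\<in>{-1<..<1}. transpose (Q x) = Q x" "weight_of_form W l \<gamma> 0 0 Q"
      using family_I_rational unfolding pt by blast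
    show ?thesis
      by (rule exI[of _ Q], rule exI[of _ 0], rule exI[of _ 0], intro conjI) (rule Q | simp)+
  next
    assume "family_II pt"
    then obtain Q where Q: "rational_on_interval Q" "\<forall>x\<in>{-1<..<1}. transpose (Q x) = Q x" "weight_of_form W l \<gamma> 0 1 Q"
      using family_II_rational unfolding pt by blast
    show ?thesis
      by (rule exI[of _ Q], rule exI[of _ 0], rule exI[of _ 1], intro conjI) (rule Q | simp)+
  next
    assume "family_III pt"
    then obtain Q where Q: "rational_on_interval Q" "\<forall>x\<in>{-1<..<1}. transpose (Q x) = Q x" "weight_of_form W l \<gamma> 1 1 Q"
      using family_III_rational unfolding pt by blast
    show ?thesis
      by (rule exI[of _ Q], rule exI[of _ 1], rule exI[of _ 1], intro conjI) (rule Q | simp)+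
  qed
  show ?thesis
    unfolding pt
    by (rule conjI[OF g conjI[OF rational conjI[OF det_claim conjI[OF _ conjI]]]]; rule impI; (elim conjE)?)
      (rule family_I_form family_II_form family_III_form; assumption)+
qed

end
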